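(* Let $G$ be a finite simple graph on the vertex set $[n]$ and let $A_1,\ldots,A_r$ be a partition of $[n]$ into disjoint subsets such that each $A_i$ is a clique in $G$ (some $A_i$ are allowed to be empty). For each $i=1,\ldots,r$ let $B_i=\{y_{i,1},\ldots,y_{i,s_i}\}$ be a non-empty finite set of new vertices (with $s_i\ge 1$ elements), the sets $B_1,\ldots,B_r$ being pairwise disjoint and disjoint from $[n]$. Let $G'=G_{A_1,\ldots,A_r}^{B_1,\ldots,B_r}$ be the hybrid graph of $G$ with respect to $B_1,\ldots,B_r$, let $\Delta'$ be the independence complex of $G'$, let $K$ be a field, and let $S=K[\{x_i : i=1,\ldots,n\}\cup\{y_{i,j} : i=1,\ldots,r,\ j=1,\ldots,s_i\}]$ be the polynomial ring. Then: (i) $\Delta'$ is pure shellable of dimension $r-1$. (ii) The ring $S/I(G')$ is Cohen--Macaulay of dimension $r$.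
   Context: A clique of a graph is a set of vertices whose induced subgraph is complete (the empty set counts as a clique). Hybrid graph: given $G$, $A_1,\ldots,A_r$ and $B_1,\ldots,B_r$ as in the claim, $G_{A_1,\ldots,A_r}^{B_1,\ldots,B_r}$ is the simple graph on the vertex set $[n]\cup B_1\cup\cdots\cup B_r$ whose edge set is $$E(G)\cup\bigcup_{i=1}^r\{F\subset A_i\cup B_i : |F|=2\}.$$ The independence complex of a graph is the simplicial complex whose faces are the independent sets of vertices (sets containing no edge). The dimension of a face $F$ is $|F|-1$, and the dimension of a complex is the maximum dimension of its faces. A simplicial complex is pure if all its facets (maximal faces) have the same cardinality. It is shellable if its facets can be totally ordered $F_1,\ldots,F_t$ so that for $2\le i\le t$ the complex $\langle F_1,\ldots,F_{i-1}\rangle\cap\langle F_i\rangle$ is generated by a non-empty set of maximal proper faces of $F_i$; equivalently, for all $j<i$ there exist $x\in F_i\setminus F_j$ and $k<i$ with $F_i\setminus F_k=\{x\}$. The vertex $i\in[n]$ is identified with the variable $x_i$, and the vertex $y_{i,j}$ with the variable of the same name. The edge ideal $I(G')\subset S$ is the ideal generated by the products of the two variables corresponding to the endpoints of each edge of $G'$. *)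

theory Defs
  imports
    Complex_Main
    "HOL-Library.Disjoint_Sets"
    "HOL-Library.Extended_Nat"
    "HOL-Library.Poly_Mapping"
    "HOL-Algebra.QuotRing"
    "HOL-Algebra.Ring_Divisibility"
begin

record 'v sgraph =
  verts :: "'v set"
  edges :: "'v set set"

definition simple_graph :: "'v sgraph \<Rightarrow> bool" where
  "simple_graph G \<longleftrightarrow>
     finite (verts G) \<and> (\<forall>e\<in>edges G. e \<subseteq> verts G \<and> card e = 2)"

definition clique :: "'v sgraph \<Rightarrow> 'v set \<Rightarrow> bool" where
  "clique G W \<longleftrightarrow> W \<subseteq> verts G \<and> (\<forall>F. F \<subseteq> W \<and> card F = 2 \<longrightarrow> F \<in> edges G)"

definition hybrid_graph ::
    "'v sgraph \<Rightarrow> nat \<Rightarrow> (nat \<Rightarrow> 'v set) \<Rightarrow> (nat \<Rightarrow> 'v set) \<Rightarrow> 'v sgraph" where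
  "hybrid_graph G r A B =
     \<lparr>verts = verts G \<union> (\<Union>i\<in>{1..r}. B i),
      edges = edges G \<union> (\<Union>i\<in>{1..r}. {F. F \<subseteq> A i \<union> B i \<and> card F = 2})\<rparr>"

text \<open>The vertices \<open>i\<close> of \<open>[n]\<close> (identified with the variables \<open>x\<^sub>i\<close>) and the new vertices
  \<open>y\<^sub>i\<^sub>j\<close>.\<close>
datatype vertex = XVar nat | YVar nat nat

definition independence_complex :: "'v sgraph \<Rightarrow> 'v set set" where
  "independence_complex G = {F. F \<subseteq> verts G \<and> (\<forall>e\<in>edges G. \<not> e \<subseteq> F)}"

definition facets :: "'v set set \<Rightarrow> 'v set set" where
  "facets \<Delta> = {F\<in>\<Delta>. \<forall>H\<in>\<Delta>. F \<subseteq> H \<longrightarrow> H = F}"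

text \<open>Integer-valued, since the complex \<open>{{}}\<close> has dimension \<open>-1\<close>; only meaningful for finite
  nonempty complexes.\<close>
definition complex_dim :: "'v set set \<Rightarrow> int" where
  "complex_dim \<Delta> = Max ((\<lambda>F. int (card F) - 1) ` \<Delta>)"

definition pure_complex :: "'v set set \<Rightarrow> bool" where
  "pure_complex \<Delta> \<longleftrightarrow> (\<forall>F\<in>facets \<Delta>. \<forall>H\<in>facets \<Delta>. card F = card H)"

definition generated_complex :: "'v set set \<Rightarrow> 'v set set" where
  "generated_complex M = (\<Union>F\<in>M. Pow F)"

text \<open>\<open>facets (Pow F - {F})\<close> is the set of maximal proper faces of \<open>F\<close>.\<close>
definition shellable :: "'v set set \<Rightarrow> bool" where
  "shellable \<Delta> \<longleftrightarrow>
     (\<exists>Fs. distinct Fs \<and> set Fs = facets \<Delta> \<and>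
       (\<forall>i. 1 \<le> i \<and> i < length Fs \<longrightarrow>
          (\<exists>M. M \<noteq> {} \<and> M \<subseteq> facets (Pow (Fs ! i) - {Fs ! i}) \<and>
             generated_complex (set (take i Fs)) \<inter> generated_complex {Fs ! i}
               = generated_complex M)))"

text \<open>Monomials are finitely supported exponent functions \<open>'v \<Rightarrow>\<^sub>0 nat\<close>; the carrier restricts the
  variables to \<open>V\<close>.\<close>
definition polynomial_ring ::
    "'v set \<Rightarrow> (('v \<Rightarrow>\<^sub>0 nat) \<Rightarrow>\<^sub>0 'k::field) ring" where
  "polynomial_ring V =
     \<lparr>carrier = {p. \<forall>m\<in>Poly_Mapping.keys p. Poly_Mapping.keys m \<subseteq> V},
      monoid.mult = (*), one = 1, zero = 0, add = (+)\<rparr>"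

definition var :: "'v \<Rightarrow> (('v \<Rightarrow>\<^sub>0 nat) \<Rightarrow>\<^sub>0 'k::field)" where
  "var v = Poly_Mapping.single (Poly_Mapping.single v 1) 1"

definition edge_ideal :: "'v sgraph \<Rightarrow> (('v \<Rightarrow>\<^sub>0 nat) \<Rightarrow>\<^sub>0 'k::field) set" where
  "edge_ideal G = Idl\<^bsub>polynomial_ring (verts G)\<^esub> {var u * var v | u v. {u, v} \<in> edges G}"

text \<open>\<open>S\<inverse>R\<close> as classes of pairs \<open>(a, s)\<close>; the factor \<open>u\<close> is needed because \<open>R\<close> may have zero
  divisors.\<close>
definition frac_rel :: "('a, 'b) ring_scheme \<Rightarrow> 'a set \<Rightarrow> (('a \<times> 'a) \<times> ('a \<times> 'a)) set" where
  "frac_rel R S = {((a, s), (b, t)) | a s b t.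
     a \<in> carrier R \<and> b \<in> carrier R \<and> s \<in> S \<and> t \<in> S \<and>
     (\<exists>u\<in>S. u \<otimes>\<^bsub>R\<^esub> (a \<otimes>\<^bsub>R\<^esub> t) = u \<otimes>\<^bsub>R\<^esub> (b \<otimes>\<^bsub>R\<^esub> s))}"

definition fraction :: "('a, 'b) ring_scheme \<Rightarrow> 'a set \<Rightarrow> 'a \<Rightarrow> 'a \<Rightarrow> ('a \<times> 'a) set" where
  "fraction R S a s = frac_rel R S `` {(a, s)}"

definition localization ::
    "('a, 'b) ring_scheme \<Rightarrow> 'a set \<Rightarrow> ('a \<times> 'a) set ring" where
  "localization R S =
     \<lparr>carrier = (carrier R \<times> S) // frac_rel R S,
      monoid.mult = (\<lambda>P Q. \<Union>(a, s)\<in>P. \<Union>(b, t)\<in>Q. fraction R S (a \<otimes>\<^bsub>R\<^esub> b) (s \<otimes>\<^bsub>R\<^esub> t)),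
      one = fraction R S \<one>\<^bsub>R\<^esub> \<one>\<^bsub>R\<^esub>,
      zero = fraction R S \<zero>\<^bsub>R\<^esub> \<one>\<^bsub>R\<^esub>,
      add = (\<lambda>P Q. \<Union>(a, s)\<in>P. \<Union>(b, t)\<in>Q.
               fraction R S (a \<otimes>\<^bsub>R\<^esub> t \<oplus>\<^bsub>R\<^esub> b \<otimes>\<^bsub>R\<^esub> s) (s \<otimes>\<^bsub>R\<^esub> t))\<rparr>"

definition localization_at :: "('a, 'b) ring_scheme \<Rightarrow> 'a set \<Rightarrow> ('a \<times> 'a) set ring" where
  "localization_at R P = localization R (carrier R - P)"

text \<open>Supremum of the lengths \<open>n\<close> of chains \<open>P\<^sub>0 \<subset> \<dots> \<subset> P\<^sub>n\<close> of prime ideals. (The zero ring gets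
  the value 0.)\<close>
definition krull_dim :: "('a, 'b) ring_scheme \<Rightarrow> enat" where
  "krull_dim R = Sup {enat n | n. \<exists>P :: nat \<Rightarrow> 'a set.
     (\<forall>i\<le>n. primeideal (P i) R) \<and> (\<forall>i<n. P i \<subset> P (Suc i))}"

definition regular_sequence :: "('a, 'b) ring_scheme \<Rightarrow> 'a list \<Rightarrow> bool" where
  "regular_sequence R xs \<longleftrightarrow>
     set xs \<subseteq> carrier R \<and>
     (\<forall>i<length xs. \<forall>a\<in>carrier R.
        xs ! i \<otimes>\<^bsub>R\<^esub> a \<in> Idl\<^bsub>R\<^esub> (set (take i xs)) \<longrightarrow> a \<in> Idl\<^bsub>R\<^esub> (set (take i xs))) \<and>
     Idl\<^bsub>R\<^esub> (set xs) \<noteq> carrier R"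

definition depth :: "'a set \<Rightarrow> ('a, 'b) ring_scheme \<Rightarrow> enat" where
  "depth I R = Sup {enat (length xs) | xs. regular_sequence R xs \<and> set xs \<subseteq> I}"

definition noetherian_local_ring :: "('a, 'b) ring_scheme \<Rightarrow> bool" where
  "noetherian_local_ring R \<longleftrightarrow> cring R \<and> noetherian_ring R \<and> (\<exists>!M. maximalideal M R)"

definition cohen_macaulay_local :: "('a, 'b) ring_scheme \<Rightarrow> bool" where
  "cohen_macaulay_local R \<longleftrightarrow>
     noetherian_local_ring R \<and> (\<forall>M. maximalideal M R \<longrightarrow> depth M R = krull_dim R)"

text \<open>For a general ring: Noetherian, with Cohen--Macaulay local rings at all maximal ideals,
  not only at the graded one.\<close>
definition cohen_macaulay :: "('a, 'b) ring_scheme \<Rightarrow> bool" where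
  "cohen_macaulay R \<longleftrightarrow>
     cring R \<and> noetherian_ring R \<and>
     (\<forall>M. maximalideal M R \<longrightarrow> cohen_macaulay_local (localization_at R M))"

end

theory Submission
  imports Defs "HOL-Computational_Algebra.Polynomial"
begin

text \<open>
  In the hybrid graph every block \<open>C\<^sub>i = A\<^sub>i \<union> B\<^sub>i\<close> is a clique, and it contains a vertex \<open>z\<^sub>i\<close> (the first vertex of \<open>B\<^sub>i\<close>) all of whose
  neighbours lie in the block. An independent set therefore has at most one vertex in each block, and one that misses
  a block can be enlarged by \<open>z\<^sub>i\<close>. So the facets are independent transversals of the \<open>r\<close> blocks, which gives purity and the dimension.
  Ordering the facets by the number of their vertices that are not among the \<open>z\<^sub>i\<close> gives a shelling: replacing such a
  vertex by the \<open>z\<^sub>i\<close> of its block leads to an earlier facet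
  (\<open>shellable_faces\<close>).

  For the algebra put \<open>\<theta>\<^sub>i = \<Sum>v\<in>C\<^sub>i. x\<^sub>v\<close>. The claim is that for all nonzero
  polynomials \<open>f\<^sub>i\<close> in one variable the sequence \<open>f\<^sub>1(\<theta>\<^sub>1), \<dots>, f\<^sub>r(\<theta>\<^sub>r)\<close> is regular on \<open>S/I(G')\<close>, apart from the
  requirement that it generate a proper ideal
  (\<open>block_sums_regular\<close>). For a vertex \<open>v\<close> different from the \<open>z\<^sub>i\<close> the ideals \<open>I + (x\<^sub>v)\<close> and \<open>I : x\<^sub>v\<close>
  are Stanley--Reisner ideals of smaller complexes of the same kind, and regularity passes from the two ends
  of the exact sequence of \<open>v\<close> to its middle (\<open>weakly_regular_extension\<close>). The induction ends with a polynomial ring in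
  the \<open>z\<^sub>i\<close>, where the claim is that of \<open>weakly_regular_vars\<close>.

  By Zariski's lemma (\<open>zariski\<close>) every maximal ideal \<open>M\<close> of \<open>S/I(G')\<close> contains nonzero polynomials
  \<open>f\<^sub>i(\<theta>\<^sub>i)\<close>, hence a regular sequence of length \<open>r\<close>. This gives \<open>r \<le> depth\<close> for the localization at \<open>M\<close>.
  Depth is at most dimension, since a regular sequence yields a chain of primes of the same length
  (\<open>regular_sequence_prime_chain\<close>). Finally, no chain of primes of \<open>S/I(G')\<close> has length greater than \<open>r\<close>
  (\<open>prime_chain_length_le\<close>): elements chosen from the steps of a chain are algebraically independent, but the number of monomials
  supported on faces grows like a polynomial of degree at most \<open>r\<close> in the bound on their exponents, so any \<open>r + 1\<close> elements are algebraically dependent. The three inequalities are combined in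
  \<open>cohen_macaulay_criterion\<close>, at all maximal ideals at once.

  The commutative algebra of polynomials is done inside the type of all polynomials, with subrings and ideals as sets
  and congruences modulo a prime instead of quotient rings. Only the last steps pass to the rings with a carrier and
  their localizations.
\<close>

section \<open>Subrings generated by one element\<close>

definition is_subring :: "'a::comm_ring_1 set \<Rightarrow> bool" where
  "is_subring A \<longleftrightarrow> 1 \<in> A \<and> (\<forall>x\<in>A. \<forall>y\<in>A. x - y \<in> A \<and> x * y \<in> A)"

definition ideal_of :: "'a::comm_ring_1 set \<Rightarrow> 'a set \<Rightarrow> bool" where
  "ideal_of C J \<longleftrightarrow> J \<subseteq> C \<and> 0 \<in> J \<and> (\<forall>x\<in>J. \<forall>y\<in>J. x + y \<in> J) \<and> (\<forall>c\<in>C. \<forall>x\<in>J. c * x \<in> J)"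

definition prime_of :: "'a::comm_ring_1 set \<Rightarrow> 'a set \<Rightarrow> bool" where
  "prime_of C P \<longleftrightarrow> ideal_of C P \<and> 1 \<notin> P \<and> (\<forall>x\<in>C. \<forall>y\<in>C. x * y \<in> P \<longrightarrow> x \<in> P \<or> y \<in> P)"

definition polys_over :: "'a::comm_ring_1 set \<Rightarrow> 'a poly set" where
  "polys_over A = {f. \<forall>i. poly.coeff f i \<in> A}"

definition adjoin :: "'a::comm_ring_1 set \<Rightarrow> 'a \<Rightarrow> 'a set" where
  "adjoin A x = (\<lambda>f. poly f x) ` polys_over A"

lemma is_subringD:
  assumes "is_subring A"
  shows "1 \<in> A" "0 \<in> A" "x \<in> A \<Longrightarrow> y \<in> A \<Longrightarrow> x - y \<in> A"
    "x \<in> A \<Longrightarrow> y \<in> A \<Longrightarrow> x * y \<in> A" "x \<in> A \<Longrightarrow> - x \<in> A"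
    "x \<in> A \<Longrightarrow> y \<in> A \<Longrightarrow> x + y \<in> A" "x \<in> A \<Longrightarrow> x ^ n \<in> A"
proof -
  show 1: "1 \<in> A" and m: "\<And>x y. x \<in> A \<Longrightarrow> y \<in> A \<Longrightarrow> x - y \<in> A"
    and t: "\<And>x y. x \<in> A \<Longrightarrow> y \<in> A \<Longrightarrow> x * y \<in> A"
    using assms by (auto simp: is_subring_def)
  show 0: "0 \<in> A" using m[OF 1 1] by simp
  show n: "- x \<in> A" if "x \<in> A" for x using m[OF 0 that] by simp
  show "x \<in> A \<Longrightarrow> y \<in> A \<Longrightarrow> x + y \<in> A" using m[of x "- y"] n[of y] by simp
  show "x \<in> A \<Longrightarrow> x ^ n \<in> A" by (induction n) (auto simp: 1 t)
qed

lemma is_subring_sum: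
  "is_subring A \<Longrightarrow> (\<And>i. i \<in> T \<Longrightarrow> f i \<in> A) \<Longrightarrow> (\<Sum>i\<in>T. f i) \<in> A"
  by (induction T rule: infinite_finite_induct) (auto simp: is_subringD)

lemma ideal_ofD:
  assumes "ideal_of C J" "is_subring C"
  shows "x \<in> J \<Longrightarrow> x \<in> C" "0 \<in> J" "x \<in> J \<Longrightarrow> y \<in> J \<Longrightarrow> x + y \<in> J" "c \<in> C \<Longrightarrow> x \<in> J \<Longrightarrow> c * x \<in> J"
    "c \<in> C \<Longrightarrow> x \<in> J \<Longrightarrow> x * c \<in> J" "x \<in> J \<Longrightarrow> - x \<in> J" "x \<in> J \<Longrightarrow> y \<in> J \<Longrightarrow> x - y \<in> J"
proof -
  show "x \<in> J \<Longrightarrow> x \<in> C" "0 \<in> J" and a: "\<And>x y. x \<in> J \<Longrightarrow> y \<in> J \<Longrightarrow> x + y \<in> J"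
    and t: "\<And>c x. c \<in> C \<Longrightarrow> x \<in> J \<Longrightarrow> c * x \<in> J"
    using assms by (auto simp: ideal_of_def)
  show "c \<in> C \<Longrightarrow> x \<in> J \<Longrightarrow> x * c \<in> J" using t[of c x] by (simp add: mult.commute)
  show n: "- x \<in> J" if "x \<in> J" for x
    using t[of "- 1" x] that is_subringD[OF assms(2)] by simp
  show "x \<in> J \<Longrightarrow> y \<in> J \<Longrightarrow> x - y \<in> J" using a[of x "- y"] n[of y] by simp
qed

lemma ideal_of_sum:
  "ideal_of C J \<Longrightarrow> (\<And>i. i \<in> T \<Longrightarrow> f i \<in> J) \<Longrightarrow> (\<Sum>i\<in>T. f i) \<in> J"
  by (induction T rule: infinite_finite_induct) (auto simp: ideal_of_def)

lemma polys_over_closed: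
  assumes "is_subring A" "f \<in> polys_over A" "g \<in> polys_over A"
  shows "f - g \<in> polys_over A" "f + g \<in> polys_over A" "f * g \<in> polys_over A" "- f \<in> polys_over A"
  using assms unfolding polys_over_def
  by (auto simp: is_subringD coeff_mult intro!: is_subring_sum)

lemma polys_over_pCons:
  "a \<in> A \<Longrightarrow> f \<in> polys_over A \<Longrightarrow> pCons a f \<in> polys_over A"
  unfolding polys_over_def by (auto simp: coeff_pCons split: nat.splits)

lemma polys_over_zero: "is_subring A \<Longrightarrow> 0 \<in> polys_over A"
  unfolding polys_over_def by (auto simp: is_subringD)

lemma polys_over_const: "is_subring A \<Longrightarrow> a \<in> A \<Longrightarrow> [:a:] \<in> polys_over A"
  by (intro polys_over_pCons polys_over_zero)

lemma polys_over_smult: "is_subring A \<Longrightarrow> a \<in> A \<Longrightarrow> f \<in> polys_over A \<Longrightarrow> smult a f \<in> polys_over A"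
  unfolding polys_over_def by (auto simp: is_subringD)

lemma polys_over_monom: "is_subring A \<Longrightarrow> a \<in> A \<Longrightarrow> Polynomial.monom a n \<in> polys_over A"
  unfolding polys_over_def by (auto simp: is_subringD)

lemma is_subring_adjoin:
  assumes "is_subring A"
  shows "is_subring (adjoin A x)"
  unfolding is_subring_def adjoin_def
proof (intro conjI ballI)
  show "1 \<in> (\<lambda>f. poly f x) ` polys_over A"
    using polys_over_const[OF assms is_subringD(1)[OF assms]] by (force simp: image_iff)
next
  fix a b assume "a \<in> (\<lambda>f. poly f x) ` polys_over A" "b \<in> (\<lambda>f. poly f x) ` polys_over A"
  then obtain f g where fg: "f \<in> polys_over A" "g \<in> polys_over A" "a = poly f x" "b = poly g x" by blast
  show "a - b \<in> (\<lambda>f. poly f x) ` polys_over A"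
    using polys_over_closed(1)[OF assms fg(1,2)] fg by (force simp: image_iff)
  show "a * b \<in> (\<lambda>f. poly f x) ` polys_over A"
    using polys_over_closed(3)[OF assms fg(1,2)] fg by (force simp: image_iff)
qed

lemma subset_adjoin: "is_subring A \<Longrightarrow> A \<subseteq> adjoin A x"
proof
  fix a assume "is_subring A" "a \<in> A"
  then show "a \<in> adjoin A x"
    unfolding adjoin_def by (intro image_eqI[of _ _ "[:a:]"]) (auto intro: polys_over_const)
qed

lemma self_in_adjoin: "is_subring A \<Longrightarrow> x \<in> adjoin A x"
  unfolding adjoin_def
  by (intro image_eqI[of _ _ "[:0, 1:]"]) (auto intro!: polys_over_pCons polys_over_zero simp: is_subringD)

lemma poly_in_subring:
  assumes "is_subring C" "f \<in> polys_over C" "x \<in> C"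
  shows "poly f x \<in> C"
  unfolding poly_altdef using assms
  by (auto intro!: is_subring_sum is_subringD simp: polys_over_def)

lemma adjoin_subset: "is_subring C \<Longrightarrow> A \<subseteq> C \<Longrightarrow> x \<in> C \<Longrightarrow> adjoin A x \<subseteq> C"
  unfolding adjoin_def by (auto intro!: poly_in_subring simp: polys_over_def subset_iff)

section \<open>Hilbert's basis theorem\<close>

text \<open>The ascending chain condition for the ideals of a subring. Stated with chains, it passes to a
simple extension by comparing leading coefficients along the chain.\<close>

definition acc :: "'a::comm_ring_1 set \<Rightarrow> bool" where
  "acc A \<longleftrightarrow> (\<forall>J. (\<forall>n::nat. ideal_of A (J n)) \<and> (\<forall>n. J n \<subseteq> J (Suc n)) \<longrightarrow> (\<exists>n. \<forall>m\<ge>n. J m = J n))"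

text \<open>The representation of an element of \<open>A[x]\<close> by a polynomial need not be unique, since \<open>x\<close> may be
algebraic over \<open>A\<close>. Hence the bound \<open>n\<close> on the degree is recorded, and the \<open>n\<close>-th coefficient
is allowed to vanish.\<close>

definition lead_coeffs :: "'a::comm_ring_1 set \<Rightarrow> 'a \<Rightarrow> 'a set \<Rightarrow> nat \<Rightarrow> 'a set" where
  "lead_coeffs A x J n =
     {poly.coeff f n | f. f \<in> polys_over A \<and> degree f \<le> n \<and> poly f x \<in> J}"

lemma ideal_of_lead_coeffs:
  assumes A: "is_subring A" and J: "ideal_of (adjoin A x) J"
  shows "ideal_of A (lead_coeffs A x J n)"
proof -
  note J' = ideal_ofD[OF J is_subring_adjoin[OF A]]
  show ?thesis
    unfolding ideal_of_def
  proof (intro conjI ballI)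
    show "lead_coeffs A x J n \<subseteq> A" unfolding lead_coeffs_def polys_over_def by auto
    show "0 \<in> lead_coeffs A x J n" unfolding lead_coeffs_def
      using A J'(2) by (auto intro!: exI[of _ 0] polys_over_zero)
  next
    fix a b assume "a \<in> lead_coeffs A x J n" "b \<in> lead_coeffs A x J n"
    then obtain f g where
      "f \<in> polys_over A" "degree f \<le> n" "poly f x \<in> J" "a = poly.coeff f n"
      "g \<in> polys_over A" "degree g \<le> n" "poly g x \<in> J" "b = poly.coeff g n"
      unfolding lead_coeffs_def by auto
    then show "a + b \<in> lead_coeffs A x J n"
      unfolding lead_coeffs_def using A J'(3)
      by (auto intro!: exI[of _ "f + g"] polys_over_closed degree_add_le)
  next
    fix a b assume "a \<in> A" "b \<in> lead_coeffs A x J n"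
    moreover then obtain g where
      "g \<in> polys_over A" "degree g \<le> n" "poly g x \<in> J" "b = poly.coeff g n"
      unfolding lead_coeffs_def by auto
    ultimately show "a * b \<in> lead_coeffs A x J n"
      unfolding lead_coeffs_def using A J'(4)[of a] subset_adjoin[OF A, of x]
      by (auto intro!: exI[of _ "smult a g"] polys_over_smult order.trans[OF degree_smult_le])
  qed
qed

lemma lead_coeffs_mono: "J \<subseteq> J' \<Longrightarrow> lead_coeffs A x J n \<subseteq> lead_coeffs A x J' n"
  unfolding lead_coeffs_def by blast

lemma lead_coeffs_Suc:
  assumes A: "is_subring A" and J: "ideal_of (adjoin A x) J"
  shows "lead_coeffs A x J n \<subseteq> lead_coeffs A x J (Suc n)"
proof
  fix a assume "a \<in> lead_coeffs A x J n"
  then obtain f where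
    f: "f \<in> polys_over A" "degree f \<le> n" "poly f x \<in> J" "a = poly.coeff f n"
    unfolding lead_coeffs_def by auto
  have "x * poly f x \<in> J"
    using ideal_ofD(4)[OF J is_subring_adjoin[OF A] self_in_adjoin[OF A]] f by blast
  with f show "a \<in> lead_coeffs A x J (Suc n)"
    unfolding lead_coeffs_def using A
    by (auto intro!: exI[of _ "pCons 0 f"] polys_over_pCons is_subringD simp: degree_pCons_eq_if)
qed

text \<open>Subtracting an element of \<open>J\<close> with the same \<open>n\<close>-th coefficient lowers the degree of an element of
\<open>J'\<close>, so induction on the degree brings every element of \<open>J'\<close> into \<open>J\<close>.\<close>

lemma ideal_eq_if_lead_coeffs_eq:
  assumes A: "is_subring A" and J: "ideal_of (adjoin A x) J" and J': "ideal_of (adjoin A x) J'"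
    and sub: "J \<subseteq> J'" and L: "\<And>n. lead_coeffs A x J' n \<subseteq> lead_coeffs A x J n"
  shows "J' = J"
proof -
  have *: "poly f x \<in> J"
    if "f \<in> polys_over A" "degree f \<le> n" "poly f x \<in> J'" for f n
    using that
  proof (induction n arbitrary: f)
    case (0 f)
    then have "poly.coeff f 0 \<in> lead_coeffs A x J 0" using L unfolding lead_coeffs_def by blast
    then obtain g where g: "degree g \<le> 0" "poly g x \<in> J" "poly.coeff g 0 = poly.coeff f 0"
      unfolding lead_coeffs_def by auto
    moreover have "f = g"
      using g 0 by (metis degree_0_id le_zero_eq)
    ultimately show ?case by simp
  next
    case (Suc n f)
    then have "poly.coeff f (Suc n) \<in> lead_coeffs A x J (Suc n)"
      using L unfolding lead_coeffs_def by blast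
    then obtain g where g: "g \<in> polys_over A" "degree g \<le> Suc n" "poly g x \<in> J"
      "poly.coeff g (Suc n) = poly.coeff f (Suc n)"
      unfolding lead_coeffs_def by auto
    have "degree (f - g) \<le> n"
    proof (rule degree_le, intro allI impI)
      fix i assume "n < i"
      then show "poly.coeff (f - g) i = 0"
        using g Suc.prems by (cases "i = Suc n") (auto simp: coeff_eq_0)
    qed
    moreover have "poly (f - g) x \<in> J'"
      using Suc.prems g sub ideal_ofD(7)[OF J' is_subring_adjoin[OF A]] by auto
    ultimately have "poly (f - g) x \<in> J"
      using Suc.IH polys_over_closed(1)[OF A] Suc.prems g by blast
    then have "poly (f - g) x + poly g x \<in> J"
      using g ideal_ofD(3)[OF J is_subring_adjoin[OF A]] by blast
    then show ?case by simp
  qed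
  have "J' \<subseteq> J"
  proof
    fix a assume a: "a \<in> J'"
    then obtain f where "f \<in> polys_over A" "a = poly f x"
      using J' unfolding ideal_of_def adjoin_def by blast
    with * a show "a \<in> J" by blast
  qed
  with sub show ?thesis by blast
qed

text \<open>The coefficient ideals \<open>L(J\<^sub>i, n)\<close> grow with \<open>i\<close> and with \<open>n\<close>. The diagonal \<open>L(J\<^sub>n, n)\<close> becomes
stationary at some \<open>N0\<close>, which settles all columns \<open>n > N0\<close> at once; the finitely many columns
\<open>n \<le> N0\<close> become stationary one by one. From then on the chain is constant by the previous lemma.\<close>

theorem hilbert_basis:
  assumes A: "is_subring A" and acc: "acc A"
  shows "acc (adjoin A x)"
  unfolding acc_def
proof (intro allI impI, elim conjE)
  fix J :: "nat \<Rightarrow> 'a set"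
  assume J: "\<forall>n. ideal_of (adjoin A x) (J n)" and inc: "\<forall>n. J n \<subseteq> J (Suc n)"
  let ?L = "\<lambda>i n. lead_coeffs A x (J i) n"
  have mono1: "J i \<subseteq> J j" if "i \<le> j" for i j using inc that by (simp add: lift_Suc_mono_le)
  have mono: "?L i m \<subseteq> ?L j n" if "i \<le> j" "m \<le> n" for i j m n
  proof -
    have "?L i m \<subseteq> ?L j m" using mono1[OF that(1)] by (rule lead_coeffs_mono)
    also have "\<dots> \<subseteq> ?L j n"
      using lead_coeffs_Suc[OF A J[rule_format]] that(2) by (rule lift_Suc_mono_le)
    finally show ?thesis .
  qed
  have stab: "\<exists>N. \<forall>m\<ge>N. K m = K N" if "\<And>n. ideal_of A (K n)" "\<And>n. K n \<subseteq> K (Suc n)" for K :: "nat \<Rightarrow> 'a set"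
    using acc that unfolding acc_def by blast
  obtain N0 where N0: "\<And>m. m \<ge> N0 \<Longrightarrow> ?L m m = ?L N0 N0"
    using stab[of "\<lambda>n. ?L n n"] ideal_of_lead_coeffs[OF A] J mono by (metis le_SucI order_refl)
  have "\<forall>k. \<exists>N. \<forall>m\<ge>N. ?L m k = ?L N k"
    using stab[of "\<lambda>n. ?L n k" for k] ideal_of_lead_coeffs[OF A] J mono by (metis le_SucI order_refl)
  then obtain N where N: "\<And>k m. m \<ge> N k \<Longrightarrow> ?L m k = ?L (N k) k" by metis
  define B where "B = Max (insert N0 (N ` {..N0}))"
  have B: "B \<ge> N0" "\<And>k. k \<le> N0 \<Longrightarrow> B \<ge> N k" unfolding B_def by (auto simp del: Max_insert intro!: Max_ge)
  have "J m = J B" if m: "m \<ge> B" for m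
  proof (rule ideal_eq_if_lead_coeffs_eq[OF A J[rule_format] J[rule_format] mono1[OF m]])
    fix k
    show "?L m k \<subseteq> ?L B k"
    proof (cases "k \<le> N0")
      case True
      then show ?thesis using N[of k m] N[of k B] B(2)[of k] m by auto
    next
      case False
      have "?L m k \<subseteq> ?L (max m k) (max m k)" by (intro mono) auto
      also have "\<dots> = ?L N0 N0" using False by (intro N0) auto
      also have "\<dots> \<subseteq> ?L B k" using False B by (intro mono) auto
      finally show ?thesis .
    qed
  qed
  then show "\<exists>n. \<forall>m\<ge>n. J m = J n" by blast
qed

section \<open>Zariski's lemma through G-domains\<close>

text \<open>The image of \<open>A\<close> modulo the prime \<open>M\<close> is a G-domain in the sense of Kaplansky: inverting the
single element \<open>u\<close> turns it into a field. The condition is phrased inside the ambient ring, with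
congruences modulo \<open>M\<close>. A ring that is a field
modulo \<open>M\<close> satisfies it with \<open>u = 1\<close>, and a polynomial ring \<open>K[X]\<close> never does. Descending from the
former to the latter through simple extensions gives Zariski's lemma.\<close>

definition g_domain_mod :: "'a::comm_ring_1 set \<Rightarrow> 'a set \<Rightarrow> bool" where
  "g_domain_mod M A \<longleftrightarrow> (\<exists>u\<in>A - M. \<forall>b\<in>A - M. \<exists>n. \<exists>c\<in>A. b * c - u ^ n \<in> M)"

lemma prime_ofD:
  assumes "prime_of C M"
  shows "ideal_of C M" "1 \<notin> M" "x \<in> C \<Longrightarrow> y \<in> C \<Longrightarrow> x * y \<in> M \<Longrightarrow> x \<in> M \<or> y \<in> M"
  using assms by (auto simp: prime_of_def)

lemma prime_of_power:
  assumes "is_subring C" "prime_of C M" "x \<in> C" "x ^ n \<in> M"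
  shows "x \<in> M"
  using assms(4)
proof (induction n)
  case 0
  then show ?case using prime_ofD(2)[OF assms(2)] by simp
next
  case (Suc n)
  then show ?case
    using prime_ofD(3)[OF assms(2,3) is_subringD(7)[OF assms(1,3)], of n] by auto
qed

lemma poly_in_ideal:
  assumes "is_subring C" "ideal_of C M" "x \<in> C" "\<And>i. poly.coeff f i \<in> M"
  shows "poly f x \<in> M"
  unfolding poly_altdef using assms
  by (auto intro!: ideal_of_sum[OF assms(2)] ideal_ofD(5)[OF assms(2,1)] is_subringD)

text \<open>Cutting off the top coefficients that vanish modulo \<open>M\<close> makes the degree of the polynomial equal to
the degree of its reduction. This replaces polynomials over the quotient ring.\<close>

lemma truncate_mod_ideal:
  assumes C: "is_subring C" and M: "ideal_of C M" and A: "is_subring A" and x: "x \<in> C"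
    and f: "f \<in> polys_over A" and n: "\<exists>i. poly.coeff f i \<notin> M"
  obtains f' where "f' \<in> polys_over A" "lead_coeff f' \<notin> M" "degree f' \<le> degree f"
    "poly f x - poly f' x \<in> M"
proof -
  define D where "D = {i. poly.coeff f i \<notin> M}"
  have "D \<subseteq> {..degree f}"
    unfolding D_def using ideal_ofD(2)[OF M C] by (auto intro!: le_degree) 
  then have fin: "finite D" using finite_subset by blast
  define d where "d = Max D"
  have dD: "d \<in> D" using n fin unfolding d_def D_def by (intro Max_in) auto
  have ge: "poly.coeff f i \<in> M" if "i > d" for i
    using that fin unfolding d_def D_def by (meson Max_ge leD mem_Collect_eq)
  define f' where "f' = poly_cutoff (Suc d) f"
  have cf: "poly.coeff f' i = (if i \<le> d then poly.coeff f i else 0)" for i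
    unfolding f'_def by (auto simp: coeff_poly_cutoff)
  have ne: "poly.coeff f d \<notin> M" using dD unfolding D_def by blast
  then have "poly.coeff f d \<noteq> 0" using ideal_ofD(2)[OF M C] by metis
  then have deg: "degree f' = d"
    by (intro antisym degree_le le_degree) (auto simp: cf)
  show ?thesis
  proof (rule that)
    show "f' \<in> polys_over A" using f is_subringD(2)[OF A] unfolding polys_over_def by (auto simp: cf)
    show "lead_coeff f' \<notin> M" using ne by (simp add: deg cf)
    show "degree f' \<le> degree f" using dD \<open>D \<subseteq> _\<close> deg by auto
    have "poly (f - f') x \<in> M"
      by (intro poly_in_ideal[OF C M x]) (use ge ideal_ofD(2)[OF M C] in \<open>auto simp: cf\<close>)
    then show "poly f x - poly f' x \<in> M" by simp
  qed
qed

text \<open>Division with remainder over a ring in which the leading coefficient \<open>b\<close> of the divisor is not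
invertible: the dividend is multiplied by a power of \<open>b\<close>. The degree bound for the quotient is
stated because degrees are not additive in the presence of zero divisors.\<close>

lemma pseudo_division:
  assumes A: "is_subring A" and h: "h \<in> polys_over A" "degree h > 0"
    and p: "p \<in> polys_over A"
  shows "\<exists>k q r. q \<in> polys_over A \<and> r \<in> polys_over A \<and> smult (lead_coeff h ^ k) p = q * h + r \<and>
      degree r < degree h \<and>
      degree q \<le> degree p - degree h"
  using p
proof (induction "degree p" arbitrary: p rule: less_induct)
  case less
  let ?b = "lead_coeff h"
  show ?case
  proof (cases "degree p < degree h")
    case True
    then show ?thesis using less.prems A
      by (intro exI[of _ "0::nat"] exI[of _ "0"] exI[of _ p]) (auto simp: polys_over_zero)
  next
    case False
    define n where "n = degree p - degree h"
    define t where "t = Polynomial.monom (lead_coeff p) n"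
    define p' where "p' = smult ?b p - t * h"
    have b: "?b \<in> A" and lp: "lead_coeff p \<in> A" using h less.prems by (auto simp: polys_over_def)
    have t: "t \<in> polys_over A" unfolding t_def using A lp by (rule polys_over_monom)
    have p'A: "p' \<in> polys_over A" unfolding p'_def
      by (intro polys_over_closed polys_over_smult A b less.prems t h)
    have dp': "degree p' < degree p"
    proof (rule degree_lessI)
      show "p' \<noteq> 0 \<or> 0 < degree p" using False h by linarith
      show "\<forall>k\<ge>degree p. poly.coeff p' k = 0"
      proof (intro allI impI)
        fix k assume k: "k \<ge> degree p"
        then have "k \<ge> n" unfolding n_def by linarith
        show "poly.coeff p' k = 0"
        proof (cases "k = degree p")
          case True
          have "poly.coeff (t * h) k = lead_coeff p * lead_coeff h"
            using False True unfolding t_def n_def by (simp add: coeff_monom_mult)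
          then show ?thesis using True unfolding p'_def by (simp add: mult.commute)
        next
          case ne: False
          then have "k - n > degree h" using k False unfolding n_def by linarith
          then show ?thesis using ne k \<open>k \<ge> n\<close> unfolding p'_def t_def
            by (auto simp: coeff_monom_mult coeff_eq_0)
        qed
      qed
    qed
    obtain k q r where IH: "q \<in> polys_over A" "r \<in> polys_over A" "smult (?b ^ k) p' = q * h + r"
      "degree r < degree h"
      "degree q \<le> degree p' - degree h"
      using less.hyps[OF dp' p'A] by blast
    have "smult (?b ^ Suc k) p = smult (?b ^ k) (p' + t * h)"
      unfolding p'_def by (simp add: mult.commute)
    also have "\<dots> = (q + smult (?b ^ k) t) * h + r"
      using IH(3) by (simp add: smult_add_right algebra_simps)
    finally have eq: "smult (?b ^ Suc k) p = (q + smult (?b ^ k) t) * h + r" .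
    have "degree (q + smult (?b ^ k) t) \<le> n"
    proof (rule degree_add_le)
      show "degree q \<le> n" using IH(5) dp' unfolding n_def by linarith
      show "degree (smult (?b ^ k) t) \<le> n"
        unfolding t_def by (rule order.trans[OF degree_smult_le degree_monom_le])
    qed
    moreover have "q + smult (?b ^ k) t \<in> polys_over A"
      by (intro polys_over_closed polys_over_smult A IH t is_subringD b)
    ultimately show ?thesis using eq IH n_def by blast
  qed
qed

lemma binomial_unit_part:
  assumes "is_subring S" "b \<in> S"
  shows "\<exists>w\<in>S. (b - 1) ^ n = (- 1) ^ n + b * w"
proof (induction n)
  case 0
  show ?case using is_subringD(2)[OF assms(1)] by (intro bexI[of _ 0]) auto
next
  case (Suc n)
  then obtain w where w: "w \<in> S" "(b - 1) ^ n = (- 1) ^ n + b * w" by blast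
  have "(b - 1) ^ Suc n = (- 1) ^ Suc n + b * ((- 1) ^ n + (b - 1) * w)"
    by (simp add: w(2) algebra_simps)
  moreover have "(- 1) ^ n + (b - 1) * w \<in> S"
    using assms w by (intro is_subringD(3-7)[OF assms(1)] is_subringD(1,2)) auto
  ultimately show ?case by blast
qed

text \<open>If \<open>x\<close> were transcendental over \<open>A\<close> modulo \<open>M\<close>, then \<open>b = 1 + x u\<close> would be a non-constant polynomial in \<open>x\<close>
dividing a power of \<open>u\<close>. But \<open>x u\<close> is congruent to \<open>-1\<close> modulo \<open>b\<close>, so \<open>b\<close> would divide
a power of \<open>-1\<close>, that is, be a unit of a polynomial ring over a domain.\<close>

lemma g_domain_mod_adjoin_imp_algebraic:
  assumes C: "is_subring C" and M: "prime_of C M" and A: "is_subring A" and AC: "A \<subseteq> C"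
    and x: "x \<in> C" and g: "g_domain_mod M (adjoin A x)"
  shows "\<exists>f\<in>polys_over A. poly f x \<in> M \<and> lead_coeff f \<notin> M"
proof (rule ccontr)
  assume na: "\<not> ?thesis"
  note Mi = prime_ofD(1)[OF M]
  note M' = ideal_ofD[OF Mi C]
  have tr: "poly.coeff f i \<in> M" if f: "f \<in> polys_over A" "poly f x \<in> M" for f i
  proof (rule ccontr)
    assume "poly.coeff f i \<notin> M"
    then obtain f' where f': "f' \<in> polys_over A" "lead_coeff f' \<notin> M" "poly f x - poly f' x \<in> M"
      using truncate_mod_ideal[OF C Mi A x f(1)] by metis
    then have "poly f' x \<in> M" using M'(7)[OF f(2) f'(3)] by simp
    with na f' show False by blast
  qed
  let ?S = "adjoin A x"
  have S: "is_subring ?S" using A by (rule is_subring_adjoin)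
  have SC: "?S \<subseteq> C" using C AC x by (rule adjoin_subset)
  obtain u where u: "u \<in> ?S - M" and U: "\<And>b. b \<in> ?S - M \<Longrightarrow> \<exists>n. \<exists>c\<in>?S. b * c - u ^ n \<in> M"
    using g unfolding g_domain_mod_def by blast
  obtain g0 where g0: "g0 \<in> polys_over A" "u = poly g0 x" using u unfolding adjoin_def by blast
  have "\<exists>i. poly.coeff g0 i \<notin> M"
    using u g0 poly_in_ideal[OF C Mi x] by blast
  then obtain g where g: "g \<in> polys_over A" "lead_coeff g \<notin> M" "u - poly g x \<in> M"
    using truncate_mod_ideal[OF C Mi A x g0(1)] g0(2) by metis
  define G where "G = pCons 1 g"
  define b where "b = poly G x"
  have "g \<noteq> 0" using g(2) M'(2) by auto
  then have G: "G \<in> polys_over A" "lead_coeff G \<notin> M" "degree G > 0" "poly.coeff G 0 = 1"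
    using g A unfolding G_def by (auto intro!: polys_over_pCons is_subringD simp: degree_pCons_eq)
  have bS: "b \<in> ?S" using G(1) unfolding b_def adjoin_def by blast
  have "b \<notin> M" using tr[OF G(1), of 0] G(4) prime_ofD(2)[OF M] unfolding b_def by auto
  then obtain n c where c: "c \<in> ?S" "b * c - u ^ n \<in> M" using U bS by blast
  have b1: "b - 1 = x * poly g x" unfolding b_def G_def by simp
  obtain w where w: "w \<in> ?S" "(b - 1) ^ n = (- 1) ^ n + b * w"
    using binomial_unit_part[OF S bS] by blast
  define v where "v = (- 1) ^ n * (c * x ^ n - w)"
  have xS: "x \<in> ?S" using A by (rule self_in_adjoin)
  have gS: "poly g x \<in> ?S" using g unfolding adjoin_def by blast
  have vS: "v \<in> ?S" unfolding v_def using xS c w is_subringD(1)[OF S]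
    by (intro is_subringD(3-7)[OF S]) auto
  have one: "(- 1) ^ n * (- 1) ^ n = (1 :: 'a)" by (simp flip: power_mult_distrib)
  have bv: "b * v - 1 \<in> M"
  proof -
    have "u ^ n - poly g x ^ n \<in> M"
    proof (induction n)
      case 0 then show ?case using M'(2) by simp
    next
      case (Suc n)
      have "u ^ Suc n - poly g x ^ Suc n = u * (u ^ n - poly g x ^ n) + (u - poly g x) * poly g x ^ n"
        by (simp add: algebra_simps)
      moreover have "u * (u ^ n - poly g x ^ n) \<in> M" using Suc u SC by (intro M'(4)) auto
      moreover have "(u - poly g x) * poly g x ^ n \<in> M"
        using g(3) gS SC C by (intro M'(5)) (auto intro!: is_subringD)
      ultimately show ?case using M'(3) by metis
    qed
    then have "b * c - poly g x ^ n \<in> M" using M'(3)[OF c(2)] by fastforce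
    then have "((- 1) ^ n * x ^ n) * (b * c - poly g x ^ n) \<in> M"
      using C x by (intro M'(4)) (auto intro!: is_subringD)
    moreover have "((- 1) ^ n * x ^ n) * (b * c - poly g x ^ n) = b * v - 1"
    proof -
      have "((- 1) ^ n * x ^ n) * (b * c - poly g x ^ n)
          = (- 1) ^ n * (b * (c * x ^ n)) - (- 1) ^ n * (b - 1) ^ n"
        by (simp add: b1 power_mult_distrib algebra_simps)
      also have "\<dots> = b * v - (- 1) ^ n * (- 1) ^ n"
        unfolding v_def w(2) by (simp add: algebra_simps)
      finally show ?thesis by (simp only: one)
    qed
    ultimately show ?thesis by simp
  qed
  obtain k0 where k0: "k0 \<in> polys_over A" "v = poly k0 x" using vS unfolding adjoin_def by blast
  have "v \<notin> M"
  proof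
    assume "v \<in> M"
    then have "b * v \<in> M" using bS SC by (intro M'(4)) auto
    then have "b * v - (b * v - 1) \<in> M" using bv by (rule M'(7))
    then show False using prime_ofD(2)[OF M] by simp
  qed
  then have "\<exists>i. poly.coeff k0 i \<notin> M"
    using k0 poly_in_ideal[OF C Mi x] by blast
  then obtain k where k: "k \<in> polys_over A" "lead_coeff k \<notin> M" "v - poly k x \<in> M"
    using truncate_mod_ideal[OF C Mi A x k0(1)] k0(2) by metis
  \<comment> \<open>The product of the two leading coefficients is a coefficient of positive degree, so it must vanish modulo M.\<close>
  have "poly (G * k - 1) x = (b * v - 1) - b * (v - poly k x)"
    by (simp add: b_def algebra_simps)
  also have "\<dots> \<in> M" using bS SC by (intro M'(7)[OF bv] M'(4)[OF _ k(3)]) auto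
  finally have "poly (G * k - 1) x \<in> M" .
  moreover have "G * k - 1 \<in> polys_over A"
    using polys_over_closed(1)[OF A polys_over_closed(3)[OF A G(1) k(1)] polys_over_const[OF A is_subringD(1)[OF A]]]
    by (simp add: one_pCons)
  ultimately have "poly.coeff (G * k - 1) (degree G + degree k) \<in> M"
    by (intro tr)
  then have "lead_coeff G * lead_coeff k \<in> M"
    using G(3) by (simp add: coeff_mult_degree_sum)
  moreover have "lead_coeff G \<in> C" "lead_coeff k \<in> C"
    using G(1) k(1) AC unfolding polys_over_def by auto
  ultimately show False using prime_ofD(3)[OF M] G(2) k(2) by blast
qed

text \<open>Let \<open>f\<close> be a polynomial of least degree over \<open>A\<close> vanishing at \<open>x\<close>, with leading coefficient \<open>a\<close>. The
ideal generated by \<open>u\<close> meets \<open>A\<close> in some \<open>c\<close> that is nonzero: an element of that ideal of least degree as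
a polynomial in \<open>x\<close> is a constant, since otherwise pseudo-division of \<open>f\<close> by it would split \<open>f\<close>.
Then \<open>a c\<close> witnesses the condition for \<open>A\<close>. Indeed, \<open>b z = c\<^sup>n\<close> with \<open>z\<close> in \<open>A[x]\<close>, and after multiplication
by a power of \<open>a\<close> the element \<open>z\<close> has degree below that of \<open>f\<close>. Now the powers of \<open>x\<close> below the degree of \<open>f\<close> are
independent over \<open>A\<close>, so the constant coefficients can be compared. All equalities are meant modulo \<open>M\<close>.\<close>

lemma g_domain_mod_descends:
  assumes C: "is_subring C" and M: "prime_of C M" and A: "is_subring A" and AC: "A \<subseteq> C"
    and x: "x \<in> C" and g: "g_domain_mod M (adjoin A x)"
  shows "g_domain_mod M A"
proof -
  note Mi = prime_ofD(1)[OF M]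
  note M' = ideal_ofD[OF Mi C]
  let ?S = "adjoin A x"
  have S: "is_subring ?S" using A by (rule is_subring_adjoin)
  have SC: "?S \<subseteq> C" using C AC x by (rule adjoin_subset)
  have polyS: "poly p x \<in> ?S" if "p \<in> polys_over A" for p using that unfolding adjoin_def by blast
  have coeffA: "poly.coeff p i \<in> A" if "p \<in> polys_over A" for p i
    using that unfolding polys_over_def by blast
  define F where "F = (\<lambda>f. f \<in> polys_over A \<and> poly f x \<in> M \<and> lead_coeff f \<notin> M)"
  have "\<exists>f. F f" using g_domain_mod_adjoin_imp_algebraic[OF assms] unfolding F_def by blast
  then obtain f where f: "F f" and fmin: "\<And>h. F h \<Longrightarrow> degree f \<le> degree h"
    using ex_has_least_nat[of F _ degree] by metis
  have low: "poly.coeff h i \<in> M"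
    if h: "h \<in> polys_over A" "poly h x \<in> M" "degree h < degree f" for h i
  proof (rule ccontr)
    assume "poly.coeff h i \<notin> M"
    then obtain h' where h': "h' \<in> polys_over A" "lead_coeff h' \<notin> M"
        "degree h' \<le> degree h" "poly h x - poly h' x \<in> M"
      using truncate_mod_ideal[OF C Mi A x h(1)] by metis
    then have "poly h' x \<in> M" using M'(7)[OF h(2) h'(4)] by simp
    then have "F h'" using h' unfolding F_def by blast
    then show False using fmin[of h'] h' h by linarith
  qed
  define a where "a = lead_coeff f"
  have aA: "a \<in> A" and aM: "a \<notin> M" and fA: "f \<in> polys_over A" and fx: "poly f x \<in> M"
    using f coeffA unfolding F_def a_def by auto
  have d: "degree f > 0"
  proof (rule ccontr)
    assume "\<not> ?thesis"
    then have "f = [:lead_coeff f:]" by (metis degree_0_id gr0I)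
    then have "poly f x = lead_coeff f" by (metis add_cancel_left_right mult_zero_right poly_0 poly_pCons)
    with fx aM show False unfolding a_def by simp
  qed
  have powM: "y ^ n \<notin> M" if "y \<in> C" "y \<notin> M" for y n
    using prime_of_power[OF C M] that by blast
  have multM: "y * z \<notin> M" if "y \<in> C" "y \<notin> M" "z \<in> C" "z \<notin> M" for y z
    using prime_ofD(3)[OF M] that by blast
  obtain u where u: "u \<in> ?S - M" and U: "\<And>b. b \<in> ?S - M \<Longrightarrow> \<exists>n. \<exists>c\<in>?S. b * c - u ^ n \<in> M"
    using g unfolding g_domain_mod_def by blast
  \<comment> \<open>Polynomial representatives of the nonzero elements of the ideal generated by u.\<close>
  define H where "H = (\<lambda>h. h \<in> polys_over A \<and> poly h x \<notin> M \<and> (\<exists>w\<in>?S. poly h x - u * w \<in> M))"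
  obtain g0 where "g0 \<in> polys_over A" "u = poly g0 x" using u unfolding adjoin_def by blast
  then have "H g0" using u M'(2) is_subringD(1)[OF S] unfolding H_def
    by (auto intro!: bexI[of _ 1])
  then obtain h where h: "H h" and hmin: "\<And>k. H k \<Longrightarrow> degree h \<le> degree k"
    using ex_has_least_nat[of H _ degree] by metis
  have hA: "h \<in> polys_over A" and hx: "poly h x \<notin> M" using h unfolding H_def by auto
  obtain w where w: "w \<in> ?S" "poly h x - u * w \<in> M" using h unfolding H_def by blast
  have hf: "degree h < degree f"
  proof -
    obtain k q r where D: "q \<in> polys_over A" "r \<in> polys_over A" "smult (a ^ k) h = q * f + r"
      "degree r < degree f"
      using pseudo_division[OF A fA d hA] unfolding a_def by blast
    from D(3) have "poly (smult (a ^ k) h) x = poly (q * f + r) x" by simp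
    then have eq: "poly r x = a ^ k * poly h x - poly q x * poly f x" by simp
    have qf: "poly q x * poly f x \<in> M" using polyS[OF D(1)] SC fx by (intro M'(4)) auto
    have "a ^ k * poly h x \<notin> M"
      using aA aM AC hx polyS[OF hA] SC C by (intro multM powM is_subringD) auto
    then have "poly r x \<notin> M" using eq qf M'(3)[OF _ qf, of "poly r x"] by auto
    moreover have "poly r x - u * (a ^ k * w) \<in> M"
    proof -
      have "poly r x - u * (a ^ k * w) = a ^ k * (poly h x - u * w) - poly q x * poly f x"
        unfolding eq by (simp add: algebra_simps)
      also have "\<dots> \<in> M"
      proof (rule M'(7)[OF _ qf], rule M'(4)[OF _ w(2)])
        show "a ^ k \<in> C" using aA AC C by (auto intro!: is_subringD)
      qed
      finally show ?thesis .
    qed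
    moreover have "a ^ k * w \<in> ?S" using w aA subset_adjoin[OF A] S by (auto intro!: is_subringD)
    ultimately have "H r" using D unfolding H_def by blast
    then show ?thesis using hmin[of r] D(4) by linarith
  qed
  have "degree h = 0"
  proof (rule ccontr)
    assume e: "degree h \<noteq> 0"
    define b where "b = lead_coeff h"
    have bM: "b \<notin> M"
    proof
      assume b: "b \<in> M"
      define h' where "h' = h - Polynomial.monom b (degree h)"
      have bA: "b \<in> A" using coeffA[OF hA] unfolding b_def by blast
      have "h' \<in> polys_over A" unfolding h'_def by (intro polys_over_closed A hA polys_over_monom bA)
      moreover have diff: "poly h x - poly h' x \<in> M"
        unfolding h'_def using b x C by (auto simp: poly_monom intro!: M'(5) is_subringD)
      moreover have "poly h' x \<notin> M" using M'(3)[OF diff, of "poly h' x"] hx by auto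
      moreover have "poly h' x - u * w \<in> M" using M'(7)[OF w(2) diff] by (simp add: algebra_simps)
      ultimately have "H h'" unfolding H_def using w(1) by blast
      moreover have "degree h' < degree h"
        unfolding h'_def b_def using e
        by (intro degree_lessI) (auto simp: coeff_eq_0)
      ultimately show False using hmin[of h'] by linarith
    qed
    obtain k q r where D: "q \<in> polys_over A" "r \<in> polys_over A" "smult (b ^ k) f = q * h + r"
      "degree r < degree h"
      "degree q \<le> degree f - degree h"
      using pseudo_division[OF A hA _ fA] e unfolding b_def by blast
    have bC: "b \<in> C" using coeffA[OF hA] AC unfolding b_def by blast
    from D(3) have "poly (smult (b ^ k) f) x = poly (q * h + r) x" by simp
    then have eq: "poly q x * poly h x + poly r x = b ^ k * poly f x" by simp
    have inM: "poly q x * poly h x + poly r x \<in> M"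
      unfolding eq using bC C by (intro M'(4) fx is_subringD) auto
    have "poly r x - u * (- poly q x * w) = (poly q x * poly h x + poly r x) - poly q x * (poly h x - u * w)"
      by (simp add: algebra_simps)
    also have "\<dots> \<in> M" using polyS[OF D(1)] SC by (intro M'(7)[OF inM] M'(4)[OF _ w(2)]) auto
    finally have 1: "poly r x - u * (- poly q x * w) \<in> M" .
    have "- poly q x * w \<in> ?S" using w polyS[OF D(1)] S by (intro is_subringD(4,5)) auto
    then have "H r" if "poly r x \<notin> M" unfolding H_def using D(2) 1 that by blast
    then have "poly r x \<in> M" using hmin[of r] D(4) by linarith
    then have rM: "poly.coeff r i \<in> M" for i
      using low[OF D(2) _ less_trans[OF D(4) hf]] by blast
    have "poly q x * poly h x \<in> M" using M'(7)[OF inM \<open>poly r x \<in> M\<close>] by simp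
    then have "poly q x \<in> M"
      using prime_ofD(3)[OF M] hx polyS[OF D(1)] polyS[OF hA] SC by blast
    then have qM: "poly.coeff q i \<in> M" for i
    proof (rule low[OF D(1)])
      show "degree q < degree f" using D(5) e hf by linarith
    qed
    have "poly.coeff h i \<in> C" for i using coeffA[OF hA] AC by blast
    then have "poly.coeff (q * h) i \<in> M" for i
      unfolding coeff_mult by (intro ideal_of_sum[OF Mi] M'(5) qM)
    then have "poly.coeff (smult (b ^ k) f) (degree f) \<in> M"
      unfolding D(3) coeff_add by (intro M'(3) rM)
    then have "b ^ k * a \<in> M" by (simp add: a_def)
    moreover have "b ^ k * a \<notin> M" using bC bM aA aM AC C by (intro multM powM is_subringD) auto
    ultimately show False by blast
  qed
  then obtain c where c: "h = [:c:]" using degree_eq_zeroE by blast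
  note C' = is_subringD[OF C] and A' = is_subringD[OF A] and S' = is_subringD[OF S]
  have cA: "c \<in> A" and cM: "c \<notin> M" and cw: "c - u * w \<in> M"
    using coeffA[OF hA, of 0] hx w unfolding c by auto
  show ?thesis
    unfolding g_domain_mod_def
  proof (intro bexI ballI)
    show "a * c \<in> A - M" using aA aM cA cM AC multM[of a c] A'(4) by blast
  next
    fix b assume b: "b \<in> A - M"
    then obtain n z where z: "z \<in> ?S" "b * z - u ^ n \<in> M" using U subset_adjoin[OF A] by blast
    have uC: "u \<in> C" "w \<in> C" "z \<in> C" "c \<in> C" "a \<in> C" "b \<in> C"
      using u w z SC cA aA b AC by auto
    have "c ^ n - (u * w) ^ n \<in> M"
    proof (induction n)
      case 0 then show ?case using M'(2) by simp
    next
      case (Suc n)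
      have "c ^ Suc n - (u * w) ^ Suc n = c * (c ^ n - (u * w) ^ n) + (c - u * w) * (u * w) ^ n"
        by (simp add: algebra_simps)
      also have "\<dots> \<in> M"
        by (rule M'(3)[OF M'(4)[OF uC(4) Suc] M'(5)[OF C'(7)[OF C'(4)[OF uC(1,2)]] cw]])
      finally show ?case .
    qed
    moreover have "w ^ n * (b * z - u ^ n) \<in> M" by (rule M'(4)[OF C'(7)[OF uC(2)] z(2)])
    ultimately have "(c ^ n - (u * w) ^ n) - w ^ n * (b * z - u ^ n) \<in> M" by (rule M'(7))
    then have cz: "c ^ n - b * (z * w ^ n) \<in> M" by (simp add: algebra_simps power_mult_distrib)
    have "z * w ^ n \<in> ?S" using z w S'(4,7) by blast
    then obtain p where p: "p \<in> polys_over A" "z * w ^ n = poly p x" unfolding adjoin_def by blast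
    obtain k q r where D: "q \<in> polys_over A" "r \<in> polys_over A" "smult (a ^ k) p = q * f + r"
      "degree r < degree f"
      using pseudo_division[OF A fA d p(1)] unfolding a_def by blast
    from D(3) have "poly (smult (a ^ k) p) x = poly (q * f + r) x" by simp
    then have eq: "a ^ k * poly p x = poly q x * poly f x + poly r x" by simp
    define t where "t = [:a ^ k * c ^ n:] - smult b r"
    have tA: "t \<in> polys_over A" unfolding t_def
      using aA cA b A D(2) A'(4,7) by (intro polys_over_closed(1) polys_over_const polys_over_smult) auto
    have "poly t x = a ^ k * (c ^ n - b * poly p x) + b * (poly q x * poly f x)"
      using eq unfolding t_def by (simp add: algebra_simps)
    also have "\<dots> \<in> M"
      using polyS[OF D(1)] SC
      by (intro M'(3) M'(4)[OF C'(7)[OF uC(5)] cz[unfolded p(2)]] M'(4)[OF uC(6)] M'(4)[OF _ fx]) auto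
    finally have "poly t x \<in> M" .
    moreover have "degree t < degree f"
      unfolding t_def using D(4) d by (intro degree_diff_less) (auto intro: le_less_trans[OF degree_smult_le])
    ultimately have "poly.coeff t 0 \<in> M" using low[OF tA] by blast
    then have key: "a ^ k * c ^ n - b * poly.coeff r 0 \<in> M" by (simp add: t_def)
    define m where "m = max k n"
    define s where "s = a ^ (m - k) * c ^ (m - n)"
    have m: "(a * c) ^ m = s * (a ^ k * c ^ n)"
    proof -
      have "a ^ m = a ^ (m - k) * a ^ k" "c ^ m = c ^ (m - n) * c ^ n"
        unfolding m_def by (simp_all flip: power_add)
      then show ?thesis unfolding s_def power_mult_distrib by (simp only: mult_ac)
    qed
    have sA: "s \<in> A" unfolding s_def using aA cA A'(4,7) by blast
    have "- s * (a ^ k * c ^ n - b * poly.coeff r 0) \<in> M"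
      using sA AC C'(5) by (intro M'(4)[OF _ key]) auto
    then have "b * (s * poly.coeff r 0) - (a * c) ^ m \<in> M" unfolding m by (simp add: algebra_simps)
    then show "\<exists>n. \<exists>z\<in>A. b * z - (a * c) ^ n \<in> M"
      using A'(4)[OF sA coeffA[OF D(2)]] by blast
  qed
qed


section \<open>Regular sequences modulo an ideal\<close>

definition add_generator :: "'a::comm_ring_1 set \<Rightarrow> 'a set \<Rightarrow> 'a \<Rightarrow> 'a set" where
  "add_generator C I x = {i + x * c | i c. i \<in> I \<and> c \<in> C}"

text \<open>Regularity of the sequence on \<open>C/I\<close> except for the requirement that the quotient by the whole sequence be nonzero,
which is established separately from a proper ideal that contains it.\<close>

fun weakly_regular :: "'a::comm_ring_1 set \<Rightarrow> 'a set \<Rightarrow> 'a list \<Rightarrow> bool" where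
  "weakly_regular C I [] \<longleftrightarrow> True"
| "weakly_regular C I (x # xs) \<longleftrightarrow> (\<forall>a\<in>C. x * a \<in> I \<longrightarrow> a \<in> I) \<and> weakly_regular C (add_generator C I x) xs"

lemma ideal_of_add_generator:
  assumes C: "is_subring C" and I: "ideal_of C I" and x: "x \<in> C"
  shows "ideal_of C (add_generator C I x)"
proof -
  note I' = ideal_ofD[OF I C]
  note C' = is_subringD[OF C]
  show ?thesis
    unfolding ideal_of_def add_generator_def
  proof (intro conjI ballI)
    show "{i + x * c |i c. i \<in> I \<and> c \<in> C} \<subseteq> C" using I'(1) C' x by auto
    show "0 \<in> {i + x * c |i c. i \<in> I \<and> c \<in> C}"
      using I'(2) C'(2) by (auto intro!: exI[of _ 0])
  next
    fix a b assume "a \<in> {i + x * c |i c. i \<in> I \<and> c \<in> C}" "b \<in> {i + x * c |i c. i \<in> I \<and> c \<in> C}"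
    then obtain i c j d where *: "i \<in> I" "c \<in> C" "a = i + x * c" "j \<in> I" "d \<in> C" "b = j + x * d" by blast
    then have "a + b = (i + j) + x * (c + d)" by (simp add: algebra_simps)
    then show "a + b \<in> {i + x * c |i c. i \<in> I \<and> c \<in> C}" using * I'(3) C'(6) by blast
  next
    fix a b assume "a \<in> C" "b \<in> {i + x * c |i c. i \<in> I \<and> c \<in> C}"
    then obtain j d where *: "a \<in> C" "j \<in> I" "d \<in> C" "b = j + x * d" by blast
    then have "a * b = a * j + x * (a * d)" by (simp add: algebra_simps)
    then show "a * b \<in> {i + x * c |i c. i \<in> I \<and> c \<in> C}" using * I'(4) C'(4) by blast
  qed
qed

lemma add_generator_memI: "i \<in> I \<Longrightarrow> c \<in> C \<Longrightarrow> i + x * c \<in> add_generator C I x"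
  unfolding add_generator_def by blast

lemma subset_add_generator: "is_subring C \<Longrightarrow> I \<subseteq> add_generator C I x"
  unfolding add_generator_def using is_subringD(2)[of C] by force

lemma self_in_add_generator: "is_subring C \<Longrightarrow> ideal_of C I \<Longrightarrow> x \<in> add_generator C I x"
  using add_generator_memI[of 0 I 1 C x] by (auto simp: ideal_of_def is_subringD)

lemma add_generator_subset_ideal:
  assumes C: "is_subring C" and J: "ideal_of C J" and "I \<subseteq> J" "x \<in> J"
  shows "add_generator C I x \<subseteq> J"
  unfolding add_generator_def using assms(3,4) ideal_ofD[OF J C] by auto

text \<open>The exact sequence \<open>0 \<rightarrow> C/(I : v) \<rightarrow> C/I \<rightarrow> C/(I + (v)) \<rightarrow> 0\<close>, whose first map is multiplication by \<open>v\<close>,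
transports regularity from its ends to its middle. Both hypotheses, \<open>I1 = (I : v)\<close>
and \<open>I2 = I + (v)\<close>, survive when a generator \<open>x\<close> that is regular on \<open>C/I2\<close> is added to all three ideals, which is what makes
the induction along the sequence work.\<close>

lemma weakly_regular_extension:
  assumes C: "is_subring C" and v: "v \<in> C"
    and I: "ideal_of C I" and I1: "ideal_of C I1" and I2: "I2 = add_generator C I v"
    and colon: "\<And>b. b \<in> C \<Longrightarrow> v * b \<in> I \<longleftrightarrow> b \<in> I1"
    and xs: "set xs \<subseteq> C" and w1: "weakly_regular C I1 xs" and w2: "weakly_regular C I2 xs"
  shows "weakly_regular C I xs"
  using I I1 I2 colon xs w1 w2
proof (induction xs arbitrary: I I1 I2)
  case Nil
  then show ?case by simp
next
  case (Cons x xs)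
  note I' = ideal_ofD[OF Cons.prems(1) C]
  note I1' = ideal_ofD[OF Cons.prems(2) C]
  note C' = is_subringD[OF C]
  have x: "x \<in> C" and xs: "set xs \<subseteq> C" using Cons.prems(5) by auto
  have I2i: "ideal_of C I2" unfolding Cons.prems(3) by (rule ideal_of_add_generator[OF C Cons.prems(1) v])
  note I2' = ideal_ofD[OF I2i C]
  have I2e: "\<exists>i c. i \<in> I \<and> c \<in> C \<and> a = i + v * c" if "a \<in> I2" for a
    using that unfolding Cons.prems(3) add_generator_def by blast
  have sub: "I \<subseteq> I2" unfolding Cons.prems(3) by (rule subset_add_generator[OF C])
  have vI2: "v \<in> I2" unfolding Cons.prems(3) by (rule self_in_add_generator[OF C Cons.prems(1)])
  have nzd1: "b \<in> I1" if "b \<in> C" "x * b \<in> I1" for b using Cons.prems(6) that by simp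
  have nzd2: "b \<in> I2" if "b \<in> C" "x * b \<in> I2" for b using Cons.prems(7) that by simp
  have nzd: "a \<in> I" if a: "a \<in> C" "x * a \<in> I" for a
  proof -
    obtain i b where b: "i \<in> I" "b \<in> C" "a = i + v * b" using nzd2[OF a(1)] a(2) sub I2e by blast
    have "x * a - x * i \<in> I" using b x by (intro I'(7)[OF a(2)] I'(4))
    then have "v * (x * b) \<in> I" by (simp add: b(3) algebra_simps)
    then have "x * b \<in> I1" using Cons.prems(4) x b C' by blast
    then have "v * b \<in> I" using nzd1 b Cons.prems(4) by blast
    then show "a \<in> I" using b I'(3) by blast
  qed
  have "weakly_regular C (add_generator C I x) xs"
  proof (rule Cons.IH[of _ "add_generator C I1 x" "add_generator C I2 x"])
    show "ideal_of C (add_generator C I x)" "ideal_of C (add_generator C I1 x)"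
      by (intro ideal_of_add_generator[OF C _ x] Cons.prems)+
    show "add_generator C I2 x = add_generator C (add_generator C I x) v"
    proof
      note J = ideal_of_add_generator[OF C ideal_of_add_generator[OF C Cons.prems(1) x] v]
      show "add_generator C I2 x \<subseteq> add_generator C (add_generator C I x) v"
        unfolding Cons.prems(3)
        using subset_add_generator[OF C] self_in_add_generator[OF C Cons.prems(1)] self_in_add_generator[OF C ideal_of_add_generator[OF C Cons.prems(1) x]]
        by (intro add_generator_subset_ideal[OF C J]) blast+
      note J2 = ideal_of_add_generator[OF C I2i x]
      show "add_generator C (add_generator C I x) v \<subseteq> add_generator C I2 x"
        using subset_add_generator[OF C, of I2 x] self_in_add_generator[OF C I2i] sub vI2
        by (intro add_generator_subset_ideal[OF C J2]) blast+
    qed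
    show "v * b \<in> add_generator C I x \<longleftrightarrow> b \<in> add_generator C I1 x" if b: "b \<in> C" for b
    proof
      \<comment> \<open>Regularity of x on the right end lets the coefficient c be divided by v modulo I.\<close>
      assume "v * b \<in> add_generator C I x"
      then obtain i c where c: "i \<in> I" "c \<in> C" "v * b = i + x * c" unfolding add_generator_def by blast
      have "v * b - i \<in> I2" using vI2 b c sub by (intro I2'(7) I2'(5)) auto
      then have "x * c \<in> I2" by (simp add: c(3))
      then obtain i' c' where c': "i' \<in> I" "c' \<in> C" "c = i' + v * c'" using nzd2 c I2e by blast
      have "i + x * i' \<in> I" using c c' x by (intro I'(3) I'(4))
      moreover have "i + x * i' = v * (b - x * c')" using c(3) c'(3) by (simp add: algebra_simps)
      ultimately have "b - x * c' \<in> I1" using Cons.prems(4) b x c' C' by metis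
      then show "b \<in> add_generator C I1 x" using add_generator_memI[OF _ c'(2), of "b - x * c'" I1 x] by simp
    next
      assume "b \<in> add_generator C I1 x"
      then obtain i c where c: "i \<in> I1" "c \<in> C" "b = i + x * c" unfolding add_generator_def by blast
      have "v * i \<in> I" using c(1) I1'(1) Cons.prems(4) by blast
      moreover have "v * c \<in> C" using v c C' by blast
      ultimately have "v * i + x * (v * c) \<in> add_generator C I x" by (rule add_generator_memI)
      then show "v * b \<in> add_generator C I x" by (simp add: c(3) algebra_simps)
    qed
    show "set xs \<subseteq> C" by fact
    show "weakly_regular C (add_generator C I1 x) xs" "weakly_regular C (add_generator C I2 x) xs" using Cons.prems by auto
  qed
  then show ?case using nzd by simp
qed

lemma weakly_regular_nth:
  assumes "weakly_regular C I xs" "k < length xs" "a \<in> C" "xs ! k * a \<in> foldl (add_generator C) I (take k xs)"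
  shows "a \<in> foldl (add_generator C) I (take k xs)"
  using assms
proof (induction xs arbitrary: I k)
  case (Cons x xs)
  then show ?case by (cases k) auto
qed simp

lemma ideal_of_foldl_add_generator:
  assumes "is_subring C" "ideal_of C I" "set xs \<subseteq> C"
  shows "ideal_of C (foldl (add_generator C) I xs) \<and> I \<subseteq> foldl (add_generator C) I xs \<and> set xs \<subseteq> foldl (add_generator C) I xs"
  using assms(2,3)
proof (induction xs arbitrary: I)
  case (Cons x xs)
  then have i: "ideal_of C (add_generator C I x)" by (auto intro: ideal_of_add_generator[OF assms(1)])
  show ?case using Cons.IH[OF i] Cons.prems subset_add_generator[OF assms(1), of I x] self_in_add_generator[OF assms(1) Cons.prems(1), of x] by auto
qed simp

lemma foldl_add_generator_subset:
  assumes "is_subring C" "ideal_of C J" "I \<subseteq> J" "set xs \<subseteq> J"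
  shows "foldl (add_generator C) I xs \<subseteq> J"
  using assms(3,4)
proof (induction xs arbitrary: I)
  case (Cons x xs)
  then show ?case using add_generator_subset_ideal[OF assms(1,2)] by auto
qed simp

section \<open>Algebraic relations and chains of prime ideals\<close>

text \<open>The value of a polynomial of degree at most \<open>E\<close> in each variable at the elements of a list, where \<open>c\<close> gives its
coefficients and \<open>\<phi>\<close> embeds them. The recursion on the list groups the terms by the exponent of the first element.\<close>

fun relation_value :: "('k \<Rightarrow> 'a::comm_ring_1) \<Rightarrow> nat \<Rightarrow> 'a list \<Rightarrow> (nat list \<Rightarrow> 'k) \<Rightarrow> 'a" where
  "relation_value \<phi> E [] c = \<phi> (c [])"
| "relation_value \<phi> E (f # fs) c = (\<Sum>j\<le>E. f ^ j * relation_value \<phi> E fs (\<lambda>\<alpha>. c (j # \<alpha>)))"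

fun power_product :: "'a::comm_ring_1 list \<Rightarrow> nat list \<Rightarrow> 'a" where
  "power_product (f # fs) (j # \<alpha>) = f ^ j * power_product fs \<alpha>"
| "power_product _ _ = 1"

definition exps :: "nat \<Rightarrow> nat \<Rightarrow> nat list set" where
  "exps E l = {\<alpha>. set \<alpha> \<subseteq> {..E} \<and> length \<alpha> = l}"

lemma finite_exps: "finite (exps E l)"
  unfolding exps_def by (rule finite_lists_length_eq) simp

lemma card_exps: "card (exps E l) = (E + 1) ^ l"
  unfolding exps_def by (subst card_lists_length_eq) auto

lemma exps_0: "exps E 0 = {[]}"
  unfolding exps_def by auto

lemma exps_Suc: "exps E (Suc l) = (\<lambda>(j, \<alpha>). j # \<alpha>) ` ({..E} \<times> exps E l)"
  unfolding exps_def by (auto simp: length_Suc_conv image_iff)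

lemma relation_value_eq_sum: "relation_value \<phi> E fs c = (\<Sum>\<alpha>\<in>exps E (length fs). \<phi> (c \<alpha>) * power_product fs \<alpha>)"
proof (induction fs arbitrary: c)
  case Nil
  then show ?case by (simp add: exps_0)
next
  case (Cons f fs)
  have "(\<Sum>\<alpha>\<in>exps E (length (f # fs)). \<phi> (c \<alpha>) * power_product (f # fs) \<alpha>)
      = (\<Sum>(j, \<alpha>)\<in>{..E} \<times> exps E (length fs). \<phi> (c (j # \<alpha>)) * (f ^ j * power_product fs \<alpha>))"
    unfolding list.size exps_Suc[of E "length fs", simplified] add_Suc_right add_0_right
    by (subst sum.reindex) (auto simp: exps_Suc inj_on_def case_prod_unfold intro!: sum.cong)
  also have "\<dots> = relation_value \<phi> E (f # fs) c"
    by (simp add: sum.cartesian_product[symmetric] Cons sum_distrib_left mult_ac)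
  finally show ?case ..
qed

lemma relation_value_in_subring:
  assumes "is_subring C" "set fs \<subseteq> C" "range \<phi> \<subseteq> C"
  shows "relation_value \<phi> E fs c \<in> C"
  using assms(2)
  by (induction fs arbitrary: c) (use assms in \<open>auto intro!: is_subring_sum is_subringD\<close>)

text \<open>Elements picked from the successive differences of a chain of primes are algebraically
independent modulo the bottom prime. For in a relation \<open>\<Sum>\<^sub>j f\<^sup>j q\<^sub>j \<in> P\<^sub>0\<close> with \<open>f \<in> P\<^sub>1 - P\<^sub>0\<close> the lowest power of \<open>f\<close> can
be cancelled modulo \<open>P\<^sub>0\<close>, and then \<open>q\<^sub>j \<in> P\<^sub>1\<close> for the lowest \<open>j\<close>, so that \<open>q\<^sub>j\<close> is a shorter relation for the rest of the chain.
This is the elementary description of Krull dimension by Coquand and Lombardi.\<close>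

lemma prime_chain_independent:
  fixes \<phi> :: "'k::zero \<Rightarrow> 'a::comm_ring_1"
  assumes C: "is_subring C" and \<phi>: "range \<phi> \<subseteq> C"
    and \<phi>0: "\<phi> 0 = 0" and \<phi>P: "\<And>P c. prime_of C P \<Longrightarrow> \<phi> c \<in> P \<Longrightarrow> c = 0"
    and P: "\<And>i. i \<le> length fs \<Longrightarrow> prime_of C (P i)"
    and fs: "\<And>i. i < length fs \<Longrightarrow> P i \<subseteq> P (Suc i) \<and> fs ! i \<in> P (Suc i) - P i"
    and rel: "relation_value \<phi> E fs c \<in> P 0" and \<alpha>: "\<alpha> \<in> exps E (length fs)"
  shows "c \<alpha> = 0"
  using P fs rel \<alpha>
proof (induction fs arbitrary: P c \<alpha>)
  case Nil
  then show ?case using \<phi>P[of "P 0"] by (auto simp: exps_0)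
next
  case (Cons f fs)
  note P0 = Cons.prems(1)[of 0, simplified] 
  have P1: "prime_of C (P 1)" using Cons.prems(1)[of 1] by simp
  note I0 = ideal_ofD[OF prime_ofD(1)[OF P0] C]
  note I1 = ideal_ofD[OF prime_ofD(1)[OF P1] C]
  have f: "P 0 \<subseteq> P 1" "f \<in> P 1" "f \<notin> P 0" using Cons.prems(2)[of 0] by auto
  have fC: "f \<in> C" using f(2) I1(1) by simp
  have fsC: "set fs \<subseteq> C"
  proof
    fix g assume "g \<in> set fs"
    then obtain i where i: "i < length fs" "g = fs ! i" by (metis in_set_conv_nth)
    show "g \<in> C" using Cons.prems(2)[of "Suc i"] i Cons.prems(1)[of "Suc (Suc i)"]
      ideal_ofD(1)[OF prime_ofD(1) C] by fastforce
  qed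
  define q where "q j = relation_value \<phi> E fs (\<lambda>\<alpha>. c (j # \<alpha>))" for j
  have qC: "q j \<in> C" for j unfolding q_def by (rule relation_value_in_subring[OF C fsC \<phi>])
  have tail: "c (j # \<beta>) = 0" if "q j \<in> P 1" "\<beta> \<in> exps E (length fs)" for j \<beta>
    using Cons.IH[of "\<lambda>i. P (Suc i)" "\<lambda>\<alpha>. c (j # \<alpha>)" \<beta>] Cons.prems(1,2) that
    unfolding q_def by fastforce
  obtain j \<beta> where \<alpha>: "\<alpha> = j # \<beta>" "j \<le> E" "\<beta> \<in> exps E (length fs)"
    using Cons.prems(4) by (auto simp: exps_Suc)
  have vanish: "i \<le> E \<Longrightarrow> q i \<in> P 1" for i
  proof (induction i rule: less_induct)
    case (less i)
    have q0: "q k = 0" if "k < i" for k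
    proof -
      have "\<phi> (c (k # \<alpha>)) = \<phi> 0" if "\<alpha> \<in> exps E (length fs)" for \<alpha>
        using tail[of k \<alpha>] less \<open>k < i\<close> that by auto
      then show ?thesis unfolding q_def relation_value_eq_sum by (intro sum.neutral) (auto simp: \<phi>0)
    qed
    have "(\<Sum>k\<le>E. f ^ k * q k) = (\<Sum>k=i..E. f ^ k * q k)"
      by (intro sum.mono_neutral_right) (auto simp: q0)
    also have "\<dots> = f ^ i * (\<Sum>k=i..E. f ^ (k - i) * q k)"
      unfolding sum_distrib_left by (intro sum.cong refl) (simp add: power_add[symmetric] mult.assoc[symmetric])
    also have "(\<Sum>k=i..E. f ^ (k - i) * q k) = q i + (\<Sum>k=Suc i..E. f ^ (k - i) * q k)"
      using less.prems by (subst sum.atLeast_Suc_atMost) auto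
    finally have eq: "relation_value \<phi> E (f # fs) c = f ^ i * (q i + (\<Sum>k=Suc i..E. f ^ (k - i) * q k))"
      by (simp add: q_def)
    have "f ^ i \<notin> P 0" using prime_of_power[OF C P0 fC] f by blast
    moreover have "q i + (\<Sum>k=Suc i..E. f ^ (k - i) * q k) \<in> C"
      using qC fC C by (auto intro!: is_subringD is_subring_sum)
    ultimately have "q i + (\<Sum>k=Suc i..E. f ^ (k - i) * q k) \<in> P 0"
      using Cons.prems(3) prime_ofD(3)[OF P0] is_subringD(7)[OF C fC] unfolding eq by blast
    then have 1: "q i + (\<Sum>k=Suc i..E. f ^ (k - i) * q k) \<in> P 1" using f by blast
    have 2: "(\<Sum>k=Suc i..E. f ^ (k - i) * q k) \<in> P 1"
    proof (rule ideal_of_sum[OF prime_ofD(1)[OF P1]])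
      fix k assume "k \<in> {Suc i..E}"
      then obtain l where "k - i = Suc l" by (metis Suc_diff_le Suc_le_D atLeastAtMost_iff diff_Suc_Suc Suc_leD)
      then have "f ^ (k - i) * q k = f * (f ^ l * q k)" by (simp add: mult.assoc)
      also have "\<dots> \<in> P 1" using f qC fC C by (intro I1(5)) (auto intro!: is_subringD)
      finally show "f ^ (k - i) * q k \<in> P 1" .
    qed
    show ?case using I1(7)[OF 1 2] by simp
  qed
  show ?case using tail[OF vanish[OF \<alpha>(2)] \<alpha>(3)] \<alpha>(1) by simp
qed



section \<open>Ideals of rings given by a carrier\<close>

lemma (in ring) idealI_sub:
  assumes "J \<subseteq> carrier R" "\<zero> \<in> J"
    and "\<And>x y. x \<in> J \<Longrightarrow> y \<in> J \<Longrightarrow> x \<oplus> y \<in> J"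
    and l: "\<And>c x. c \<in> carrier R \<Longrightarrow> x \<in> J \<Longrightarrow> c \<otimes> x \<in> J"
    and r: "\<And>c x. c \<in> carrier R \<Longrightarrow> x \<in> J \<Longrightarrow> x \<otimes> c \<in> J"
  shows "ideal J R"
proof (rule idealI[OF ring_axioms])
  show "subgroup J (add_monoid R)"
  proof (rule add.subgroupI)
    fix a assume "a \<in> J"
    then have "\<ominus> \<one> \<otimes> a \<in> J" by (intro l) auto
    then show "\<ominus> a \<in> J" using \<open>a \<in> J\<close> assms(1) by (auto simp: l_minus)
  qed (use assms in auto)
qed (use l r in auto)

lemma (in cring) cideal_I:
  assumes "J \<subseteq> carrier R" "\<zero> \<in> J"
    and "\<And>x y. x \<in> J \<Longrightarrow> y \<in> J \<Longrightarrow> x \<oplus> y \<in> J"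
    and l: "\<And>c x. c \<in> carrier R \<Longrightarrow> x \<in> J \<Longrightarrow> c \<otimes> x \<in> J"
  shows "ideal J R"
  using assms by (intro idealI_sub) (auto simp: m_comm subset_iff)

lemma idealD:
  assumes "ideal J R"
  shows "x \<in> J \<Longrightarrow> x \<in> carrier R" "\<zero>\<^bsub>R\<^esub> \<in> J" "x \<in> J \<Longrightarrow> y \<in> J \<Longrightarrow> x \<oplus>\<^bsub>R\<^esub> y \<in> J"
    "c \<in> carrier R \<Longrightarrow> x \<in> J \<Longrightarrow> c \<otimes>\<^bsub>R\<^esub> x \<in> J" "c \<in> carrier R \<Longrightarrow> x \<in> J \<Longrightarrow> x \<otimes>\<^bsub>R\<^esub> c \<in> J"
    "J \<subseteq> carrier R"
proof -
  interpret ideal J R by fact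
  show "x \<in> J \<Longrightarrow> x \<in> carrier R" "\<zero>\<^bsub>R\<^esub> \<in> J" "x \<in> J \<Longrightarrow> y \<in> J \<Longrightarrow> x \<oplus>\<^bsub>R\<^esub> y \<in> J"
    "c \<in> carrier R \<Longrightarrow> x \<in> J \<Longrightarrow> c \<otimes>\<^bsub>R\<^esub> x \<in> J" "c \<in> carrier R \<Longrightarrow> x \<in> J \<Longrightarrow> x \<otimes>\<^bsub>R\<^esub> c \<in> J"
    "J \<subseteq> carrier R"
    by (auto intro: I_l_closed I_r_closed a_Hcarr)
qed

lemma ideal_whole_iff:
  assumes "ideal J R" shows "J = carrier R \<longleftrightarrow> \<one>\<^bsub>R\<^esub> \<in> J"
proof -
  interpret ideal J R by fact
  show ?thesis using one_imp_carrier by auto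
qed

section \<open>Prime ideals avoiding a multiplicative set\<close>

text \<open>Krull's theorem: by Zorn's lemma some ideal is maximal among those that contain \<open>I\<close> and avoid \<open>T\<close>, and it is prime because
adding either factor of a product makes it meet \<open>T\<close>. Maximality is kept in the conclusion since \<open>T = {1}\<close> then yields maximal ideals.\<close>

lemma (in cring) ideal_maximal_avoiding:
  assumes I: "ideal I R" and T: "T \<subseteq> carrier R" "\<one> \<in> T" "\<And>x y. x \<in> T \<Longrightarrow> y \<in> T \<Longrightarrow> x \<otimes> y \<in> T"
    and disj: "I \<inter> T = {}"
  obtains Q where "primeideal Q R" "I \<subseteq> Q" "Q \<inter> T = {}"
    "\<And>J. ideal J R \<Longrightarrow> Q \<subseteq> J \<Longrightarrow> J \<inter> T = {} \<Longrightarrow> J = Q"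
proof -
  let ?A = "{J. ideal J R \<and> I \<subseteq> J \<and> J \<inter> T = {}}"
  have "\<exists>M\<in>?A. \<forall>X\<in>?A. M \<subseteq> X \<longrightarrow> X = M"
  proof (rule subset_Zorn_nonempty)
    show "?A \<noteq> {}" using I disj by blast
  next
    fix C assume C: "C \<noteq> {}" "subset.chain ?A C"
    have CA: "C \<subseteq> ?A" using C(2) by (rule subset_chain_def[THEN iffD1, THEN conjunct1])
    have "subset.chain {I. ideal I R} C"
      using C(2) CA by (auto simp: subset_chain_def)
    from chain_Union_is_ideal[OF this] C(1) have "ideal (\<Union>C) R" by simp
    moreover have "I \<subseteq> \<Union>C" using C(1) CA by fastforce
    moreover have "\<Union>C \<inter> T = {}" using CA by fastforce
    ultimately show "\<Union>C \<in> ?A" by simp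
  qed
  then obtain Q where Q0: "Q \<in> ?A" and Q1: "\<forall>X\<in>?A. Q \<subseteq> X \<longrightarrow> X = Q" by (rule bexE)
  from Q0 have Q: "ideal Q R" "I \<subseteq> Q" "Q \<inter> T = {}" by simp_all
  have max: "J = Q" if "ideal J R" "Q \<subseteq> J" "J \<inter> T = {}" for J
    by (rule Q1[rule_format]) (use that Q(2) in auto)
  note Q' = idealD[OF Q(1)]
  have enlarge: "\<exists>t\<in>T. \<exists>q\<in>Q. \<exists>c\<in>carrier R. t = q \<oplus> c \<otimes> x" if x: "x \<in> carrier R" "x \<notin> Q" for x
  proof -
    have J: "ideal (Q <+> PIdl x) R" by (intro add_ideals Q cgenideal_ideal x)
    have J': "Q <+> PIdl x = {q \<oplus> c \<otimes> x | q c. q \<in> Q \<and> c \<in> carrier R}"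
      unfolding set_add_def' cgenideal_def by auto
    have "Q \<subseteq> Q <+> PIdl x"
    proof
      fix q assume "q \<in> Q"
      then have "q \<oplus> \<zero> \<otimes> x \<in> Q <+> PIdl x" unfolding J' by blast
      then show "q \<in> Q <+> PIdl x" using x Q'(1)[OF \<open>q \<in> Q\<close>] by simp
    qed
    moreover have "\<zero> \<oplus> \<one> \<otimes> x \<in> Q <+> PIdl x" unfolding J' using Q'(2) by blast
    then have "x \<in> Q <+> PIdl x" using x by simp
    ultimately have "(Q <+> PIdl x) \<inter> T \<noteq> {}" using max[OF J] x(2) by metis
    then show ?thesis unfolding J' by blast
  qed
  have "primeideal Q R"
  proof (rule primeidealI[OF Q(1) is_cring])
    show "carrier R \<noteq> Q" using T(2) Q(3) by blast
  next
    fix x y assume xy: "x \<in> carrier R" "y \<in> carrier R" "x \<otimes> y \<in> Q"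
    show "x \<in> Q \<or> y \<in> Q"
    proof (rule ccontr)
      assume "\<not> ?thesis"
      then have n: "x \<notin> Q" "y \<notin> Q" by auto
      obtain t q c where *: "t \<in> T" "q \<in> Q" "c \<in> carrier R" "t = q \<oplus> c \<otimes> x"
        using enlarge[OF xy(1) n(1)] by blast
      obtain t' q' c' where **: "t' \<in> T" "q' \<in> Q" "c' \<in> carrier R" "t' = q' \<oplus> c' \<otimes> y"
        using enlarge[OF xy(2) n(2)] by blast
      note * = * **
      note cl = Q'(1)[OF *(2)] Q'(1)[OF *(6)] *(3,7) xy(1,2)
      have "t \<otimes> t' = (q' \<oplus> c' \<otimes> y) \<otimes> q \<oplus> ((c \<otimes> x) \<otimes> q' \<oplus> (c \<otimes> c') \<otimes> (x \<otimes> y))"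
        unfolding *(4,8) using cl by algebra
      also have "\<dots> \<in> Q"
        using cl by (intro Q'(3) Q'(4)[OF _ *(2)] Q'(4)[OF _ *(6)] Q'(4)[OF _ xy(3)]) auto
      finally have "t \<otimes> t' \<in> Q" .
      then show False using T(3)[OF *(1,5)] Q(3) by blast
    qed
  qed
  then show ?thesis using Q(2,3) max by (rule that)
qed

lemma (in cring) prime_ideal_avoiding:
  assumes "ideal I R" "T \<subseteq> carrier R" "\<one> \<in> T" "\<And>x y. x \<in> T \<Longrightarrow> y \<in> T \<Longrightarrow> x \<otimes> y \<in> T"
    and "I \<inter> T = {}"
  shows "\<exists>Q. primeideal Q R \<and> I \<subseteq> Q \<and> Q \<inter> T = {}"
  by (rule ideal_maximal_avoiding[OF assms]) auto

lemma (in cring) exists_maximalideal: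
  assumes "\<one> \<noteq> \<zero>"
  obtains M where "maximalideal M R"
proof -
  obtain Q where Q: "primeideal Q R" "Q \<inter> {\<one>} = {}"
    "\<And>J. ideal J R \<Longrightarrow> Q \<subseteq> J \<Longrightarrow> J \<inter> {\<one>} = {} \<Longrightarrow> J = Q"
    by (rule ideal_maximal_avoiding[OF zeroideal, of "{\<one>}"]) (use assms in auto)
  then have Qi: "ideal Q R" by (simp add: primeideal_def)
  have "maximalideal Q R"
  proof (rule maximalidealI[OF Qi])
    show "carrier R \<noteq> Q" using Q(2) by auto
    fix J assume J: "ideal J R" "Q \<subseteq> J"
    then show "J = Q \<or> J = carrier R" using Q(3)[OF J] ideal_whole_iff[OF J(1)] by blast
  qed
  then show ?thesis using that by blast
qed

definition prime_chain :: "('a, 'b) ring_scheme \<Rightarrow> nat \<Rightarrow> (nat \<Rightarrow> 'a set) \<Rightarrow> bool" where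
  "prime_chain R n P \<longleftrightarrow> (\<forall>i\<le>n. primeideal (P i) R) \<and> (\<forall>i<n. P i \<subset> P (Suc i))"

lemma krull_dim_prime_chain: "krull_dim R = Sup {enat n | n. \<exists>P. prime_chain R n P}"
  unfolding krull_dim_def prime_chain_def ..

text \<open>A regular element modulo \<open>I\<close> makes the prime drop: the products \<open>s x\<^sup>j\<close> with \<open>s \<notin> Q\<close> avoid \<open>I\<close>, and a prime that
avoids them lies inside \<open>Q\<close> and misses \<open>x\<close>.\<close>

lemma (in cring) prime_below_nonzerodivisor:
  assumes Q: "primeideal Q R" and I: "ideal I R" and IQ: "I \<subseteq> Q" and x: "x \<in> Q"
    and nzd: "\<And>a. a \<in> carrier R \<Longrightarrow> x \<otimes> a \<in> I \<Longrightarrow> a \<in> I"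
  obtains P where "primeideal P R" "I \<subseteq> P" "P \<subset> Q"
proof -
  have Qi: "ideal Q R" using Q by (simp add: primeideal_def)
  have xR: "x \<in> carrier R" using idealD(1)[OF Qi x] .
  let ?T = "{s \<otimes> x [^] (j::nat) | s j. s \<in> carrier R - Q}"
  have "\<one> \<notin> Q" using ideal_whole_iff[OF Qi] primeideal.I_notcarr[OF Q] by blast
  have inT: "s \<otimes> x [^] j \<in> ?T" if "s \<in> carrier R - Q" for s and j :: nat
    using that by blast
  have one: "s \<in> ?T" if "s \<in> carrier R - Q" for s
    using inT[OF that, of 0] that by simp
  have pow: "a \<in> I" if "a \<in> carrier R" "a \<otimes> x [^] j \<in> I" for a and j :: nat
    using that
  proof (induction j)
    case (Suc j)
    have "a \<otimes> x [^] Suc j = x \<otimes> (a \<otimes> x [^] j)" using Suc.prems xR by (simp add: m_ac)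
    then have "x \<otimes> (a \<otimes> x [^] j) \<in> I" using Suc.prems by simp
    from nzd[OF _ this] have "a \<otimes> x [^] j \<in> I" using Suc.prems xR by simp
    then show ?case using Suc.IH Suc.prems(1) by blast
  qed auto
  have "\<exists>P. primeideal P R \<and> I \<subseteq> P \<and> P \<inter> ?T = {}"
  proof (rule prime_ideal_avoiding[OF I, of ?T])
    show "?T \<subseteq> carrier R" using xR by auto
    show "\<one> \<in> ?T" using one \<open>\<one> \<notin> Q\<close> by simp
    have "s \<otimes> x [^] j \<notin> I" if "s \<in> carrier R - Q" for s and j :: nat
      using pow[of s j] IQ that by auto
    then show "I \<inter> ?T = {}" by auto
    fix u v assume "u \<in> ?T" "v \<in> ?T"
    from \<open>u \<in> ?T\<close> obtain s i where su: "u = s \<otimes> x [^] (i::nat)" "s \<in> carrier R - Q" by auto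
    from \<open>v \<in> ?T\<close> obtain t j where tv: "v = t \<otimes> x [^] (j::nat)" "t \<in> carrier R - Q" by auto
    note st = su(2,1) tv(2,1)
    have "u \<otimes> v = (s \<otimes> t) \<otimes> (x [^] i \<otimes> x [^] j)"
      unfolding st(2,4) using st(1,3) xR by (simp add: m_ac)
    also have "\<dots> = (s \<otimes> t) \<otimes> x [^] (i + j)" using xR by (simp add: nat_pow_mult)
    also have "\<dots> \<in> ?T" using st(1,3) primeideal.I_prime[OF Q, of s t] by (intro inT) auto
    finally show "u \<otimes> v \<in> ?T" .
  qed
  then obtain P where P: "primeideal P R" "I \<subseteq> P" "P \<inter> ?T = {}" by blast
  have Pi: "ideal P R" using P by (simp add: primeideal_def)
  have "x \<notin> P"
  proof -
    have "\<one> \<otimes> x [^] (1::nat) \<in> ?T" using \<open>\<one> \<notin> Q\<close> by (intro inT) simp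
    then have "x \<in> ?T" using xR by simp
    then show ?thesis using P(3) by blast
  qed
  moreover have "P \<subseteq> Q"
  proof
    fix y assume "y \<in> P"
    then have "y \<in> carrier R" "y \<notin> ?T" using P(3) idealD(1)[OF Pi] by blast+
    then show "y \<in> Q" using one[of y] by blast
  qed
  ultimately have "P \<subset> Q" using x by blast
  with P(1,2) show ?thesis by (rule that)
qed

text \<open>Applied along a regular sequence from its last element to its first, the previous lemma builds a chain of primes
downwards. Hence depth is bounded by dimension.\<close>

lemma (in cring) regular_sequence_prime_chain:
  assumes xs: "regular_sequence R xs"
  shows "\<exists>P. prime_chain R (length xs) P"
proof -
  have car: "set xs \<subseteq> carrier R" using xs unfolding regular_sequence_def by blast
  have car': "set (take k xs) \<subseteq> carrier R" for k using car set_take_subset[of k xs] by blast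
  have id: "ideal (Idl (set (take k xs))) R" for k by (rule genideal_ideal[OF car'])
  have *: "\<exists>P. prime_chain R k P \<and> P k = Q"
    if "primeideal Q R" "Idl (set (take k xs)) \<subseteq> Q" "k \<le> length xs" for k Q
    using that
  proof (induction k arbitrary: Q)
    case 0
    then show ?case by (auto simp: prime_chain_def)
  next
    case (Suc k)
    let ?I = "Idl (set (take k xs))"
    have sub: "set (take (Suc k) xs) = insert (xs ! k) (set (take k xs))"
      using Suc.prems(3) by (simp add: take_Suc_conv_app_nth)
    have "?I \<subseteq> Idl (set (take (Suc k) xs))"
      using sub genideal_self[OF car', of "Suc k"] by (intro genideal_minimal id) auto
    then have IQ: "?I \<subseteq> Q" using Suc.prems(2) by blast
    have xQ: "xs ! k \<in> Q" using genideal_self[OF car', of "Suc k"] Suc.prems(2) sub by blast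
    have nzd: "a \<in> ?I" if "a \<in> carrier R" "xs ! k \<otimes> a \<in> ?I" for a
      using xs that Suc_le_lessD[OF Suc.prems(3)] unfolding regular_sequence_def by simp
    obtain P where P: "primeideal P R" "?I \<subseteq> P" "P \<subset> Q"
      using nzd by (rule prime_below_nonzerodivisor[OF Suc.prems(1) id IQ xQ])
    then obtain Ps where Ps: "prime_chain R k Ps" "Ps k = P" using Suc.IH[OF P(1,2)] Suc.prems(3) by auto
    have "prime_chain R (Suc k) (Ps(Suc k := Q))"
      unfolding prime_chain_def
    proof (intro conjI allI impI)
      fix i assume "i \<le> Suc k"
      then show "primeideal ((Ps(Suc k := Q)) i) R"
        using Ps(1) Suc.prems(1) by (cases "i = Suc k") (simp_all add: prime_chain_def)
    next
      fix i assume "i < Suc k"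
      then show "(Ps(Suc k := Q)) i \<subset> (Ps(Suc k := Q)) (Suc i)"
        using Ps P(3) by (cases "i = k") (simp_all add: prime_chain_def)
    qed
    then show ?case by (intro exI[of _ "Ps(Suc k := Q)"] conjI) (assumption, simp)
  qed
  have "Idl (set xs) \<noteq> carrier R" using xs unfolding regular_sequence_def by blast
  then have "Idl (set xs) \<inter> {\<one>} = {}"
    using ideal_whole_iff[OF id[of "length xs"]] by auto
  then obtain Q where "primeideal Q R" "Idl (set xs) \<subseteq> Q"
    using prime_ideal_avoiding[OF id[of "length xs"], of "{\<one>}"] by auto
  then show ?thesis using *[of Q "length xs"] by auto
qed

text \<open>Serves both for quotients and for localizations, where \<open>c\<close> is the contraction of ideals.\<close>

lemma noetherian_transfer:
  assumes R: "noetherian_ring R" and L: "ring L"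
    and c: "\<And>J. ideal J L \<Longrightarrow> ideal (c J) R"
    and mono: "\<And>J J'. ideal J L \<Longrightarrow> ideal J' L \<Longrightarrow> c J \<subseteq> c J' \<longleftrightarrow> J \<subseteq> J'"
  shows "noetherian_ring L"
proof (rule ring.trivial_ideal_chain_imp_noetherian[OF L])
  fix C assume C: "C \<noteq> {}" "subset.chain {I. ideal I L} C"
  have id: "ideal J L" if "J \<in> C" for J using C(2) that unfolding subset_chain_def by auto
  have "subset.chain {I. ideal I R} (c ` C)"
    unfolding subset_chain_def
  proof (intro conjI ballI)
    show "c ` C \<subseteq> {I. ideal I R}" by (rule image_subsetI) (simp add: c id)
    fix x y assume "x \<in> c ` C" "y \<in> c ` C"
    then obtain J J' where J: "J \<in> C" "x = c J" "J' \<in> C" "y = c J'" by (elim imageE)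
    have "J \<subseteq> J' \<or> J' \<subseteq> J" using C(2) J(1,3) unfolding subset_chain_def by simp
    then show "x \<subseteq> y \<or> y \<subseteq> x"
      using mono[OF id[OF J(1)] id[OF J(3)]] mono[OF id[OF J(3)] id[OF J(1)]] J(2,4) by simp
  qed
  with C(1) have "\<Union>(c ` C) \<in> c ` C" by (intro noetherian_ring.ideal_chain_is_trivial[OF R]) simp_all
  then obtain J where J: "J \<in> C" "\<Union>(c ` C) = c J" by (elim imageE)
  have "J' \<subseteq> J" if "J' \<in> C" for J'
  proof -
    have "c J' \<subseteq> c J" unfolding J(2)[symmetric] using that by (rule UN_upper)
    then show ?thesis using mono[OF id[OF that] id[OF J(1)]] by simp
  qed
  then have "\<Union>C = J" using J(1) by blast
  with J show "\<Union>C \<in> C" by simp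
qed

section \<open>Localization\<close>

locale multiplicative_subset = cring R for R (structure) +
  fixes S :: "'a set"
  assumes S_sub: "S \<subseteq> carrier R" and S_one: "\<one> \<in> S" and S_mult: "s \<in> S \<Longrightarrow> t \<in> S \<Longrightarrow> s \<otimes> t \<in> S"
begin

abbreviation "L \<equiv> localization R S"
abbreviation "frc \<equiv> fraction R S"

lemma S_car: "s \<in> S \<Longrightarrow> s \<in> carrier R" using S_sub by blast

lemma mem_frac:
  assumes "a \<in> carrier R" "s \<in> S"
  shows "p \<in> frc a s \<longleftrightarrow> fst p \<in> carrier R \<and> snd p \<in> S \<and> (\<exists>u\<in>S. u \<otimes> (a \<otimes> snd p) = u \<otimes> (fst p \<otimes> s))"
  using assms unfolding fraction_def frac_rel_def by (cases p) (simp add: Image_iff)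

lemma frac_self: "a \<in> carrier R \<Longrightarrow> s \<in> S \<Longrightarrow> (a, s) \<in> frc a s"
  unfolding mem_frac using S_one by (simp only: fst_conv snd_conv) blast

lemma frac_eq_iff:
  assumes a: "a \<in> carrier R" "s \<in> S" and b: "b \<in> carrier R" "t \<in> S"
  shows "frc a s = frc b t \<longleftrightarrow> (\<exists>u\<in>S. u \<otimes> (a \<otimes> t) = u \<otimes> (b \<otimes> s))"
proof
  assume "frc a s = frc b t"
  then have "(b, t) \<in> frc a s" using frac_self[OF b] by simp
  then show "\<exists>u\<in>S. u \<otimes> (a \<otimes> t) = u \<otimes> (b \<otimes> s)" unfolding mem_frac[OF a] by simp
next
  have trans: "frc a s \<subseteq> frc b t" if ab: "a \<in> carrier R" "s \<in> S" "b \<in> carrier R" "t \<in> S"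
     and u: "u \<in> S" "u \<otimes> (a \<otimes> t) = u \<otimes> (b \<otimes> s)" for a s b t u
  proof
    fix p assume "p \<in> frc a s"
    then obtain v where p: "fst p \<in> carrier R" "snd p \<in> S" "v \<in> S" "v \<otimes> (a \<otimes> snd p) = v \<otimes> (fst p \<otimes> s)"
      using mem_frac[OF ab(1,2)] by blast
    note cl = ab(1,3) p(1) u(1)[THEN S_car] p(2,3)[THEN S_car] ab(2,4)[THEN S_car]
    have "(u \<otimes> v \<otimes> s) \<otimes> (b \<otimes> snd p) = (v \<otimes> snd p) \<otimes> (u \<otimes> (b \<otimes> s))" using cl by (simp add: m_ac)
    also have "\<dots> = (u \<otimes> t) \<otimes> (v \<otimes> (a \<otimes> snd p))" unfolding u(2)[symmetric] using cl by (simp add: m_ac)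
    also have "\<dots> = (u \<otimes> v \<otimes> s) \<otimes> (fst p \<otimes> t)" unfolding p(4) using cl by (simp add: m_ac)
    finally have eq: "(u \<otimes> v \<otimes> s) \<otimes> (b \<otimes> snd p) = (u \<otimes> v \<otimes> s) \<otimes> (fst p \<otimes> t)" .
    have "u \<otimes> v \<otimes> s \<in> S" by (intro S_mult u(1) p(3) ab(2))
    with eq p(1,2) show "p \<in> frc b t" unfolding mem_frac[OF ab(3,4)] by (intro conjI bexI)
  qed
  assume "\<exists>u\<in>S. u \<otimes> (a \<otimes> t) = u \<otimes> (b \<otimes> s)"
  then obtain u where "u \<in> S" "u \<otimes> (a \<otimes> t) = u \<otimes> (b \<otimes> s)" by blast
  then show "frc a s = frc b t"
    using trans[OF a b] trans[OF b a, OF _ sym] by (intro equalityI)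
qed

lemma frac_eqI:
  assumes "a \<in> carrier R" "s \<in> S" "b \<in> carrier R" "t \<in> S" "a \<otimes> t = b \<otimes> s"
  shows "frc a s = frc b t"
  using assms S_one by (auto simp: frac_eq_iff)

lemma carrier_L: "carrier L = {frc a s | a s. a \<in> carrier R \<and> s \<in> S}"
  unfolding localization_def quotient_def fraction_def by auto

lemma carrier_LE:
  assumes "x \<in> carrier L" obtains a s where "a \<in> carrier R" "s \<in> S" "x = frc a s"
  using assms unfolding carrier_L by blast

lemma frac_carrier: "a \<in> carrier R \<Longrightarrow> s \<in> S \<Longrightarrow> frc a s \<in> carrier L"
  unfolding carrier_L by blast

text \<open>Operations on classes are defined as unions over representatives; if the result does not depend on the representatives, the union
collapses to a single class.\<close>

lemma frac_op:
  assumes a: "a \<in> carrier R" "s \<in> S" and b: "b \<in> carrier R" "t \<in> S"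
    and cong: "\<And>a' s' b' t'. a' \<in> carrier R \<Longrightarrow> s' \<in> S \<Longrightarrow> b' \<in> carrier R \<Longrightarrow> t' \<in> S \<Longrightarrow>
       frc a' s' = frc a s \<Longrightarrow> frc b' t' = frc b t \<Longrightarrow> F a' s' b' t' = F a s b t"
  shows "(\<Union>(a, s)\<in>frc a s. \<Union>(b, t)\<in>frc b t. F a s b t) = F a s b t"
proof -
  have "F a' s' b' t' = F a s b t" if "(a', s') \<in> frc a s" "(b', t') \<in> frc b t" for a' s' b' t'
  proof -
    have 1: "a' \<in> carrier R" "s' \<in> S" "b' \<in> carrier R" "t' \<in> S" using that mem_frac a b by auto
    have "\<exists>u\<in>S. u \<otimes> (a \<otimes> s') = u \<otimes> (a' \<otimes> s)" "\<exists>u\<in>S. u \<otimes> (b \<otimes> t') = u \<otimes> (b' \<otimes> t)"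
      using that mem_frac[OF a] mem_frac[OF b] by auto
    then have "frc a s = frc a' s'" "frc b t = frc b' t'" using frac_eq_iff 1 a b by blast+
    then show ?thesis using cong 1 by simp
  qed
  then have "(\<Union>(a', s')\<in>frc a s. \<Union>(b', t')\<in>frc b t. F a' s' b' t') = (\<Union>p\<in>frc a s. \<Union>q\<in>frc b t. F a s b t)"
    by (intro SUP_cong refl) auto
  also have "\<dots> = F a s b t" using frac_self[OF a] frac_self[OF b] by auto
  finally show ?thesis .
qed

lemma mult_L:
  assumes a: "a \<in> carrier R" "s \<in> S" and b: "b \<in> carrier R" "t \<in> S"
  shows "frc a s \<otimes>\<^bsub>L\<^esub> frc b t = frc (a \<otimes> b) (s \<otimes> t)"
proof -
  have "frc a s \<otimes>\<^bsub>L\<^esub> frc b t = (\<Union>(a, s)\<in>frc a s. \<Union>(b, t)\<in>frc b t. frc (a \<otimes> b) (s \<otimes> t))"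
    by (simp add: localization_def)
  also have "\<dots> = frc (a \<otimes> b) (s \<otimes> t)"
  proof (rule frac_op[OF a b])
    fix a' s' b' t' assume c: "a' \<in> carrier R" "s' \<in> S" "b' \<in> carrier R" "t' \<in> S"
      "frc a' s' = frc a s" "frc b' t' = frc b t"
    obtain u where u: "u \<in> S" "u \<otimes> (a' \<otimes> s) = u \<otimes> (a \<otimes> s')" using c a frac_eq_iff by blast
    obtain v where v: "v \<in> S" "v \<otimes> (b' \<otimes> t) = v \<otimes> (b \<otimes> t')" using c b frac_eq_iff by blast
    note cl = a(1) b(1) c(1,3) a(2)[THEN S_car] b(2)[THEN S_car] c(2,4)[THEN S_car] u(1)[THEN S_car] v(1)[THEN S_car]
    have "(u \<otimes> v) \<otimes> ((a' \<otimes> b') \<otimes> (s \<otimes> t)) = (u \<otimes> (a' \<otimes> s)) \<otimes> (v \<otimes> (b' \<otimes> t))" using cl by (simp add: m_ac)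
    also have "\<dots> = (u \<otimes> v) \<otimes> ((a \<otimes> b) \<otimes> (s' \<otimes> t'))" unfolding u(2) v(2) using cl by (simp add: m_ac)
    finally show "frc (a' \<otimes> b') (s' \<otimes> t') = frc (a \<otimes> b) (s \<otimes> t)"
      using a b c u v by (subst frac_eq_iff) (auto intro!: S_mult)
  qed
  finally show ?thesis .
qed

lemma add_L:
  assumes a: "a \<in> carrier R" "s \<in> S" and b: "b \<in> carrier R" "t \<in> S"
  shows "frc a s \<oplus>\<^bsub>L\<^esub> frc b t = frc (a \<otimes> t \<oplus> b \<otimes> s) (s \<otimes> t)"
proof -
  have "frc a s \<oplus>\<^bsub>L\<^esub> frc b t = (\<Union>(a, s)\<in>frc a s. \<Union>(b, t)\<in>frc b t. frc (a \<otimes> t \<oplus> b \<otimes> s) (s \<otimes> t))"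
    by (simp add: localization_def)
  also have "\<dots> = frc (a \<otimes> t \<oplus> b \<otimes> s) (s \<otimes> t)"
  proof (rule frac_op[OF a b])
    fix a' s' b' t' assume c: "a' \<in> carrier R" "s' \<in> S" "b' \<in> carrier R" "t' \<in> S"
      "frc a' s' = frc a s" "frc b' t' = frc b t"
    obtain u where u: "u \<in> S" "u \<otimes> (a' \<otimes> s) = u \<otimes> (a \<otimes> s')" using c a frac_eq_iff by blast
    obtain v where v: "v \<in> S" "v \<otimes> (b' \<otimes> t) = v \<otimes> (b \<otimes> t')" using c b frac_eq_iff by blast
    note cl = a(1) b(1) c(1,3) a(2)[THEN S_car] b(2)[THEN S_car] c(2,4)[THEN S_car] u(1)[THEN S_car] v(1)[THEN S_car]
    have "(u \<otimes> v) \<otimes> ((a' \<otimes> t' \<oplus> b' \<otimes> s') \<otimes> (s \<otimes> t))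
        = (u \<otimes> (a' \<otimes> s)) \<otimes> (v \<otimes> t \<otimes> t') \<oplus> (v \<otimes> (b' \<otimes> t)) \<otimes> (u \<otimes> s \<otimes> s')" using cl by algebra
    also have "\<dots> = (u \<otimes> v) \<otimes> ((a \<otimes> t \<oplus> b \<otimes> s) \<otimes> (s' \<otimes> t'))" unfolding u(2) v(2) using cl by algebra
    finally show "frc (a' \<otimes> t' \<oplus> b' \<otimes> s') (s' \<otimes> t') = frc (a \<otimes> t \<oplus> b \<otimes> s) (s \<otimes> t)"
      using a b c u v by (subst frac_eq_iff) (auto intro!: S_mult simp: S_car)
  qed
  finally show ?thesis .
qed

lemma one_L: "\<one>\<^bsub>L\<^esub> = frc \<one> \<one>" by (simp add: localization_def)
lemma zero_L: "\<zero>\<^bsub>L\<^esub> = frc \<zero> \<one>" by (simp add: localization_def)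

lemma cring_L: "cring L"
proof (rule cringI)
  show "abelian_group L"
  proof (rule abelian_groupI)
    fix x y assume x: "x \<in> carrier L" and y: "y \<in> carrier L"
    obtain a s where *: "a \<in> carrier R" "s \<in> S" "x = frc a s" using x by (rule carrier_LE)
    obtain b t where **: "b \<in> carrier R" "t \<in> S" "y = frc b t" using y by (rule carrier_LE)
    note * = * **
    note cl = *(1,4) *(2,5)[THEN S_car]
    show "x \<oplus>\<^bsub>L\<^esub> y \<in> carrier L" using * cl by (auto simp: add_L intro!: frac_carrier S_mult)
    show "x \<oplus>\<^bsub>L\<^esub> y = y \<oplus>\<^bsub>L\<^esub> x" using * cl by (simp add: add_L m_comm a_comm)
  next
    fix x y z assume x: "x \<in> carrier L" and y: "y \<in> carrier L" and z: "z \<in> carrier L"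
    obtain a s where *: "a \<in> carrier R" "s \<in> S" "x = frc a s" using x by (rule carrier_LE)
    obtain b t where **: "b \<in> carrier R" "t \<in> S" "y = frc b t" using y by (rule carrier_LE)
    obtain c u where ***: "c \<in> carrier R" "u \<in> S" "z = frc c u" using z by (rule carrier_LE)
    note * = * ** ***
    note cl = *(1,4,7) *(2,5,8)[THEN S_car]
    have 1: "(a \<otimes> t \<oplus> b \<otimes> s) \<otimes> u \<oplus> c \<otimes> (s \<otimes> t) = a \<otimes> (t \<otimes> u) \<oplus> (b \<otimes> u \<oplus> c \<otimes> t) \<otimes> s" using cl by algebra
    have 2: "s \<otimes> t \<otimes> u = s \<otimes> (t \<otimes> u)" using cl by algebra
    show "(x \<oplus>\<^bsub>L\<^esub> y) \<oplus>\<^bsub>L\<^esub> z = x \<oplus>\<^bsub>L\<^esub> (y \<oplus>\<^bsub>L\<^esub> z)" using * cl 1 2 by (simp add: add_L S_mult)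
  next
    show "\<zero>\<^bsub>L\<^esub> \<in> carrier L" unfolding zero_L by (intro frac_carrier S_one) auto
  next
    fix x assume "x \<in> carrier L"
    then obtain a s where *: "a \<in> carrier R" "s \<in> S" "x = frc a s" by (rule carrier_LE)
    note cl = *(1) *(2)[THEN S_car]
    show "\<zero>\<^bsub>L\<^esub> \<oplus>\<^bsub>L\<^esub> x = x" using * cl S_one by (simp add: zero_L add_L)
    have "frc (\<ominus> a) s \<oplus>\<^bsub>L\<^esub> x = frc ((\<ominus> a) \<otimes> s \<oplus> a \<otimes> s) (s \<otimes> s)" using * cl by (simp add: add_L)
    also have "(\<ominus> a) \<otimes> s \<oplus> a \<otimes> s = \<zero>" using cl by algebra
    also have "frc \<zero> (s \<otimes> s) = \<zero>\<^bsub>L\<^esub>" unfolding zero_L using * cl S_one by (intro frac_eqI S_mult) auto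
    finally show "\<exists>y\<in>carrier L. y \<oplus>\<^bsub>L\<^esub> x = \<zero>\<^bsub>L\<^esub>" using * frac_carrier by blast
  qed
  show "comm_monoid L"
  proof (rule comm_monoidI)
    fix x y assume x: "x \<in> carrier L" and y: "y \<in> carrier L"
    obtain a s where *: "a \<in> carrier R" "s \<in> S" "x = frc a s" using x by (rule carrier_LE)
    obtain b t where **: "b \<in> carrier R" "t \<in> S" "y = frc b t" using y by (rule carrier_LE)
    note * = * **
    note cl = *(1,4) *(2,5)[THEN S_car]
    show "x \<otimes>\<^bsub>L\<^esub> y \<in> carrier L" using * cl by (auto simp: mult_L intro!: frac_carrier S_mult)
    show "x \<otimes>\<^bsub>L\<^esub> y = y \<otimes>\<^bsub>L\<^esub> x" using * cl by (simp add: mult_L m_comm)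
  next
    fix x y z assume x: "x \<in> carrier L" and y: "y \<in> carrier L" and z: "z \<in> carrier L"
    obtain a s where *: "a \<in> carrier R" "s \<in> S" "x = frc a s" using x by (rule carrier_LE)
    obtain b t where **: "b \<in> carrier R" "t \<in> S" "y = frc b t" using y by (rule carrier_LE)
    obtain c u where ***: "c \<in> carrier R" "u \<in> S" "z = frc c u" using z by (rule carrier_LE)
    note * = * ** ***
    note cl = *(1,4,7) *(2,5,8)[THEN S_car]
    show "(x \<otimes>\<^bsub>L\<^esub> y) \<otimes>\<^bsub>L\<^esub> z = x \<otimes>\<^bsub>L\<^esub> (y \<otimes>\<^bsub>L\<^esub> z)" using * cl by (simp add: mult_L S_mult m_assoc)
  next
    show "\<one>\<^bsub>L\<^esub> \<in> carrier L" unfolding one_L by (intro frac_carrier S_one) auto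
  next
    fix x assume "x \<in> carrier L"
    then obtain a s where *: "a \<in> carrier R" "s \<in> S" "x = frc a s" by (rule carrier_LE)
    then show "\<one>\<^bsub>L\<^esub> \<otimes>\<^bsub>L\<^esub> x = x" using S_one S_car by (simp add: one_L mult_L)
  qed
  fix x y z assume x: "x \<in> carrier L" and y: "y \<in> carrier L" and z: "z \<in> carrier L"
  obtain a s where *: "a \<in> carrier R" "s \<in> S" "x = frc a s" using x by (rule carrier_LE)
  obtain b t where **: "b \<in> carrier R" "t \<in> S" "y = frc b t" using y by (rule carrier_LE)
  obtain c u where ***: "c \<in> carrier R" "u \<in> S" "z = frc c u" using z by (rule carrier_LE)
  note * = * ** ***
  note cl = *(1,4,7) *(2,5,8)[THEN S_car]
  have "((a \<otimes> t \<oplus> b \<otimes> s) \<otimes> c) \<otimes> ((s \<otimes> u) \<otimes> (t \<otimes> u)) = (a \<otimes> c \<otimes> (t \<otimes> u) \<oplus> b \<otimes> c \<otimes> (s \<otimes> u)) \<otimes> ((s \<otimes> t) \<otimes> u)"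
    using cl by algebra
  then have "frc ((a \<otimes> t \<oplus> b \<otimes> s) \<otimes> c) ((s \<otimes> t) \<otimes> u) = frc (a \<otimes> c \<otimes> (t \<otimes> u) \<oplus> b \<otimes> c \<otimes> (s \<otimes> u)) ((s \<otimes> u) \<otimes> (t \<otimes> u))"
    using * cl by (intro frac_eqI S_mult) auto
  then show "(x \<oplus>\<^bsub>L\<^esub> y) \<otimes>\<^bsub>L\<^esub> z = x \<otimes>\<^bsub>L\<^esub> z \<oplus>\<^bsub>L\<^esub> y \<otimes>\<^bsub>L\<^esub> z"
    using * cl by (simp add: mult_L add_L S_mult)
qed

text \<open>The inverse image of an ideal under the canonical map to the localization.\<close>

definition contract :: "('a \<times> 'a) set set \<Rightarrow> 'a set" where
  "contract J = {a \<in> carrier R. frc a \<one> \<in> J}"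

text \<open>Denominators are units of the localization, so membership of a fraction depends on its numerator only. All later facts
about ideals of the localization rest on this.\<close>

lemma frac_in_ideal_iff:
  assumes J: "ideal J L" and a: "a \<in> carrier R" "s \<in> S"
  shows "frc a s \<in> J \<longleftrightarrow> a \<in> contract J"
proof
  note J' = idealD[OF J]
  assume "frc a s \<in> J"
  then have "frc s \<one> \<otimes>\<^bsub>L\<^esub> frc a s \<in> J" using a S_one S_car by (intro J'(4) frac_carrier) auto
  also have "frc s \<one> \<otimes>\<^bsub>L\<^esub> frc a s = frc (s \<otimes> a) (\<one> \<otimes> s)"
    using a S_one S_car by (intro mult_L) auto
  also have "\<dots> = frc a \<one>"
    using a S_one S_car by (intro frac_eqI) (auto simp: m_ac)
  finally show "a \<in> contract J" unfolding contract_def using a by simp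
next
  note J' = idealD[OF J]
  assume "a \<in> contract J"
  then have "frc \<one> s \<otimes>\<^bsub>L\<^esub> frc a \<one> \<in> J" unfolding contract_def using a by (intro J'(4) frac_carrier) auto
  also have "frc \<one> s \<otimes>\<^bsub>L\<^esub> frc a \<one> = frc a s"
    using a S_one S_car by (subst mult_L) auto
  finally show "frc a s \<in> J" .
qed

lemma ideal_contract:
  assumes J: "ideal J L" shows "ideal (contract J) R"
proof (rule cideal_I)
  note J' = idealD[OF J]
  show "contract J \<subseteq> carrier R" unfolding contract_def by blast
  show "\<zero> \<in> contract J" unfolding contract_def using J'(2) by (simp add: zero_L)
  fix x y assume "x \<in> contract J" "y \<in> contract J"
  then show "x \<oplus> y \<in> contract J" using J'(3)[of "frc x \<one>" "frc y \<one>"] S_one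
    unfolding contract_def by (auto simp: add_L)
next
  note J' = idealD[OF J]
  fix c x assume "c \<in> carrier R" "x \<in> contract J"
  then show "c \<otimes> x \<in> contract J" using J'(4)[of "frc c \<one>" "frc x \<one>"] S_one
    unfolding contract_def by (auto simp: mult_L intro!: frac_carrier)
qed

lemma contract_subset_iff:
  assumes J: "ideal J L" and K: "ideal K L"
  shows "contract J \<subseteq> contract K \<longleftrightarrow> J \<subseteq> K"
proof
  assume sub: "contract J \<subseteq> contract K"
  show "J \<subseteq> K"
  proof
    fix x assume x: "x \<in> J"
    then obtain a s where *: "a \<in> carrier R" "s \<in> S" "x = frc a s" using carrier_LE[OF idealD(1)[OF J]] by blast
    then show "x \<in> K" using x sub frac_in_ideal_iff[OF J] frac_in_ideal_iff[OF K] by blast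
  qed
qed (auto simp: contract_def)

lemma primeideal_contract:
  assumes P: "primeideal P L" shows "primeideal (contract P) R"
proof -
  have Pi: "ideal P L" using P by (simp add: primeideal_def)
  show ?thesis
  proof (rule primeidealI[OF ideal_contract[OF Pi] is_cring])
    have "\<one>\<^bsub>L\<^esub> \<notin> P" using ideal_whole_iff[OF Pi] primeideal.I_notcarr[OF P] by blast
    then have "\<one> \<notin> contract P" unfolding contract_def by (simp add: one_L)
    then show "carrier R \<noteq> contract P" using one_closed by blast
  next
    fix a b assume ab: "a \<in> carrier R" "b \<in> carrier R" "a \<otimes> b \<in> contract P"
    then have "frc a \<one> \<otimes>\<^bsub>L\<^esub> frc b \<one> \<in> P" using S_one unfolding contract_def by (simp add: mult_L)
    then have "frc a \<one> \<in> P \<or> frc b \<one> \<in> P"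
      using primeideal.I_prime[OF P] ab S_one frac_carrier by blast
    then show "a \<in> contract P \<or> b \<in> contract P" unfolding contract_def using ab by blast
  qed
qed

lemma prime_chain_contract:
  assumes "prime_chain L n P" shows "prime_chain R n (\<lambda>i. contract (P i))"
proof -
  have id: "ideal (P i) L" if "i \<le> n" for i using assms that unfolding prime_chain_def by (simp add: primeideal_def)
  have "contract (P i) \<subset> contract (P (Suc i))" if "i < n" for i
    using assms that contract_subset_iff[OF id id, of i "Suc i"] contract_subset_iff[OF id id, of "Suc i" i]
    unfolding prime_chain_def by (auto simp: psubset_eq)
  then show ?thesis using assms primeideal_contract unfolding prime_chain_def by blast
qed

lemma noetherian_L: "noetherian_ring R \<Longrightarrow> noetherian_ring L"
  by (rule noetherian_transfer[where c = contract])
    (auto intro: cring.axioms(1)[OF cring_L] ideal_contract simp: contract_subset_iff)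

text \<open>Clearing denominators: the fractions whose numerators some denominator carries into the ideal generated by \<open>X\<close>
form an ideal of the localization.\<close>

lemma genideal_L:
  assumes X: "X \<subseteq> carrier R" and a: "a \<in> carrier R" "s \<in> S"
  shows "frc a s \<in> Idl\<^bsub>L\<^esub> ((\<lambda>x. frc x \<one>) ` X) \<longleftrightarrow> (\<exists>t\<in>S. t \<otimes> a \<in> Idl X)"
proof -
  interpret L: cring L by (rule cring_L)
  have X': "(\<lambda>x. frc x \<one>) ` X \<subseteq> carrier L" using X S_one frac_carrier by blast
  note I = genideal_ideal[OF X]
  note I' = idealD[OF I]
  let ?J = "{frc b t | b t. b \<in> carrier R \<and> t \<in> S \<and> (\<exists>v\<in>S. v \<otimes> b \<in> Idl X)}"
  have J: "ideal ?J L"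
  proof (rule L.cideal_I)
    show "?J \<subseteq> carrier L" using frac_carrier by blast
    have "\<one> \<otimes> \<zero> \<in> Idl X" using I'(2) by simp
    then show "\<zero>\<^bsub>L\<^esub> \<in> ?J" unfolding zero_L using S_one by blast
  next
    fix x y assume "x \<in> ?J" "y \<in> ?J"
    then obtain b t v c u w where *: "x = frc b t" "b \<in> carrier R" "t \<in> S" "v \<in> S" "v \<otimes> b \<in> Idl X"
      "y = frc c u" "c \<in> carrier R" "u \<in> S" "w \<in> S" "w \<otimes> c \<in> Idl X" by blast
    note cl = *(2,7) *(3,4,8,9)[THEN S_car]
    have "(v \<otimes> w) \<otimes> (b \<otimes> u \<oplus> c \<otimes> t) = (w \<otimes> u) \<otimes> (v \<otimes> b) \<oplus> (v \<otimes> t) \<otimes> (w \<otimes> c)" using cl by algebra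
    also have "\<dots> \<in> Idl X" using cl by (intro I'(3) I'(4)[OF _ *(5)] I'(4)[OF _ *(10)]) auto
    finally have "(v \<otimes> w) \<otimes> (b \<otimes> u \<oplus> c \<otimes> t) \<in> Idl X" .
    moreover have "v \<otimes> w \<in> S" "t \<otimes> u \<in> S" "b \<otimes> u \<oplus> c \<otimes> t \<in> carrier R" using * cl S_mult by auto
    moreover have "x \<oplus>\<^bsub>L\<^esub> y = frc (b \<otimes> u \<oplus> c \<otimes> t) (t \<otimes> u)" using * by (simp add: add_L)
    ultimately show "x \<oplus>\<^bsub>L\<^esub> y \<in> ?J" by blast
  next
    fix x y assume "x \<in> carrier L" "y \<in> ?J"
    obtain b t where *: "b \<in> carrier R" "t \<in> S" "x = frc b t" using \<open>x \<in> carrier L\<close> by (rule carrier_LE)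
    obtain c u w where **: "y = frc c u" "c \<in> carrier R" "u \<in> S" "w \<in> S" "w \<otimes> c \<in> Idl X"
      using \<open>y \<in> ?J\<close> by blast
    note * = *(3,1,2) **
    note cl = *(2,5) *(3,6,7)[THEN S_car]
    have "w \<otimes> (b \<otimes> c) = b \<otimes> (w \<otimes> c)" using cl by (simp add: m_ac)
    also have "\<dots> \<in> Idl X" using cl by (intro I'(4)[OF _ *(8)]) auto
    finally have "w \<otimes> (b \<otimes> c) \<in> Idl X" .
    moreover have "t \<otimes> u \<in> S" "b \<otimes> c \<in> carrier R" using * cl S_mult by auto
    moreover have "x \<otimes>\<^bsub>L\<^esub> y = frc (b \<otimes> c) (t \<otimes> u)" using * by (simp add: mult_L)
    ultimately show "x \<otimes>\<^bsub>L\<^esub> y \<in> ?J" using *(7) by blast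
  qed
  have XJ: "(\<lambda>x. frc x \<one>) ` X \<subseteq> ?J"
  proof
    fix y assume "y \<in> (\<lambda>x. frc x \<one>) ` X"
    then obtain x where x: "x \<in> X" "y = frc x \<one>" by blast
    then have "x \<in> Idl X" using genideal_self[OF X] by blast
    then have "\<one> \<otimes> x \<in> Idl X" using I'(1) by simp
    then show "y \<in> ?J" using x X S_one by blast
  qed
  show ?thesis
  proof
    assume "frc a s \<in> Idl\<^bsub>L\<^esub> ((\<lambda>x. frc x \<one>) ` X)"
    then have "frc a s \<in> ?J" using L.genideal_minimal[OF J XJ] by blast
    then obtain b t v where *: "frc a s = frc b t" "b \<in> carrier R" "t \<in> S" "v \<in> S" "v \<otimes> b \<in> Idl X" by blast
    then obtain u where u: "u \<in> S" "u \<otimes> (a \<otimes> t) = u \<otimes> (b \<otimes> s)" using frac_eq_iff a by blast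
    note cl = a(1) *(2) a(2)[THEN S_car] *(3,4)[THEN S_car] u(1)[THEN S_car]
    have "(v \<otimes> u \<otimes> t) \<otimes> a = v \<otimes> (u \<otimes> (a \<otimes> t))" using cl by (simp add: m_ac)
    also have "\<dots> = (u \<otimes> s) \<otimes> (v \<otimes> b)" unfolding u(2) using cl by (simp add: m_ac)
    also have "\<dots> \<in> Idl X" using cl by (intro I'(4)[OF _ *(5)]) auto
    finally show "\<exists>t\<in>S. t \<otimes> a \<in> Idl X" using S_mult * u by blast
  next
    assume "\<exists>t\<in>S. t \<otimes> a \<in> Idl X"
    then obtain t where t: "t \<in> S" "t \<otimes> a \<in> Idl X" by blast
    note IL = L.genideal_ideal[OF X']
    have "X \<subseteq> contract (Idl\<^bsub>L\<^esub> ((\<lambda>x. frc x \<one>) ` X))"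
      unfolding contract_def using X L.genideal_self[OF X'] by auto
    then have "Idl X \<subseteq> contract (Idl\<^bsub>L\<^esub> ((\<lambda>x. frc x \<one>) ` X))"
      by (rule genideal_minimal[OF ideal_contract[OF IL]])
    then have "t \<otimes> a \<in> contract (Idl\<^bsub>L\<^esub> ((\<lambda>x. frc x \<one>) ` X))" using t by blast
    then have "frc (t \<otimes> a) (t \<otimes> s) \<in> Idl\<^bsub>L\<^esub> ((\<lambda>x. frc x \<one>) ` X)"
      using frac_in_ideal_iff[OF IL, of "t \<otimes> a" "t \<otimes> s"] t a S_mult S_car by auto
    moreover have "frc (t \<otimes> a) (t \<otimes> s) = frc a s"
      using t a S_car by (intro frac_eqI S_mult) (auto simp: m_ac)
    ultimately show "frc a s \<in> Idl\<^bsub>L\<^esub> ((\<lambda>x. frc x \<one>) ` X)" by simp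
  qed
qed

end



section \<open>A criterion for the Cohen--Macaulay property\<close>

lemma (in cring) depth_le_krull_dim: "depth I R \<le> krull_dim R"
  unfolding depth_def krull_dim_prime_chain
proof (rule Sup_mono)
  fix d assume "d \<in> {enat (length xs) | xs. regular_sequence R xs \<and> set xs \<subseteq> I}"
  then obtain xs where xs: "d = enat (length xs)" "regular_sequence R xs" by auto
  then obtain P where "prime_chain R (length xs) P" using regular_sequence_prime_chain by blast
  with xs(1) show "\<exists>e\<in>{enat n | n. \<exists>P. prime_chain R n P}. d \<le> e" by auto
qed

lemma krull_dim_leI:
  assumes "\<And>n P. prime_chain R n P \<Longrightarrow> n \<le> r"
  shows "krull_dim R \<le> enat r"
  unfolding krull_dim_prime_chain by (rule Sup_least) (auto dest: assms)

text \<open>The fractions with numerator in \<open>M\<close> form the ideal \<open>N\<close>. A fraction outside \<open>N\<close> has an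
invertible numerator, so every proper ideal lies in \<open>N\<close>.\<close>

lemma (in cring) local_ring_at_maximalideal:
  assumes M: "maximalideal M R"
  defines "L \<equiv> localization_at R M"
  shows "multiplicative_subset R (carrier R - M)"
    and "\<exists>N. maximalideal N L \<and> (\<forall>K. maximalideal K L \<longrightarrow> K = N) \<and>
      (\<forall>a\<in>M. fraction R (carrier R - M) a \<one> \<in> N)"
proof -
  define S where "S = carrier R - M"
  have Mi: "ideal M R" using M by (simp add: maximalideal_def)
  note M' = idealD[OF Mi]
  note Mp = maximalideal_prime[OF M]
  have "\<one> \<notin> M" using ideal_whole_iff[OF Mi] primeideal.I_notcarr[OF Mp] by blast
  have prime: "a \<in> M \<or> b \<in> M" if "a \<in> carrier R" "b \<in> carrier R" "a \<otimes> b \<in> M" for a b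
    using primeideal.I_prime[OF Mp that] .
  interpret S: multiplicative_subset R S
  proof
    show "S \<subseteq> carrier R" "\<one> \<in> S" unfolding S_def using \<open>\<one> \<notin> M\<close> by auto
    show "s \<otimes> t \<in> S" if "s \<in> S" "t \<in> S" for s t
      using that prime[of s t] unfolding S_def by auto
  qed
  show "multiplicative_subset R (carrier R - M)" using S.multiplicative_subset_axioms unfolding S_def .
  have L: "L = localization R S" unfolding L_def localization_at_def S_def ..
  interpret L: cring L unfolding L by (rule S.cring_L)
  define N where "N = {fraction R S a s | a s. a \<in> M \<and> s \<in> S}"
  have memN: "fraction R S a s \<in> N \<longleftrightarrow> a \<in> M" if a: "a \<in> carrier R" "s \<in> S" for a s
  proof
    assume "fraction R S a s \<in> N"
    then obtain b t where b: "fraction R S a s = fraction R S b t" "b \<in> M" "t \<in> S" unfolding N_def by blast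
    then obtain u where u: "u \<in> S" "u \<otimes> (a \<otimes> t) = u \<otimes> (b \<otimes> s)"
      using S.frac_eq_iff[OF a M'(1)[OF b(2)] b(3)] by blast
    have "u \<otimes> (b \<otimes> s) \<in> M" using S.S_car u(1) a(2) by (intro M'(4)[OF _ M'(5)[OF _ b(2)]]) auto
    then have "u \<otimes> (a \<otimes> t) \<in> M" by (simp only: u(2))
    then have "a \<otimes> t \<in> M" using prime[of u "a \<otimes> t"] u(1) a(1) b(3) unfolding S_def by auto
    then show "a \<in> M" using prime[of a t] a(1) b(3) unfolding S_def by auto
  next
    assume "a \<in> M" then show "fraction R S a s \<in> N" using a(2) unfolding N_def by blast
  qed
  have Ni: "ideal N L"
  proof (rule L.cideal_I)
    show "N \<subseteq> carrier L" unfolding N_def L using S.frac_carrier M'(1) by blast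
    show "\<zero>\<^bsub>L\<^esub> \<in> N" unfolding L S.zero_L by (simp add: memN M'(2) S.S_one)
  next
    fix x y assume "x \<in> N" "y \<in> N"
    then obtain a s b t where *: "x = fraction R S a s" "a \<in> M" "s \<in> S" "y = fraction R S b t" "b \<in> M" "t \<in> S"
      unfolding N_def by blast
    note car = M'(1)[OF *(2)] M'(1)[OF *(5)] S.S_car[OF *(3)] S.S_car[OF *(6)]
    have "a \<otimes> t \<oplus> b \<otimes> s \<in> M" using car by (intro M'(3) M'(5)[OF _ *(2)] M'(5)[OF _ *(5)])
    then show "x \<oplus>\<^bsub>L\<^esub> y \<in> N" using * car by (simp add: L S.add_L memN S.S_mult)
  next
    fix x y assume "x \<in> carrier L" "y \<in> N"
    from \<open>x \<in> carrier L\<close> obtain a s where a: "a \<in> carrier R" "s \<in> S" "x = fraction R S a s"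
      unfolding L by (rule S.carrier_LE)
    obtain b t where b: "y = fraction R S b t" "b \<in> M" "t \<in> S" using \<open>y \<in> N\<close> unfolding N_def by blast
    have "a \<otimes> b \<in> M" by (rule M'(4)[OF a(1) b(2)])
    then show "x \<otimes>\<^bsub>L\<^esub> y \<in> N" using a b M'(1)[OF b(2)] by (simp add: L S.mult_L memN S.S_mult)
  qed
  have oneN: "\<one>\<^bsub>L\<^esub> \<notin> N" unfolding L S.one_L by (simp add: memN \<open>\<one> \<notin> M\<close> S.S_one)
  have sub: "J \<subseteq> N" if J: "ideal J L" "J \<noteq> carrier L" for J
  proof
    fix x assume x: "x \<in> J"
    then have "x \<in> carrier L" by (rule idealD(1)[OF J(1)])
    then obtain a s where a: "a \<in> carrier R" "s \<in> S" "x = fraction R S a s"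
      unfolding L by (rule S.carrier_LE)
    show "x \<in> N"
    proof (rule ccontr)
      assume "x \<notin> N"
      then have aS: "a \<in> S" using memN[OF a(1,2)] a(1,3) unfolding S_def by blast
      note car = S.S_car[OF aS] S.S_car[OF a(2)]
      have "fraction R S s a \<otimes>\<^bsub>L\<^esub> x \<in> J"
        using x car aS by (intro idealD(4)[OF J(1)]) (auto simp: L intro: S.frac_carrier)
      moreover have "fraction R S s a \<otimes>\<^bsub>L\<^esub> x = fraction R S (s \<otimes> a) (a \<otimes> s)"
        unfolding a(3) L using car aS a(2) by (intro S.mult_L) auto
      moreover have "\<dots> = \<one>\<^bsub>L\<^esub>"
        unfolding L S.one_L using car aS a(2) S.S_one by (intro S.frac_eqI S.S_mult) (auto simp: m_ac)
      ultimately show False using J ideal_whole_iff[OF J(1)] by simp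
    qed
  qed
  have Nmax: "maximalideal N L"
  proof (rule maximalidealI[OF Ni])
    show "carrier L \<noteq> N" using oneN L.one_closed by blast
    show "J = N \<or> J = carrier L" if "ideal J L" "N \<subseteq> J" for J
      using sub[OF that(1)] that(2) by blast
  qed
  have "K = N" if K: "maximalideal K L" for K
  proof -
    have Ki: "ideal K L" using K by (simp add: maximalideal_def)
    have "K \<subseteq> N" using sub[OF Ki] maximalideal.I_notcarr[OF K] by simp
    then show ?thesis
      using maximalideal.I_maximal[OF K Ni] idealD(6)[OF Ni] oneN L.one_closed by auto
  qed
  moreover have "\<forall>a\<in>M. fraction R (carrier R - M) a \<one> \<in> N"
    using memN S.S_one M'(1) unfolding S_def by blast
  ultimately show "\<exists>N. maximalideal N L \<and> (\<forall>K. maximalideal K L \<longrightarrow> K = N) \<and>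
      (\<forall>a\<in>M. fraction R (carrier R - M) a \<one> \<in> N)" using Nmax by (intro exI[of _ N] conjI allI impI)
qed

text \<open>Flatness of localization, in the form in which it is used here: a denominator that is needed to move an element into the ideal can be
multiplied into the element itself.\<close>

lemma (in multiplicative_subset) regular_sequence_L:
  assumes xs: "regular_sequence R xs"
    and proper: "ideal N L" "\<one>\<^bsub>L\<^esub> \<notin> N" "\<And>a. a \<in> set xs \<Longrightarrow> frc a \<one> \<in> N"
  shows "regular_sequence L (map (\<lambda>x. frc x \<one>) xs)"
proof -
  interpret L: cring L by (rule cring_L)
  have car: "set xs \<subseteq> carrier R" using xs unfolding regular_sequence_def by blast
  have car': "set (take k xs) \<subseteq> carrier R" for k using car set_take_subset[of k xs] by blast
  have tk: "set (take i (map (\<lambda>x. frc x \<one>) xs)) = (\<lambda>x. frc x \<one>) ` set (take i xs)" for i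
    by (simp add: take_map)
  show ?thesis
    unfolding regular_sequence_def
  proof (intro conjI allI impI ballI)
    show "set (map (\<lambda>x. frc x \<one>) xs) \<subseteq> carrier L"
      using car S_one frac_carrier by auto
    have "Idl\<^bsub>L\<^esub> (set (map (\<lambda>x. frc x \<one>) xs)) \<subseteq> N"
      using proper(3) by (intro L.genideal_minimal[OF proper(1)]) auto
    then show "Idl\<^bsub>L\<^esub> (set (map (\<lambda>x. frc x \<one>) xs)) \<noteq> carrier L"
      using proper(2) L.one_closed by blast
  next
    fix i x assume i: "i < length (map (\<lambda>x. frc x \<one>) xs)" and x: "x \<in> carrier L"
      and m: "map (\<lambda>x. frc x \<one>) xs ! i \<otimes>\<^bsub>L\<^esub> x \<in> Idl\<^bsub>L\<^esub> (set (take i (map (\<lambda>x. frc x \<one>) xs)))"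
    from x obtain a s where a: "a \<in> carrier R" "s \<in> S" "x = frc a s" by (rule carrier_LE)
    let ?y = "xs ! i"
    let ?I = "Idl (set (take i xs))"
    have y: "?y \<in> carrier R" using i car by auto
    have "map (\<lambda>x. frc x \<one>) xs ! i \<otimes>\<^bsub>L\<^esub> x = frc (?y \<otimes> a) s"
      using i y a S_one S_car by (simp add: mult_L)
    then have "frc (?y \<otimes> a) s \<in> Idl\<^bsub>L\<^esub> ((\<lambda>x. frc x \<one>) ` set (take i xs))" using m unfolding tk by simp
    then obtain t where t: "t \<in> S" "t \<otimes> (?y \<otimes> a) \<in> ?I"
      using genideal_L[OF car', of "?y \<otimes> a" s i] y a by auto
    have "?y \<otimes> (t \<otimes> a) \<in> ?I" using t y a S_car by (simp add: m_lcomm)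
    then have "t \<otimes> a \<in> ?I" using xs i t a S_car unfolding regular_sequence_def by auto
    then have "x \<in> Idl\<^bsub>L\<^esub> ((\<lambda>x. frc x \<one>) ` set (take i xs))"
      unfolding a(3) using genideal_L[OF car' a(1,2), of i] t(1) by auto
    then show "x \<in> Idl\<^bsub>L\<^esub> (set (take i (map (\<lambda>x. frc x \<one>) xs)))" unfolding tk .
  qed
qed

text \<open>At every maximal ideal the regular sequence survives in the localization, so that \<open>r \<le> depth\<close>; depth is at most dimension by
the prime chains built from regular sequences; and chains of primes of the localization contract to chains of \<open>R\<close>, so the dimension is at most \<open>r\<close>.\<close>

theorem (in cring) cohen_macaulay_criterion:
  assumes noeth: "noetherian_ring R" and nz: "\<one> \<noteq> \<zero>"
    and bound: "\<And>n P. prime_chain R n P \<Longrightarrow> n \<le> r"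
    and reg: "\<And>M. maximalideal M R \<Longrightarrow> \<exists>xs. regular_sequence R xs \<and> set xs \<subseteq> M \<and> length xs = r"
  shows "cohen_macaulay R \<and> krull_dim R = enat r"
proof
  show "cohen_macaulay R"
    unfolding cohen_macaulay_def
  proof (intro conjI allI impI)
    show "cring R" by (rule is_cring)
    show "noetherian_ring R" by (rule noeth)
    fix M assume M: "maximalideal M R"
    let ?S = "carrier R - M"
    let ?L = "localization_at R M"
    interpret S: multiplicative_subset R ?S by (rule local_ring_at_maximalideal(1)[OF M])
    have L: "?L = localization R ?S" unfolding localization_at_def ..
    interpret L: cring ?L unfolding L by (rule S.cring_L)
    obtain N where N': "maximalideal N ?L \<and> (\<forall>K. maximalideal K ?L \<longrightarrow> K = N) \<and>
        (\<forall>a\<in>M. fraction R ?S a \<one> \<in> N)"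
      using local_ring_at_maximalideal(2)[OF M] by (rule exE)
    have N: "maximalideal N ?L" "\<And>K. maximalideal K ?L \<Longrightarrow> K = N"
      "\<And>a. a \<in> M \<Longrightarrow> fraction R ?S a \<one> \<in> N"
      using N' by simp_all
    have Ni: "ideal N ?L" using N(1) by (simp add: maximalideal_def)
    have oneN: "\<one>\<^bsub>?L\<^esub> \<notin> N" using ideal_whole_iff[OF Ni] maximalideal.I_notcarr[OF N(1)] by simp
    obtain xs where xs: "regular_sequence R xs" "set xs \<subseteq> M" "length xs = r" using reg[OF M] by blast
    have "regular_sequence ?L (map (\<lambda>x. fraction R ?S x \<one>) xs)"
      unfolding L
      by (rule S.regular_sequence_L[OF xs(1)]) (use Ni oneN N(3) xs(2) in \<open>auto simp: L\<close>)
    moreover have "set (map (\<lambda>x. fraction R ?S x \<one>) xs) \<subseteq> N" using N(3) xs(2) by auto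
    ultimately have "enat (length (map (\<lambda>x. fraction R ?S x \<one>) xs)) \<le> depth N ?L"
      unfolding depth_def by (intro Sup_upper) blast
    then have 1: "enat r \<le> depth N ?L" using xs(3) by simp
    have 2: "depth N ?L \<le> krull_dim ?L" by (rule L.depth_le_krull_dim)
    have 3: "krull_dim ?L \<le> enat r"
      by (rule krull_dim_leI) (use S.prime_chain_contract bound in \<open>auto simp: L\<close>)
    have eq: "depth N ?L = krull_dim ?L" using 1 2 3 by order
    show "cohen_macaulay_local ?L"
      unfolding cohen_macaulay_local_def noetherian_local_ring_def
    proof (intro conjI allI impI)
      show "cring ?L" by (rule L.is_cring)
      show "noetherian_ring ?L" unfolding L by (rule S.noetherian_L[OF noeth])
      show "\<exists>!M. maximalideal M ?L" using N(1,2) by (intro ex1I)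
      show "depth K ?L = krull_dim ?L" if "maximalideal K ?L" for K using N(2)[OF that] eq by simp
    qed
  qed
  obtain M where M: "maximalideal M R" using exists_maximalideal[OF nz] by blast
  obtain xs where xs: "regular_sequence R xs" "set xs \<subseteq> M" "length xs = r" using reg[OF M] by blast
  have "enat (length xs) \<le> depth M R" unfolding depth_def using xs(1,2) by (intro Sup_upper) blast
  also have "\<dots> \<le> krull_dim R" by (rule depth_le_krull_dim)
  finally have "enat r \<le> krull_dim R" by (simp only: xs(3))
  moreover have "krull_dim R \<le> enat r" by (rule krull_dim_leI[OF bound])
  ultimately show "krull_dim R = enat r" by (rule antisym[rotated])
qed



section \<open>Polynomials with variables in a finite set\<close>

type_synonym ('v, 'k) mpol = "('v \<Rightarrow>\<^sub>0 nat) \<Rightarrow>\<^sub>0 'k"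

abbreviation "keys \<equiv> Poly_Mapping.keys"
abbreviation "lookup \<equiv> Poly_Mapping.lookup"
abbreviation "single \<equiv> Poly_Mapping.single"

definition poly_carrier :: "'v set \<Rightarrow> ('v, 'k::field) mpol set" where
  "poly_carrier V = {p. \<forall>m\<in>keys p. keys m \<subseteq> V}"

definition const :: "'k::field \<Rightarrow> ('v, 'k) mpol" where
  "const c = single 0 c"

text \<open>The Stanley--Reisner ideal of \<open>\<Delta>\<close>: since it is spanned by monomials, it is described by the
supports of the monomials that may occur.\<close>

definition sr_ideal :: "'v set \<Rightarrow> 'v set set \<Rightarrow> ('v, 'k::field) mpol set" where
  "sr_ideal V \<Delta> = {p \<in> poly_carrier V. \<forall>m\<in>keys p. keys m \<notin> \<Delta>}"

abbreviation eval_poly :: "'k::field poly \<Rightarrow> ('v, 'k) mpol \<Rightarrow> ('v, 'k) mpol" where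
  "eval_poly f \<theta> \<equiv> poly (map_poly const f) \<theta>"

lemma keys_add_nat: "keys (a + b :: 'v \<Rightarrow>\<^sub>0 nat) = keys a \<union> keys b"
  by (auto simp: in_keys_iff lookup_add)

lemma is_subring_poly_carrier: "is_subring (poly_carrier V :: ('v, 'k::field) mpol set)"
  unfolding is_subring_def
proof (intro conjI ballI)
  show "(1 :: ('v, 'k) mpol) \<in> poly_carrier V" by (simp add: poly_carrier_def)
next
  fix p q :: "('v, 'k) mpol" assume pq: "p \<in> poly_carrier V" "q \<in> poly_carrier V"
  have "keys (p - q) \<subseteq> keys p \<union> keys q"
    by (auto simp: in_keys_iff lookup_minus)
  then show "p - q \<in> poly_carrier V" using pq unfolding poly_carrier_def by blast
  show "p * q \<in> poly_carrier V"
    unfolding poly_carrier_def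
  proof (intro CollectI ballI)
    fix m assume "m \<in> keys (p * q)"
    then obtain a b where "a \<in> keys p" "b \<in> keys q" "m = a + b"
      using keys_mult[of p q] by blast
    then show "keys m \<subseteq> V" using pq unfolding poly_carrier_def by (simp add: keys_add_nat)
  qed
qed

lemma const_in_poly_carrier: "const c \<in> poly_carrier V" by (simp add: poly_carrier_def const_def)
lemma const_0 [simp]: "const 0 = 0" by (simp add: const_def)
lemma const_1 [simp]: "const 1 = 1" by (simp add: const_def)
lemma const_eq_0_iff [simp]: "const c = 0 \<longleftrightarrow> c = 0"
  by (metis const_0 const_def lookup_single_eq lookup_zero)
lemma const_mult: "const (a * b) = const a * const b" by (simp add: const_def mult_single)
lemma const_diff: "const (a - b) = const a - const b" by (simp add: const_def single_diff)
lemma var_in_poly_carrier: "v \<in> V \<Longrightarrow> var v \<in> poly_carrier V" by (simp add: poly_carrier_def var_def)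

lemma is_subring_const: "is_subring (range (const :: 'k::field \<Rightarrow> ('v, 'k) mpol))"
  unfolding is_subring_def
  by (auto simp: const_mult[symmetric] const_diff[symmetric] intro!: range_eqI[of _ _ 1])

lemma mpol_sum_terms: "p = (\<Sum>m\<in>keys p. single m (lookup p m))"
  by (intro poly_mapping_eqI) (simp add: lookup_sum lookup_single when_def in_keys_iff)

lemma lookup_single_times:
  fixes p :: "('v, 'k::field) mpol"
  shows "lookup (single t c * p) (t + k) = c * lookup p k"
  by (simp add: lookup_mult lookup_single when_mult)

lemma lookup_single_times_not:
  fixes p :: "('v, 'k::field) mpol"
  assumes "\<And>q. k \<noteq> t + q"
  shows "lookup (single t c * p) k = 0"
  using assms by (simp add: lookup_mult lookup_single when_mult)

lemma lookup_const_times: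
  fixes p :: "('v, 'k::field) mpol"
  shows "lookup (const c * p) k = c * lookup p k"
  using lookup_single_times[of 0 c p k] by (simp add: const_def)

lemma var_power: "(var v :: ('v, 'k::field) mpol) ^ n = single (single v n) 1"
  by (induction n) (simp_all add: var_def mult_single single_add[symmetric])

text \<open>Powers of a variable can be split off a monomial as far as its exponent allows.\<close>

lemma single_factor:
  fixes c :: "'k::field"
  assumes "n \<le> lookup m v"
  shows "single m c = var v ^ n * single (m - single v n) c"
proof -
  have "m = single v n + (m - single v n)"
    by (rule poly_mapping_eqI) (use assms in \<open>auto simp: lookup_add lookup_minus lookup_single when_def\<close>)
  then show ?thesis by (simp add: var_power mult_single)
qed

lemma single_in_subring:
  fixes c :: "'k::field"
  assumes A: "is_subring A" "range const \<subseteq> A" "\<And>v. v \<in> keys m \<Longrightarrow> var v \<in> A"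
  shows "single m c \<in> A"
  using A(3)
proof (induction "card (keys m)" arbitrary: m)
  case 0
  then have "m = 0" by (auto simp: poly_mapping_eq_iff fun_eq_iff in_keys_iff) 
  then have "single m c = const c" by (simp add: const_def)
  then show ?case using A(2) by auto
next
  case (Suc k)
  then obtain v where v: "v \<in> keys m" by fastforce
  let ?m = "m - single v (lookup m v)"
  have km: "keys ?m = keys m - {v}"
    by (auto simp: in_keys_iff lookup_minus lookup_single when_def split: if_splits)
  have "single ?m c \<in> A"
    using Suc.prems Suc.hyps(2) v unfolding km by (intro Suc.hyps(1)) (auto simp: km)
  then show ?case
    unfolding single_factor[OF order_refl, of m c v]
    by (intro is_subringD(4,7)[OF A(1)] Suc.prems v)
qed

lemma poly_carrier_subset_subring:
  assumes A: "is_subring A" "range const \<subseteq> A" "\<And>v. v \<in> V \<Longrightarrow> var v \<in> A"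
  shows "(poly_carrier V :: ('v, 'k::field) mpol set) \<subseteq> A"
proof
  fix p :: "('v, 'k) mpol" assume p: "p \<in> poly_carrier V"
  show "p \<in> A"
    by (subst mpol_sum_terms, intro is_subring_sum[OF A(1)] single_in_subring[OF A(1,2)] A(3))
      (use p in \<open>auto simp: poly_carrier_def\<close>)
qed

lemma foldl_adjoin:
  assumes "is_subring A"
  shows "is_subring (foldl adjoin A xs) \<and> A \<subseteq> foldl adjoin A xs \<and> set xs \<subseteq> foldl adjoin A xs"
  using assms
proof (induction xs arbitrary: A)
  case (Cons x xs)
  show ?case
    using Cons.IH[OF is_subring_adjoin[OF Cons.prems, of x]] subset_adjoin[OF Cons.prems, of x]
      self_in_adjoin[OF Cons.prems, of x] by auto
qed simp

lemma foldl_adjoin_subset: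
  assumes "is_subring C" "A \<subseteq> C" "set xs \<subseteq> C"
  shows "foldl adjoin A xs \<subseteq> C"
  using assms(2,3)
  by (induction xs arbitrary: A) (use adjoin_subset[OF assms(1)] in auto)

text \<open>The starting ring \<open>A\<close> is arbitrary: the constants are used for noetherianness, and the constants together with a further element
\<open>\<theta>\<close> are used for Zariski's lemma.\<close>

lemma poly_carrier_eq_foldl_adjoin:
  fixes A :: "('v, 'k::field) mpol set"
  assumes "is_subring A" "range const \<subseteq> A" "A \<subseteq> poly_carrier V" "set vs = V"
  shows "foldl adjoin A (map var vs) = poly_carrier V"
proof
  show "foldl adjoin A (map var vs) \<subseteq> poly_carrier V"
    using assms by (intro foldl_adjoin_subset is_subring_poly_carrier) (auto intro: var_in_poly_carrier)
  show "poly_carrier V \<subseteq> foldl adjoin A (map var vs)"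
    using foldl_adjoin[OF assms(1), of "map var vs"] assms(2,4) by (intro poly_carrier_subset_subring) auto
qed

lemma acc_foldl_adjoin: "is_subring A \<Longrightarrow> acc A \<Longrightarrow> acc (foldl adjoin A xs)"
  by (induction xs arbitrary: A) (auto intro: hilbert_basis is_subring_adjoin)

lemma const_inverse: "c \<noteq> 0 \<Longrightarrow> const (inverse c) * const c = (1 :: ('v, 'k::field) mpol)"
  by (simp flip: const_mult)

text \<open>A nonzero ideal of a field is the whole field, so a chain of ideals changes at most once.\<close>

lemma acc_const: "acc (range (const :: 'k::field \<Rightarrow> ('v, 'k) mpol))"
  unfolding acc_def
proof (intro allI impI, elim conjE)
  fix J :: "nat \<Rightarrow> ('v, 'k) mpol set"
  assume J: "\<forall>n. ideal_of (range const) (J n)" and inc: "\<forall>n. J n \<subseteq> J (Suc n)"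
  have mono: "J i \<subseteq> J j" if "i \<le> j" for i j using inc that by (simp add: lift_Suc_mono_le)
  note J' = ideal_ofD[OF J[rule_format] is_subring_const]
  have whole: "J n = range const" if "x \<in> J n" "x \<noteq> 0" for n x
  proof
    show "J n \<subseteq> range const" using J'(1) by blast
    obtain c where c: "x = const c" using J'(1) \<open>x \<in> J n\<close> by blast
    then have "c \<noteq> 0" using that(2) by auto
    have "const d \<in> J n" for d
    proof -
      have "const d = (const d * const (inverse c)) * x"
        unfolding c by (simp only: mult.assoc const_inverse[OF \<open>c \<noteq> 0\<close>] mult_1_right)
      also have "\<dots> \<in> J n" using that(1) by (intro J'(4)) (auto simp flip: const_mult)
      finally show ?thesis .
    qed
    then show "range const \<subseteq> J n" by blast
  qed
  show "\<exists>n. \<forall>m\<ge>n. J m = J n"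
  proof (cases "\<exists>n x. x \<in> J n \<and> x \<noteq> 0")
    case True
    then obtain n x where x: "x \<in> J n" "x \<noteq> 0" by blast
    then have "J m = J n" if "m \<ge> n" for m
      using whole[OF x] whole[of x m] mono[OF that] by blast
    then show ?thesis by blast
  next
    case False
    then have "J n = {0}" for n using J'(2) by blast
    then show ?thesis by simp
  qed
qed

lemma acc_poly_carrier:
  assumes "finite V" shows "acc (poly_carrier V :: ('v, 'k::field) mpol set)"
proof -
  obtain vs where "set vs = V" using finite_list[OF assms] by blast
  then have "foldl adjoin (range const) (map var vs) = (poly_carrier V :: ('v, 'k) mpol set)"
    by (intro poly_carrier_eq_foldl_adjoin is_subring_const) (auto intro: const_in_poly_carrier)
  then show ?thesis using acc_foldl_adjoin[OF is_subring_const acc_const] by metis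
qed

lemma g_domain_mod_foldl_adjoin:
  assumes C: "is_subring C" and M: "prime_of C M" and A: "is_subring A" and "A \<subseteq> C" "set xs \<subseteq> C"
    and g: "g_domain_mod M (foldl adjoin A xs)"
  shows "g_domain_mod M A"
  using assms(3-6)
proof (induction xs arbitrary: A)
  case (Cons x xs)
  have "g_domain_mod M (adjoin A x)"
    by (rule Cons.IH[OF is_subring_adjoin[OF Cons.prems(1)] adjoin_subset[OF C Cons.prems(2)]])
      (use Cons.prems in simp_all)
  then show ?case using Cons.prems by (intro g_domain_mod_descends[OF C M Cons.prems(1,2), of x]) simp_all
qed simp

text \<open>Modulo \<open>M\<close> the whole polynomial ring is a field and so satisfies the G-domain condition. Removing the
variables one at a time, the condition descends to \<open>K[\<theta>]\<close>, and there it forces \<open>\<theta>\<close> to be algebraic.\<close>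

theorem zariski:
  fixes M :: "('v, 'k::field) mpol set"
  assumes V: "finite V" and M: "prime_of (poly_carrier V) M"
    and max: "\<And>b. b \<in> poly_carrier V \<Longrightarrow> b \<notin> M \<Longrightarrow> \<exists>c\<in>poly_carrier V. b * c - 1 \<in> M"
    and \<theta>: "\<theta> \<in> poly_carrier V"
  shows "\<exists>f. f \<noteq> 0 \<and> eval_poly f \<theta> \<in> M"
proof -
  let ?K = "range const :: ('v, 'k) mpol set"
  let ?A = "adjoin ?K \<theta>"
  have KV: "?K \<subseteq> poly_carrier V" by (auto intro: const_in_poly_carrier)
  have A: "is_subring ?A" by (rule is_subring_adjoin[OF is_subring_const])
  have AV: "?A \<subseteq> poly_carrier V" by (rule adjoin_subset[OF is_subring_poly_carrier KV \<theta>])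
  obtain vs where vs: "set vs = V" using finite_list[OF V] by blast
  have eq: "foldl adjoin ?A (map var vs) = poly_carrier V"
    by (rule poly_carrier_eq_foldl_adjoin[OF A subset_adjoin[OF is_subring_const] AV vs])
  have "g_domain_mod M (poly_carrier V)"
    unfolding g_domain_mod_def
  proof (rule bexI[of _ 1], rule ballI, rule exI[of _ 0])
    show "1 \<in> poly_carrier V - M" using prime_ofD(2)[OF M] is_subringD(1)[OF is_subring_poly_carrier] by blast
    show "\<exists>c\<in>poly_carrier V. b * c - 1 ^ 0 \<in> M" if "b \<in> poly_carrier V - M" for b using max[of b] that by simp
  qed
  then have "g_domain_mod M (foldl adjoin ?A (map var vs))" by (simp only: eq)
  from _ this have "g_domain_mod M ?A"
    by (rule g_domain_mod_foldl_adjoin[OF is_subring_poly_carrier M A AV, of "map var vs"])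
      (use vs in \<open>auto intro: var_in_poly_carrier\<close>)
  then obtain f where f: "f \<in> polys_over ?K" "poly f \<theta> \<in> M" "lead_coeff f \<notin> M"
    using g_domain_mod_adjoin_imp_algebraic[OF is_subring_poly_carrier M is_subring_const KV \<theta>] by blast
  define f0 where "f0 = map_poly (\<lambda>p. lookup p 0) f"
  have "const (lookup (poly.coeff f i) 0) = poly.coeff f i" for i
  proof -
    obtain c where "poly.coeff f i = const c" using f(1) by (auto simp: polys_over_def)
    then show ?thesis by (simp add: const_def)
  qed
  then have f0: "map_poly const f0 = f"
    unfolding f0_def by (intro poly_eqI) (simp add: coeff_map_poly)
  have "f \<noteq> 0" using f(3) ideal_ofD(2)[OF prime_ofD(1)[OF M] is_subring_poly_carrier] by auto
  then have "f0 \<noteq> 0" using f0 by auto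
  then show ?thesis using f0 f(2) by blast
qed


section \<open>Stanley--Reisner ideals\<close>

definition down_closed :: "'v set set \<Rightarrow> bool" where
  "down_closed \<Delta> \<longleftrightarrow> (\<forall>F\<in>\<Delta>. \<forall>F'. F' \<subseteq> F \<longrightarrow> F' \<in> \<Delta>)"

lemma ideal_of_sr_ideal:
  assumes "down_closed \<Delta>"
  shows "ideal_of (poly_carrier V) (sr_ideal V \<Delta> :: ('v, 'k::field) mpol set)"
  unfolding ideal_of_def
proof (intro conjI ballI)
  show "sr_ideal V \<Delta> \<subseteq> (poly_carrier V :: ('v, 'k) mpol set)" by (auto simp: sr_ideal_def)
  show "(0 :: ('v, 'k) mpol) \<in> sr_ideal V \<Delta>" by (simp add: sr_ideal_def poly_carrier_def)
next
  fix p q :: "('v, 'k) mpol" assume pq: "p \<in> sr_ideal V \<Delta>" "q \<in> sr_ideal V \<Delta>"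
  then have "p + q \<in> poly_carrier V" using is_subringD(6)[OF is_subring_poly_carrier] unfolding sr_ideal_def by blast
  then show "p + q \<in> sr_ideal V \<Delta>" using pq keys_add[of p q] unfolding sr_ideal_def by blast
next
  fix c p :: "('v, 'k) mpol" assume c: "c \<in> poly_carrier V" and p: "p \<in> sr_ideal V \<Delta>"
  then have "c * p \<in> poly_carrier V" using is_subringD(4)[OF is_subring_poly_carrier] unfolding sr_ideal_def by blast
  moreover have "keys m \<notin> \<Delta>" if m: "m \<in> keys (c * p)" for m
  proof -
    obtain a b where ab: "b \<in> keys p" "m = a + b" using m keys_mult[of c p] by blast
    then have "keys b \<subseteq> keys m" by (simp add: keys_add_nat)
    moreover have "keys b \<notin> \<Delta>" using p ab(1) unfolding sr_ideal_def by blast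
    ultimately show ?thesis using assms unfolding down_closed_def by blast
  qed
  ultimately show "c * p \<in> sr_ideal V \<Delta>" unfolding sr_ideal_def by blast
qed

lemma in_ideal_termwise:
  assumes "ideal_of C J" "\<And>m. m \<in> keys p \<Longrightarrow> single m (lookup p m) \<in> J"
  shows "p \<in> J"
  by (subst mpol_sum_terms, rule ideal_of_sum[OF assms(1)], rule assms(2))

text \<open>Multiplication by a variable shifts the monomials injectively and adds \<open>v\<close> to their supports. On the right stands the ideal of the
star of \<open>v\<close>.\<close>

lemma sr_ideal_colon:
  fixes b :: "('v, 'k::field) mpol"
  assumes v: "v \<in> V" and b: "b \<in> poly_carrier V"
  shows "var v * b \<in> sr_ideal V \<Delta> \<longleftrightarrow> b \<in> sr_ideal V {F. insert v F \<in> \<Delta>}"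
proof -
  let ?t = "single v (1::nat)"
  have kb: "keys (var v * b) = (\<lambda>k. ?t + k) ` keys b"
  proof (intro equalityI subsetI)
    fix m assume m: "m \<in> keys (var v * b)"
    then obtain k where k: "m = ?t + k"
      using lookup_single_times_not[of m ?t 1 b] unfolding var_def in_keys_iff by blast
    then show "m \<in> (\<lambda>k. ?t + k) ` keys b"
      using m lookup_single_times[of ?t 1 b k] unfolding var_def in_keys_iff by (auto simp: in_keys_iff)
  next
    fix m assume "m \<in> (\<lambda>k. ?t + k) ` keys b"
    then show "m \<in> keys (var v * b)"
      using lookup_single_times[of ?t 1 b] unfolding var_def by (auto simp: in_keys_iff)
  qed
  have "var v * b \<in> poly_carrier V" using is_subringD(4)[OF is_subring_poly_carrier var_in_poly_carrier[OF v] b] .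
  moreover have "(\<forall>m\<in>keys (var v * b). keys m \<notin> \<Delta>) \<longleftrightarrow>
      (\<forall>k\<in>keys b. insert v (keys k) \<notin> \<Delta>)"
    unfolding kb ball_simps by (simp add: keys_add_nat)
  ultimately show ?thesis using b unfolding sr_ideal_def by simp
qed

lemma single_in_poly_carrier: "keys m \<subseteq> V \<Longrightarrow> single m c \<in> poly_carrier V"
  by (simp add: poly_carrier_def)

text \<open>A monomial whose support is not a face avoiding \<open>v\<close> either has a non-face as support or is divisible by \<open>v\<close>.\<close>

lemma sr_ideal_deletion:
  assumes \<Delta>: "down_closed \<Delta>" and v: "v \<in> V"
  shows "sr_ideal V {F \<in> \<Delta>. v \<notin> F} = add_generator (poly_carrier V) (sr_ideal V \<Delta> :: ('v, 'k::field) mpol set) (var v)"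
proof
  have I: "ideal_of (poly_carrier V) (sr_ideal V \<Delta> :: ('v, 'k) mpol set)" by (rule ideal_of_sr_ideal[OF \<Delta>])
  note J = ideal_of_add_generator[OF is_subring_poly_carrier I var_in_poly_carrier[OF v]]
  show "sr_ideal V {F \<in> \<Delta>. v \<notin> F} \<subseteq> add_generator (poly_carrier V) (sr_ideal V \<Delta> :: ('v, 'k) mpol set) (var v)"
  proof
    fix p :: "('v, 'k) mpol" assume p: "p \<in> sr_ideal V {F \<in> \<Delta>. v \<notin> F}"
    show "p \<in> add_generator (poly_carrier V) (sr_ideal V \<Delta>) (var v)"
    proof (rule in_ideal_termwise[OF J])
      fix m assume m: "m \<in> keys p"
      let ?c = "lookup p m"
      have mV: "keys m \<subseteq> V" using p m unfolding sr_ideal_def poly_carrier_def by blast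
      have "keys m \<notin> \<Delta> \<or> v \<in> keys m"
        using p m unfolding sr_ideal_def by blast
      then show "single m ?c \<in> add_generator (poly_carrier V) (sr_ideal V \<Delta>) (var v)"
      proof
        assume "keys m \<notin> \<Delta>"
        then have "single m ?c \<in> sr_ideal V \<Delta>"
          using mV by (simp add: sr_ideal_def poly_carrier_def)
        then show ?thesis using subset_add_generator[OF is_subring_poly_carrier] by blast
      next
        assume "v \<in> keys m"
        then have 1: "1 \<le> lookup m v" by (simp add: in_keys_iff)
        have "keys (m - single v 1) \<subseteq> V"
          using mV by (auto simp: in_keys_iff lookup_minus)
        then have "0 + var v * single (m - single v 1) ?c \<in> add_generator (poly_carrier V) (sr_ideal V \<Delta>) (var v)"
          by (intro add_generator_memI single_in_poly_carrier) (use ideal_ofD(2)[OF I is_subring_poly_carrier] in auto)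
        then show ?thesis using single_factor[OF 1, of ?c] by simp
      qed
    qed
  qed
  have \<Delta>': "down_closed {F \<in> \<Delta>. v \<notin> F}" using \<Delta> unfolding down_closed_def by blast
  show "add_generator (poly_carrier V) (sr_ideal V \<Delta> :: ('v, 'k) mpol set) (var v) \<subseteq> sr_ideal V {F \<in> \<Delta>. v \<notin> F}"
  proof (rule add_generator_subset_ideal[OF is_subring_poly_carrier ideal_of_sr_ideal[OF \<Delta>']])
    show "sr_ideal V \<Delta> \<subseteq> (sr_ideal V {F \<in> \<Delta>. v \<notin> F} :: ('v, 'k) mpol set)"
      unfolding sr_ideal_def by blast
    show "(var v :: ('v, 'k) mpol) \<in> sr_ideal V {F \<in> \<Delta>. v \<notin> F}"
      using v by (simp add: sr_ideal_def poly_carrier_def var_def)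
  qed
qed

section \<open>Coefficients with respect to one variable\<close>

text \<open>The coefficient of \<open>z\<^sup>e\<close> when \<open>p\<close> is read as a polynomial in \<open>z\<close> over the other variables: the
result involves no \<open>z\<close>, so its value at monomials with a positive exponent of \<open>z\<close> is zero.\<close>

definition coef :: "'v \<Rightarrow> nat \<Rightarrow> ('v, 'k::field) mpol \<Rightarrow> ('v, 'k) mpol" where
  "coef z e p = Abs_poly_mapping
     (\<lambda>k. if lookup k z = 0 then lookup p (k + single z e) else 0)"

lemma lookup_coef:
  "lookup (coef z e p) k =
     (if lookup k z = 0 then lookup p (k + single z e) else 0)"
proof -
  have "{k. (if lookup k z = 0 then lookup p (k + single z e) else 0) \<noteq> 0}
      \<subseteq> (\<lambda>m. m - single z e) ` keys p"
  proof
    fix k assume "k \<in> {k. (if lookup k z = 0 then lookup p (k + single z e) else 0) \<noteq> 0}"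
    then have "k + single z e \<in> keys p" by (auto simp: in_keys_iff split: if_splits)
    then show "k \<in> (\<lambda>m. m - single z e) ` keys p" by force
  qed
  then have "finite {k. (if lookup k z = 0 then lookup p (k + single z e) else 0) \<noteq> 0}"
    by (rule finite_subset) simp
  then show ?thesis unfolding coef_def by (subst lookup_Abs_poly_mapping) auto
qed

lemma coef_add: "coef z e (p + q) = coef z e p + coef z e q"
  by (rule poly_mapping_eqI) (simp add: lookup_coef lookup_add)

lemma coef_0 [simp]: "coef z e 0 = 0"
  by (rule poly_mapping_eqI) (simp add: lookup_coef)

lemma coef_sum: "coef z e (\<Sum>i\<in>T. f i) = (\<Sum>i\<in>T. coef z e (f i))"
  by (induction T rule: infinite_finite_induct) (auto simp: coef_add)

lemma coef_single_times:
  fixes p :: "('v, 'k::field) mpol"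
  assumes "lookup t z = 0"
  shows "coef z e (single t c * p) = single t c * coef z e p"
proof (rule poly_mapping_eqI)
  fix k
  show "lookup (coef z e (single t c * p)) k =
      lookup (single t c * coef z e p) k"
  proof (cases "\<exists>q. k = t + q")
    case True
    then obtain q where q: "k = t + q" by blast
    have "lookup k z = lookup q z" using assms q by (simp add: lookup_add)
    then show ?thesis
      unfolding q lookup_single_times lookup_coef
      using assms lookup_single_times[of t c p "q + single z e"]
      by (simp add: lookup_add add.assoc)
  next
    case False
    have "k + single z e \<noteq> t + q" if "lookup k z = 0" for q
    proof
      assume eq: "k + single z e = t + q"
      have l: "lookup k x + (if x = z then e else 0) = lookup t x + lookup q x" for x
        using arg_cong[OF eq, of "\<lambda>f. lookup f x"] by (auto simp: lookup_add lookup_single when_def split: if_splits)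
      have "k = t + (k - t)"
      proof (rule poly_mapping_eqI)
        fix x show "lookup k x = lookup (t + (k - t)) x"
          using l[of x] assms by (cases "x = z") (auto simp: lookup_add lookup_minus)
      qed
      with False show False by blast
    qed
    then have "lookup (coef z e (single t c * p)) k = 0"
      unfolding lookup_coef by (auto intro!: lookup_single_times_not)
    moreover have "lookup (single t c * coef z e p) k = 0"
      using False by (intro lookup_single_times_not) blast
    ultimately show ?thesis by simp
  qed
qed

lemma coef_times:
  fixes g p :: "('v, 'k::field) mpol"
  assumes g: "g \<in> poly_carrier U" "z \<notin> U"
  shows "coef z e (g * p) = g * coef z e p"
proof -
  have z: "lookup m z = 0" if "m \<in> keys g" for m
    using that g unfolding poly_carrier_def by (auto simp flip: not_in_keys_iff_lookup_eq_zero)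
  let ?s = "\<lambda>m. single m (lookup g m)"
  have "coef z e (g * p) = coef z e ((\<Sum>m\<in>keys g. ?s m) * p)"
    using mpol_sum_terms[of g] by simp
  also have "\<dots> = (\<Sum>m\<in>keys g. ?s m * coef z e p)"
    unfolding sum_distrib_right coef_sum by (intro sum.cong refl coef_single_times z)
  also have "\<dots> = g * coef z e p"
    unfolding sum_distrib_right[symmetric] using mpol_sum_terms[of g] by simp
  finally show ?thesis .
qed

lemma coef_var_power_times:
  fixes p :: "('v, 'k::field) mpol"
  shows "coef z e (var z ^ i * p) = (if i \<le> e then coef z (e - i) p else 0)"
proof (rule poly_mapping_eqI)
  fix k
  show "lookup (coef z e (var z ^ i * p)) k =
      lookup (if i \<le> e then coef z (e - i) p else 0) k"
  proof (cases "lookup k z = 0 \<and> i \<le> e")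
    case True
    then have "k + single z e = single z i + (k + single z (e - i))"
      by (simp add: add.left_commute[of _ k] single_add[symmetric])
    then show ?thesis using True lookup_single_times[of "single z i" 1 p "k + single z (e - i)"]
      by (simp add: lookup_coef var_power)
  next
    case False
    show ?thesis
    proof (cases "lookup k z = 0")
      case True
      then have "\<not> i \<le> e" using False by blast
      have "k + single z e \<noteq> single z i + q" for q
      proof
        assume "k + single z e = single z i + q"
        from arg_cong[OF this, of "\<lambda>f. lookup f z"] have "e = i + lookup q z"
          using True by (simp add: lookup_add)
        with \<open>\<not> i \<le> e\<close> show False by simp
      qed
      then show ?thesis using \<open>\<not> i \<le> e\<close> unfolding lookup_coef var_power
        by (simp add: lookup_single_times_not)
    qed (simp add: lookup_coef)
  qed
qed

lemma coef_expansion: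
  fixes p :: "('v, 'k::field) mpol"
  assumes B: "\<And>m. m \<in> keys p \<Longrightarrow> lookup m z \<le> B"
  shows "p = (\<Sum>e\<le>B. var z ^ e * coef z e p)"
proof (rule poly_mapping_eqI)
  fix k :: "'v \<Rightarrow>\<^sub>0 nat"
  let ?n = "lookup k z"
  have k: "k = single z ?n + (k - single z ?n)"
    by (rule poly_mapping_eqI) (auto simp: lookup_add lookup_minus lookup_single when_def)
  have "lookup (var z ^ e * coef z e p) k = (if e = ?n then lookup p k else 0)" for e
  proof (cases "\<exists>q. k = single z e + q")
    case True
    then obtain q where q: "k = single z e + q" by blast
    then have n: "?n = e + lookup q z" by (simp add: lookup_add)
    have "lookup (var z ^ e * coef z e p) k = lookup (coef z e p) q"
      using lookup_single_times[of "single z e" 1 "coef z e p" q] by (simp add: q var_power)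
    then show ?thesis unfolding lookup_coef using n by (auto simp: q add.commute)
  next
    case False
    then have "e \<noteq> ?n" using k by metis
    moreover have "lookup (var z ^ e * coef z e p) k = 0"
      unfolding var_power using False by (intro lookup_single_times_not) blast
    ultimately show ?thesis by simp
  qed
  then have "lookup (\<Sum>e\<le>B. var z ^ e * coef z e p) k = (if ?n \<le> B then lookup p k else 0)"
    by (simp add: lookup_sum)
  also have "\<dots> = lookup p k" using B[of k] by (auto simp: in_keys_iff)
  finally show "lookup p k = lookup (\<Sum>e\<le>B. var z ^ e * coef z e p) k" ..
qed

lemma coef_in_poly_carrier: "p \<in> poly_carrier V \<Longrightarrow> coef z e p \<in> poly_carrier V"
  unfolding poly_carrier_def
proof (intro CollectI ballI)
  fix m assume p: "p \<in> {p. \<forall>m\<in>keys p. keys m \<subseteq> V}" and "m \<in> keys (coef z e p)"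
  then have "m + single z e \<in> keys p"
    by (auto simp: in_keys_iff lookup_coef split: if_splits)
  then have "keys (m + single z e) \<subseteq> V" using p by blast
  then show "keys m \<subseteq> V" by (simp add: keys_add_nat)
qed

lemma eval_poly_eq_sum: "eval_poly f \<theta> = (\<Sum>i\<le>degree f. const (poly.coeff f i) * \<theta> ^ i)"
proof -
  have "degree (map_poly const f :: ('a, 'b) mpol poly) = degree f"
    by (rule degree_map_poly) simp
  then show ?thesis unfolding poly_altdef by (simp add: coeff_map_poly)
qed

lemma eval_poly_in_poly_carrier: "\<theta> \<in> poly_carrier V \<Longrightarrow> eval_poly f \<theta> \<in> poly_carrier V"
  unfolding eval_poly_eq_sum
  by (intro is_subring_sum[OF is_subring_poly_carrier] is_subringD(4,7)[OF is_subring_poly_carrier] const_in_poly_carrier)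

definition coef_closed :: "'v \<Rightarrow> ('v, 'k::field) mpol set \<Rightarrow> bool" where
  "coef_closed z J \<longleftrightarrow> (\<forall>e. \<forall>p\<in>J. coef z e p \<in> J)"

text \<open>Let \<open>c\<^sub>l\<close> be the lowest nonzero coefficient of \<open>f\<close>. The coefficient of \<open>z\<close> to the power \<open>l + e\<close> in \<open>f(z) a\<close> is \<open>c\<^sub>l\<close> times the coefficient of
\<open>z\<^sup>e\<close> in \<open>a\<close> plus multiples of earlier coefficients of \<open>a\<close>. So all coefficients of \<open>a\<close> lie in \<open>J\<close>
one after the other, and \<open>a\<close> is recovered from them.\<close>

lemma eval_poly_var_nonzerodivisor:
  fixes a :: "('v, 'k::field) mpol"
  assumes J: "ideal_of (poly_carrier V) J" and cl: "coef_closed z J" and z: "z \<in> V" and f: "f \<noteq> 0"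
    and a: "a \<in> poly_carrier V" and fa: "eval_poly f (var z) * a \<in> J"
  shows "a \<in> J"
proof -
  note J' = ideal_ofD[OF J is_subring_poly_carrier]
  define l where "l = (LEAST i. poly.coeff f i \<noteq> 0)"
  have "\<exists>i. poly.coeff f i \<noteq> 0" using f leading_coeff_0_iff by blast
  then have l: "poly.coeff f l \<noteq> 0" unfolding l_def by (rule LeastI_ex)
  have low: "poly.coeff f i = 0" if "i < l" for i using that not_less_Least unfolding l_def by blast
  have ld: "l \<le> degree f" using l by (rule le_degree)
  have main: "coef z e a \<in> J" for e
  proof (induction e rule: less_induct)
    case (less e)
    let ?T = "\<lambda>i. const (poly.coeff f i) * (if i \<le> l + e then coef z (l + e - i) a else 0)"
    have "coef z (l + e) (eval_poly f (var z) * a) = (\<Sum>i\<le>degree f. ?T i)"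
      unfolding eval_poly_eq_sum sum_distrib_right coef_sum mult.assoc
    proof (rule sum.cong[OF refl])
      fix i
      have "coef z (l + e) (const (poly.coeff f i) * (var z ^ i * a))
          = const (poly.coeff f i) * coef z (l + e) (var z ^ i * a)"
        by (rule coef_times[of _ "{}"]) (simp_all add: const_in_poly_carrier)
      then show "coef z (l + e) (const (poly.coeff f i) * (var z ^ i * a)) = ?T i"
        by (simp only: coef_var_power_times)
    qed
    also have "\<dots> = ?T l + (\<Sum>i\<in>{..degree f} - {l}. ?T i)"
      using ld by (subst sum.remove[of _ l]) auto
    finally have eq: "coef z (l + e) (eval_poly f (var z) * a) = ?T l + (\<Sum>i\<in>{..degree f} - {l}. ?T i)" .
    have 1: "coef z (l + e) (eval_poly f (var z) * a) \<in> J" using cl fa unfolding coef_closed_def by blast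
    have 2: "(\<Sum>i\<in>{..degree f} - {l}. ?T i) \<in> J"
    proof (rule ideal_of_sum[OF J])
      fix i assume i: "i \<in> {..degree f} - {l}"
      show "?T i \<in> J"
      proof (cases "l < i \<and> i \<le> l + e")
        case True
        then have "coef z (l + e - i) a \<in> J" by (intro less) auto
        then show ?thesis using True J'(4)[OF const_in_poly_carrier] by simp
      next
        case False
        then have "i < l \<or> \<not> i \<le> l + e" using i by auto
        then show ?thesis using low J'(2) by auto
      qed
    qed
    have "?T l \<in> J" using J'(7)[OF 1 2] unfolding eq by simp
    then have "const (poly.coeff f l) * coef z e a \<in> J" by simp
    from J'(4)[OF const_in_poly_carrier this, of "inverse (poly.coeff f l)"]
    show "coef z e a \<in> J" unfolding mult.assoc[symmetric] const_inverse[OF l] by simp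
  qed
  define B where "B = Max (insert 0 ((\<lambda>m. lookup m z) ` keys a))"
  have "lookup m z \<le> B" if "m \<in> keys a" for m
    unfolding B_def using that by (intro Max_ge) auto
  then have "a = (\<Sum>e\<le>B. var z ^ e * coef z e a)" by (rule coef_expansion)
  also have "\<dots> \<in> J"
    by (intro ideal_of_sum[OF J] J'(4)[OF is_subringD(7)[OF is_subring_poly_carrier var_in_poly_carrier[OF z]] main])
  finally show ?thesis .
qed

lemma coef_closed_add_generator:
  fixes J :: "('v, 'k::field) mpol set"
  assumes "coef_closed z J" "z' \<noteq> z" "z' \<in> V"
  shows "coef_closed z (add_generator (poly_carrier V) J (eval_poly f (var z')))"
  unfolding coef_closed_def
proof (intro allI ballI)
  fix e p assume "p \<in> add_generator (poly_carrier V) J (eval_poly f (var z'))"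
  then obtain i c where p: "i \<in> J" "c \<in> poly_carrier V" "p = i + eval_poly f (var z') * c" unfolding add_generator_def by blast
  have "eval_poly f (var z') \<in> poly_carrier {z'}" by (intro eval_poly_in_poly_carrier var_in_poly_carrier) simp
  then have "coef z e p = coef z e i + eval_poly f (var z') * coef z e c"
    unfolding p(3) coef_add using assms(2) by (subst coef_times[of _ "{z'}"]) auto
  moreover have "coef z e i \<in> J" using assms(1) p(1) unfolding coef_closed_def by blast
  ultimately show "coef z e p \<in> add_generator (poly_carrier V) J (eval_poly f (var z'))"
    using add_generator_memI[OF _ coef_in_poly_carrier[OF p(2)]] by simp
qed

text \<open>Each \<open>f\<^sub>i(z\<^sub>i)\<close> involves only its own variable, so adding it to the ideal keeps the ideal closed under taking
coefficients with respect to the remaining variables.\<close>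

lemma weakly_regular_vars:
  fixes J :: "('v, 'k::field) mpol set"
  assumes "ideal_of (poly_carrier V) J" "\<And>i. i \<in> set is \<Longrightarrow> coef_closed (z i) J \<and> z i \<in> V \<and> f i \<noteq> 0"
    and "distinct (map z is)"
  shows "weakly_regular (poly_carrier V) J (map (\<lambda>i. eval_poly (f i) (var (z i))) is)"
  using assms
proof (induction "is" arbitrary: J)
  case (Cons i "is")
  have i: "coef_closed (z i) J" "z i \<in> V" "f i \<noteq> 0" using Cons.prems(2) by auto
  let ?x = "eval_poly (f i) (var (z i))"
  have "weakly_regular (poly_carrier V) (add_generator (poly_carrier V) J ?x) (map (\<lambda>i. eval_poly (f i) (var (z i))) is)"
  proof (rule Cons.IH)
    show "ideal_of (poly_carrier V) (add_generator (poly_carrier V) J ?x)"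
      by (intro ideal_of_add_generator is_subring_poly_carrier Cons.prems eval_poly_in_poly_carrier var_in_poly_carrier i)
    show "coef_closed (z j) (add_generator (poly_carrier V) J ?x) \<and> z j \<in> V \<and> f j \<noteq> 0" if j: "j \<in> set is" for j
    proof -
      have "z i \<noteq> z j" using Cons.prems(3) j by auto
      then show ?thesis using Cons.prems(2)[of j] j i(2) by (auto intro!: coef_closed_add_generator)
    qed
    show "distinct (map z is)" using Cons.prems(3) by simp
  qed
  then show ?case
    using eval_poly_var_nonzerodivisor[OF Cons.prems(1) i(1,2,3)] by simp
qed simp



lemma add_generator_cong:
  assumes C: "is_subring C" and I: "ideal_of C I" and xy: "x \<in> C" "y \<in> C" "x - y \<in> I"
  shows "add_generator C I x = add_generator C I y"
proof -
  have "add_generator C I x \<subseteq> add_generator C I y" if "x \<in> C" "y \<in> C" "x - y \<in> I" for x y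
  proof (rule add_generator_subset_ideal[OF C ideal_of_add_generator[OF C I \<open>y \<in> C\<close>] subset_add_generator[OF C]])
    show "x \<in> add_generator C I y" using add_generator_memI[OF that(3) is_subringD(1)[OF C], of y] by simp
  qed
  from this[OF xy] this[OF xy(2,1)] show ?thesis
    using ideal_ofD(6)[OF I C xy(3)] by auto
qed

lemma weakly_regular_cong:
  assumes C: "is_subring C" and "ideal_of C I" "list_all2 (\<lambda>x y. x \<in> C \<and> y \<in> C \<and> x - y \<in> I) xs ys"
    and "weakly_regular C I xs"
  shows "weakly_regular C I ys"
  using assms(2-)
proof (induction xs arbitrary: I ys)
  case (Cons x xs)
  then obtain y ys' where ys: "ys = y # ys'" and xy: "x \<in> C" "y \<in> C" "x - y \<in> I"
    and l: "list_all2 (\<lambda>x y. x \<in> C \<and> y \<in> C \<and> x - y \<in> I) xs ys'"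
    by (auto simp: list_all2_Cons1)
  note I = ideal_ofD[OF Cons.prems(1) C]
  have "weakly_regular C (add_generator C I x) ys'"
  proof (rule Cons.IH[OF ideal_of_add_generator[OF C Cons.prems(1) xy(1)]])
    show "list_all2 (\<lambda>u v. u \<in> C \<and> v \<in> C \<and> u - v \<in> add_generator C I x) xs ys'"
      using l by (rule list_all2_mono) (use subset_add_generator[OF C, of I x] in blast)
    show "weakly_regular C (add_generator C I x) xs" using Cons.prems(3) by simp
  qed
  moreover have "a \<in> I" if "a \<in> C" "y * a \<in> I" for a
  proof -
    have "(x - y) * a + y * a \<in> I" by (intro I(3) I(5)[OF that(1) xy(3)] that(2))
    then have "x * a \<in> I" by (simp add: algebra_simps)
    then show ?thesis using Cons.prems(3) that(1) by simp
  qed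
  ultimately show ?case unfolding ys by (simp add: add_generator_cong[OF C Cons.prems(1) xy])
qed simp

lemma eval_poly_cong:
  fixes x y :: "('v, 'k::field) mpol"
  assumes I: "ideal_of (poly_carrier V) I" and x: "x \<in> poly_carrier V" and y: "y \<in> poly_carrier V" and xy: "x - y \<in> I"
  shows "eval_poly f x - eval_poly f y \<in> I"
proof -
  note I' = ideal_ofD[OF I is_subring_poly_carrier]
  have "x ^ i - y ^ i \<in> I" for i
  proof (induction i)
    case 0 show ?case using I'(2) by simp
  next
    case (Suc i)
    have "x ^ Suc i - y ^ Suc i = x * (x ^ i - y ^ i) + (x - y) * y ^ i" by (simp add: algebra_simps)
    also have "\<dots> \<in> I"
      by (intro I'(3) I'(4)[OF x Suc] I'(5)[OF is_subringD(7)[OF is_subring_poly_carrier y] xy])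
    finally show ?case .
  qed
  then have "(\<Sum>i\<le>degree f. const (poly.coeff f i) * (x ^ i - y ^ i)) \<in> I"
    by (intro ideal_of_sum[OF I] I'(4)[OF const_in_poly_carrier])
  then show ?thesis
    unfolding eval_poly_eq_sum by (simp add: sum_subtractf right_diff_distrib)
qed

section \<open>Regularity of the block sums\<close>

definition faces :: "'v set set \<Rightarrow> 'v set \<Rightarrow> 'v set set" where
  "faces E W = {F. F \<subseteq> W \<and> (\<forall>e\<in>E. \<not> e \<subseteq> F)}"

lemma facesD:
  assumes "F \<in> faces E W" shows "F \<subseteq> W" "e \<in> E \<Longrightarrow> \<not> e \<subseteq> F"
  using assms by (auto simp: faces_def)

lemma facesI: "F \<subseteq> W \<Longrightarrow> (\<And>e. e \<in> E \<Longrightarrow> \<not> e \<subseteq> F) \<Longrightarrow> F \<in> faces E W"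
  by (simp add: faces_def)

lemma down_closed_faces: "down_closed (faces E W)"
  unfolding down_closed_def faces_def by blast

text \<open>This is the ideal generated by the variables outside \<open>Z\<close>, none of which is \<open>z\<close>.\<close>

lemma coef_closed_sr_simplex:
  assumes "z \<in> Z"
  shows "coef_closed z (sr_ideal V (Pow Z) :: ('v, 'k::field) mpol set)"
  unfolding coef_closed_def
proof (intro allI ballI)
  fix e and p :: "('v, 'k) mpol" assume p: "p \<in> sr_ideal V (Pow Z)"
  have "keys m \<notin> Pow Z" if m: "m \<in> keys (coef z e p)" for m
  proof -
    have "m + single z e \<in> keys p"
      using m by (auto simp: in_keys_iff lookup_coef split: if_splits)
    then have "keys (m + single z e) \<notin> Pow Z" using p unfolding sr_ideal_def by blast
    then show ?thesis using assms by (auto simp: keys_add_nat split: if_splits)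
  qed
  moreover have "coef z e p \<in> poly_carrier V" using p by (intro coef_in_poly_carrier) (simp add: sr_ideal_def)
  ultimately show "coef z e p \<in> sr_ideal V (Pow Z)" unfolding sr_ideal_def by blast
qed

lemma other_endpoint:
  assumes "v \<in> e" "card e = 2" obtains u where "e = {u, v}" "u \<noteq> v"
proof -
  obtain a b where "e = {a, b}" "a \<noteq> b" using assms(2) by (auto simp: card_2_iff)
  then show ?thesis using assms(1) that[of a] that[of b] by (cases "v = a") auto
qed

text \<open>The induced subgraphs on vertex sets \<open>W\<close> in which every block \<open>C\<^sub>i\<close> keeps a vertex \<open>z\<^sub>i\<close> without neighbours outside its block form a class
that is closed under two operations. Deleting a vertex \<open>v\<close> other than the \<open>z\<^sub>j\<close> keeps all of them. Deleting the
neighbours of such a \<open>v\<close> in the block \<open>C\<^sub>i\<close> removes \<open>z\<^sub>i\<close>, but then \<open>v\<close> itself has become isolated and takes its place, while the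
other \<open>z\<^sub>j\<close> are not adjacent to \<open>v\<close>. These operations correspond to adding \<open>v\<close> to the Stanley--Reisner ideal and to forming the
colon ideal by \<open>v\<close>, so regularity follows by induction from the exact sequence for \<open>v\<close>. When only the \<open>z\<^sub>i\<close> are left, the
quotient is a polynomial ring in which the \<open>i\<close>-th block sum is the variable \<open>z\<^sub>i\<close>.

The sequence consists of arbitrary nonzero polynomials \<open>f\<^sub>i\<close> in the block sums, because it has to lie in
a prescribed maximal ideal later. The block sums themselves never change, as the deleted variables are zero in the quotient.\<close>

theorem block_sums_regular:
  fixes E :: "'v set set" and f :: "nat \<Rightarrow> 'k::field poly"
  assumes V: "finite V" and C: "\<And>i. i \<in> set is \<Longrightarrow> C i \<subseteq> V" and "is": "distinct is"
    and disj: "\<And>i j. i \<in> set is \<Longrightarrow> j \<in> set is \<Longrightarrow> i \<noteq> j \<Longrightarrow> C i \<inter> C j = {}"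
    and clq: "\<And>i u v. i \<in> set is \<Longrightarrow> u \<in> C i \<Longrightarrow> v \<in> C i \<Longrightarrow> u \<noteq> v \<Longrightarrow> {u, v} \<in> E"
    and E: "\<And>e. e \<in> E \<Longrightarrow> card e = 2"
    and f: "\<And>i. i \<in> set is \<Longrightarrow> f i \<noteq> 0"
    and W: "W \<subseteq> (\<Union>i\<in>set is. C i)"
    and z: "\<And>i. i \<in> set is \<Longrightarrow> z i \<in> C i \<and> z i \<in> W"
    and zE: "\<And>i e. i \<in> set is \<Longrightarrow> e \<in> E \<Longrightarrow> e \<subseteq> W \<Longrightarrow> z i \<in> e \<Longrightarrow> e \<subseteq> C i"
  shows "weakly_regular (poly_carrier V) (sr_ideal V (faces E W)) (map (\<lambda>i. eval_poly (f i) (\<Sum>v\<in>C i. var v)) is)"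
  using W z zE
proof (induction "card W" arbitrary: W z rule: less_induct)
  case less
  note W = less.prems(1) and z = less.prems(2) and zE = less.prems(3)
  let ?P = "poly_carrier V :: ('v, 'k) mpol set"
  let ?\<theta> = "\<lambda>i. (\<Sum>v\<in>C i. var v) :: ('v, 'k) mpol"
  note P = is_subring_poly_carrier[of V, where 'k='k]
  have WV: "W \<subseteq> V" using W C by blast
  then have finW: "finite W" using V finite_subset by blast
  have \<theta>: "?\<theta> i \<in> ?P" if "i \<in> set is" for i
    using C[OF that] by (intro is_subring_sum[OF P] var_in_poly_carrier) blast
  have I: "ideal_of ?P (sr_ideal V (faces E W'))" for W' by (rule ideal_of_sr_ideal[OF down_closed_faces])
  have zinj: "i = j" if "i \<in> set is" "j \<in> set is" "z i \<in> C j" for i j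
    using disj[of i j] z[of i] that by blast
  show ?case
  proof (cases "W \<subseteq> z ` set is")
    case True
    then have WZ: "W = z ` set is" using z by blast
    have "\<not> e \<subseteq> W" if e: "e \<in> E" for e
    proof
      assume eW: "e \<subseteq> W"
      have "e \<noteq> {}" using E[OF e] by auto
      then obtain i where i: "i \<in> set is" "z i \<in> e" using eW WZ by blast
      have eC: "e \<subseteq> C i" by (rule zE[OF i(1) e eW i(2)])
      have "e \<subseteq> {z i}"
      proof
        fix u assume u: "u \<in> e"
        then obtain j where j: "j \<in> set is" "u = z j" using eW WZ by blast
        then have "j = i" using zinj[of j i] i(1) eC u by blast
        then show "u \<in> {z i}" using j by simp
      qed
      then have "card e \<le> 1" using card_mono[of "{z i}" e] by simp
      then show False using E[OF e] by simp
    qed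
    then have fac: "faces E W = Pow W" by (auto simp: faces_def)
    have "weakly_regular ?P (sr_ideal V (Pow W)) (map (\<lambda>i. eval_poly (f i) (var (z i))) is)"
    proof (rule weakly_regular_vars)
      show "ideal_of ?P (sr_ideal V (Pow W))" using I[of W] unfolding fac .
      show "coef_closed (z i) (sr_ideal V (Pow W) :: ('v, 'k) mpol set) \<and> z i \<in> V \<and> f i \<noteq> 0" if "i \<in> set is" for i
        using z[OF that] WV f[OF that] coef_closed_sr_simplex[of "z i" W V] by blast
      show "distinct (map z is)" unfolding distinct_map
      proof (intro conjI inj_onI "is")
        fix i j assume "i \<in> set is" "j \<in> set is" "z i = z j"
        then show "i = j" using zinj[of i j] z[of j] by metis
      qed
    qed
    moreover have "list_all2 (\<lambda>x y. x \<in> ?P \<and> y \<in> ?P \<and> x - y \<in> sr_ideal V (Pow W))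
        (map (\<lambda>i. eval_poly (f i) (var (z i))) is) (map (\<lambda>i. eval_poly (f i) (?\<theta> i)) is)"
      unfolding list_all2_map1 list_all2_map2
    proof (rule list_all2_same[THEN iffD2], rule ballI)
      fix i assume i: "i \<in> set is"
      have zi: "z i \<in> V" using z[OF i] WV by blast
      have Ci: "finite (C i)" using C[OF i] V finite_subset by blast
      have IW: "ideal_of ?P (sr_ideal V (Pow W))" using I[of W] unfolding fac .
      have "var (z i) - ?\<theta> i = - (\<Sum>v\<in>C i - {z i}. var v)"
        using z[OF i] Ci by (simp add: sum.remove[of _ "z i"])
      moreover have "(\<Sum>v\<in>C i - {z i}. var v) \<in> (sr_ideal V (Pow W) :: ('v, 'k) mpol set)"
      proof (rule ideal_of_sum[OF IW])
        fix v assume v: "v \<in> C i - {z i}"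
        have "v \<notin> W"
        proof
          assume "v \<in> W"
          then obtain j where j: "j \<in> set is" "v = z j" using WZ by blast
          then show False using zinj[of j i] i v by blast
        qed
        moreover have "v \<in> V" using v C[OF i] by blast
        ultimately show "var v \<in> (sr_ideal V (Pow W) :: ('v, 'k) mpol set)"
          by (simp add: sr_ideal_def poly_carrier_def var_def)
      qed
      ultimately have "var (z i) - ?\<theta> i \<in> sr_ideal V (Pow W)"
        using ideal_ofD(6)[OF IW P] by simp
      then show "eval_poly (f i) (var (z i)) \<in> ?P \<and> eval_poly (f i) (?\<theta> i) \<in> ?P \<and>
          eval_poly (f i) (var (z i)) - eval_poly (f i) (?\<theta> i) \<in> sr_ideal V (Pow W)"
        by (intro conjI eval_poly_in_poly_carrier eval_poly_cong[OF IW] var_in_poly_carrier zi \<theta>[OF i])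
    qed
    ultimately show ?thesis
      unfolding fac by (rule weakly_regular_cong[OF P I[of W, unfolded fac], rotated])
  next
    case False
    then obtain v where v: "v \<in> W" "v \<notin> z ` set is" by blast
    then obtain i where i: "i \<in> set is" "v \<in> C i" using W by blast
    have vV: "v \<in> V" using v WV by blast
    have vz: "v \<noteq> z j" if "j \<in> set is" for j using v(2) that by blast
    let ?N = "{u. {u, v} \<in> E}"
    have vN: "v \<notin> ?N" using E[of "{v, v}"] by fastforce
    have ziN: "z i \<in> ?N"
      using clq[OF i(1) conjunct1[OF z[OF i(1)]] i(2)] vz[OF i(1)] by simp
    have zjN: "z j \<notin> ?N" if j: "j \<in> set is" "j \<noteq> i" for j
    proof
      assume "z j \<in> ?N"
      then have "{z j, v} \<subseteq> C j" using z[OF j(1)] v(1) by (intro zE[OF j(1)]) auto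
      then show False using disj[OF j(1) i(1) j(2)] i(2) by blast
    qed
    show ?thesis
    proof (rule weakly_regular_extension[OF P var_in_poly_carrier[OF vV] I I[of "W - ?N"]])
      show "sr_ideal V (faces E (W - {v})) = add_generator ?P (sr_ideal V (faces E W)) (var v)"
      proof -
        have "faces E (W - {v}) = {F \<in> faces E W. v \<notin> F}" unfolding faces_def by blast
        then show ?thesis by (simp only: sr_ideal_deletion[OF down_closed_faces vV])
      qed
      show "var v * b \<in> sr_ideal V (faces E W) \<longleftrightarrow> b \<in> sr_ideal V (faces E (W - ?N))" if "b \<in> ?P" for b
      proof -
        have "insert v F \<in> faces E W \<longleftrightarrow> F \<in> faces E (W - ?N)" for F
        proof
          assume a: "insert v F \<in> faces E W"
          have "u \<notin> ?N" if "u \<in> F" for u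
            using facesD(2)[OF a, of "{u, v}"] that by auto
          then have "F \<subseteq> W - ?N" using facesD(1)[OF a] by blast
          moreover have "\<not> e \<subseteq> F" if "e \<in> E" for e using facesD(2)[OF a that] by blast
          ultimately show "F \<in> faces E (W - ?N)" by (rule facesI)
        next
          assume a: "F \<in> faces E (W - ?N)"
          have "\<not> e \<subseteq> insert v F" if e: "e \<in> E" for e
          proof
            assume sub: "e \<subseteq> insert v F"
            have "v \<in> e" using sub facesD(2)[OF a e] by blast
            moreover have "card e = 2" by (rule E[OF e])
            ultimately obtain u where u: "e = {u, v}" "u \<noteq> v" by (rule other_endpoint)
            then have "u \<in> F" using sub by blast
            moreover have "u \<in> ?N" using u e by simp
            ultimately show False using facesD(1)[OF a] by blast
          qed
          moreover have "insert v F \<subseteq> W" using facesD(1)[OF a] v(1) by blast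
          ultimately show "insert v F \<in> faces E W" by (intro facesI)
        qed
        then have "{F. insert v F \<in> faces E W} = faces E (W - ?N)" by blast
        then show ?thesis using sr_ideal_colon[OF vV that, of "faces E W"] by simp
      qed
      show "set (map (\<lambda>i. eval_poly (f i) (?\<theta> i)) is) \<subseteq> ?P" using \<theta> by (auto intro: eval_poly_in_poly_carrier)
      have lt: "card W' < card W" if "W' \<subset> W" for W' using psubset_card_mono[OF finW that] .
      show "weakly_regular ?P (sr_ideal V (faces E (W - ?N))) (map (\<lambda>i. eval_poly (f i) (?\<theta> i)) is)"
      proof (rule less.hyps[of _ "z(i := v)"])
        show "card (W - ?N) < card W" using ziN z[OF i(1)] by (intro lt) blast
        show "W - ?N \<subseteq> (\<Union>i\<in>set is. C i)" using W by blast
        show "(z(i := v)) j \<in> C j \<and> (z(i := v)) j \<in> W - ?N" if "j \<in> set is" for j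
          using z[OF that] zjN[OF that] i(2) v(1) vN by (cases "j = i") simp_all
        show "e \<subseteq> C j" if j: "j \<in> set is" and e: "e \<in> E" "e \<subseteq> W - ?N" "(z(i := v)) j \<in> e" for j e
        proof (cases "j = i")
          case True
          then have "v \<in> e" using e(3) by simp
          then obtain u where "e = {u, v}" using E[OF e(1)] by (rule other_endpoint)
          then show ?thesis using e(1,2) by blast
        next
          case False
          then show ?thesis using zE[OF j e(1)] e(2,3) by auto
        qed
      qed
      show "weakly_regular ?P (sr_ideal V (faces E (W - {v}))) (map (\<lambda>i. eval_poly (f i) (?\<theta> i)) is)"
      proof (rule less.hyps[of _ z])
        show "card (W - {v}) < card W" using v(1) by (intro lt) blast
        show "W - {v} \<subseteq> (\<Union>i\<in>set is. C i)" using W by blast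
        show "z j \<in> C j \<and> z j \<in> W - {v}" if "j \<in> set is" for j using z[OF that] vz[OF that] by auto
        show "e \<subseteq> C j" if "j \<in> set is" "e \<in> E" "e \<subseteq> W - {v}" "z j \<in> e" for j e
          using zE[OF that(1,2)] that(3,4) by blast
      qed
    qed
  qed
qed



section \<open>Counting monomials and the dimension bound\<close>

lemma homogeneous_system:
  fixes u :: "'t \<Rightarrow> 'x \<Rightarrow> 'k::field"
  assumes "finite X" "finite T" "card X < card T"
  shows "\<exists>c. (\<exists>t\<in>T. c t \<noteq> 0) \<and> (\<forall>x\<in>X. (\<Sum>t\<in>T. c t * u t x) = 0)"
  using assms
proof (induction X arbitrary: T u rule: finite_induct)
  case empty
  then obtain t where "t \<in> T" by fastforce
  then show ?case by (intro exI[of _ "\<lambda>_. 1"]) auto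
next
  case (insert x X)
  show ?case
  proof (cases "\<forall>t\<in>T. u t x = 0")
    case True
    have "card X < card T" using insert by simp
    then obtain c where "\<exists>t\<in>T. c t \<noteq> 0" "\<forall>y\<in>X. (\<Sum>t\<in>T. c t * u t y) = 0"
      using insert.IH[OF insert.prems(1)] by blast
    then show ?thesis using True by (intro exI[of _ c]) simp
  next
    case False
    then obtain t0 where t0: "t0 \<in> T" "u t0 x \<noteq> 0" by blast
    let ?T = "T - {t0}"
    let ?u = "\<lambda>t y. u t y - (u t x / u t0 x) * u t0 y"
    have "card X < card ?T" using insert t0 by simp
    then obtain c where c: "\<exists>t\<in>?T. c t \<noteq> 0" "\<forall>y\<in>X. (\<Sum>t\<in>?T. c t * ?u t y) = 0"
      using insert.IH[of ?T ?u] insert.prems(1) by blast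
    define d where "d = c(t0 := - (\<Sum>t\<in>?T. c t * (u t x / u t0 x)))"
    have d: "(\<Sum>t\<in>T. d t * u t y) = (\<Sum>t\<in>?T. c t * ?u t y)" for y
    proof -
      have "(\<Sum>t\<in>T. d t * u t y) = d t0 * u t0 y + (\<Sum>t\<in>?T. d t * u t y)"
        using insert.prems(1) t0(1) by (rule sum.remove)
      also have "(\<Sum>t\<in>?T. d t * u t y) = (\<Sum>t\<in>?T. c t * u t y)"
        by (intro sum.cong) (auto simp: d_def)
      also have "d t0 * u t0 y = - (\<Sum>t\<in>?T. c t * (u t x / u t0 x) * u t0 y)"
        by (simp add: d_def sum_distrib_right)
      finally show ?thesis by (simp add: sum_subtractf right_diff_distrib mult.assoc)
    qed
    have "?u t x = 0" for t using t0(2) by simp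
    then have "(\<Sum>t\<in>T. d t * u t x) = 0" unfolding d by simp
    moreover have "\<exists>t\<in>T. d t \<noteq> 0" using c(1) by (auto simp: d_def)
    ultimately show ?thesis using c(2) by (intro exI[of _ d]) (simp add: d)
  qed
qed

definition bounded_exps :: "nat \<Rightarrow> ('v, 'k::field) mpol \<Rightarrow> bool" where
  "bounded_exps D p \<longleftrightarrow> (\<forall>m\<in>keys p. \<forall>v. lookup m v \<le> D)"

lemma bounded_exps_mult:
  assumes "bounded_exps a p" "bounded_exps b q" shows "bounded_exps (a + b) (p * q)"
  unfolding bounded_exps_def
proof (intro ballI allI)
  fix m v assume "m \<in> keys (p * q)"
  then obtain k l where "k \<in> keys p" "l \<in> keys q" "m = k + l"
    using keys_mult[of p q] by blast
  then show "lookup m v \<le> a + b"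
    using assms unfolding bounded_exps_def by (simp add: lookup_add add_mono)
qed

lemma bounded_exps_one: "bounded_exps 0 1"
  by (simp add: bounded_exps_def)

lemma bounded_exps_power: "bounded_exps a p \<Longrightarrow> bounded_exps (n * a) (p ^ n)"
proof (induction n)
  case 0 then show ?case by (simp add: bounded_exps_one)
next
  case (Suc n)
  then show ?case using bounded_exps_mult[of a p "n * a" "p ^ n"] by simp
qed

lemma bounded_exps_mono: "bounded_exps a p \<Longrightarrow> a \<le> b \<Longrightarrow> bounded_exps b p"
  unfolding bounded_exps_def using order_trans by blast

lemma bounded_exps_power_product:
  assumes "\<forall>f\<in>set fs. bounded_exps d f" "\<alpha> \<in> exps E (length fs)"
  shows "bounded_exps (length fs * (E * d)) (power_product fs \<alpha>)"
  using assms
proof (induction fs arbitrary: \<alpha>)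
  case Nil then show ?case by (simp add: bounded_exps_one)
next
  case (Cons f fs)
  then obtain j \<beta> where \<alpha>: "\<alpha> = j # \<beta>" "j \<le> E" "\<beta> \<in> exps E (length fs)" by (auto simp: exps_Suc)
  have "bounded_exps (j * d) (f ^ j)" using Cons.prems by (intro bounded_exps_power) simp
  then have 1: "bounded_exps (E * d) (f ^ j)" by (rule bounded_exps_mono) (simp add: \<alpha>(2))
  have 2: "bounded_exps (length fs * (E * d)) (power_product fs \<beta>)" using Cons.IH Cons.prems(1) \<alpha>(3) by simp
  show ?case using bounded_exps_mult[OF 1 2] by (simp add: \<alpha>(1))
qed

lemma bounded_exps_exists: "\<exists>D. bounded_exps D p"
proof -
  let ?A = "insert 0 (\<Union>m\<in>keys p. lookup m ` keys m)"
  have fin: "finite ?A" by simp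
  have "lookup m v \<le> Max ?A" if "m \<in> keys p" for m v
  proof (rule Max_ge[OF fin])
    show "lookup m v \<in> ?A"
    proof (cases "v \<in> keys m")
      case True
      then show ?thesis using that by blast
    next
      case False
      then show ?thesis by (simp add: in_keys_iff)
    qed
  qed
  then show ?thesis unfolding bounded_exps_def by blast
qed

lemma bounded_exps_list: "\<exists>D. \<forall>f\<in>set fs. bounded_exps D f"
proof (induction fs)
  case (Cons f fs)
  then obtain D where D: "\<forall>f\<in>set fs. bounded_exps D f" by blast
  obtain D' where D': "bounded_exps D' f" using bounded_exps_exists by blast
  have "\<forall>g\<in>set (f # fs). bounded_exps (max D D') g"
    using D D' by (auto intro: bounded_exps_mono)
  then show ?case by blast
qed simp

lemma card_monomials_le:
  assumes F: "finite F"
  shows "finite {m :: 'v \<Rightarrow>\<^sub>0 nat. keys m \<subseteq> F \<and> (\<forall>v. lookup m v \<le> D)} \<and>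
    card {m :: 'v \<Rightarrow>\<^sub>0 nat. keys m \<subseteq> F \<and> (\<forall>v. lookup m v \<le> D)} \<le> (D + 1) ^ card F"
proof -
  let ?M = "{m :: 'v \<Rightarrow>\<^sub>0 nat. keys m \<subseteq> F \<and> (\<forall>v. lookup m v \<le> D)}"
  let ?P = "PiE F (\<lambda>_. {..D})"
  let ?r = "\<lambda>m. restrict (lookup m) F"
  have inj: "inj_on ?r ?M"
  proof (rule inj_onI)
    fix m m' assume m: "m \<in> ?M" "m' \<in> ?M" and eq: "?r m = ?r m'"
    show "m = m'"
    proof (rule poly_mapping_eqI)
      fix v
      show "lookup m v = lookup m' v"
      proof (cases "v \<in> F")
        case True
        then show ?thesis using fun_cong[OF eq, of v] by simp
      next
        case False
        then have "v \<notin> keys m" "v \<notin> keys m'" using m by auto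
        then show ?thesis by (simp add: in_keys_iff)
      qed
    qed
  qed
  have sub: "?r ` ?M \<subseteq> ?P" by auto
  have fin: "finite ?P" using F by (simp add: finite_PiE)
  have "card ?P = (D + 1) ^ card F" using F by (simp add: card_PiE)
  then show ?thesis using inj_on_finite[OF inj sub fin] card_inj_on_le[OF inj sub fin] by simp
qed

text \<open>A counting argument. The power products of the \<open>r + 1\<close> elements with exponents at most \<open>E\<close> number \<open>(E + 1)\<close> to
the power \<open>r + 1\<close>. Modulo the ideal they live in the span of the monomials that are supported on faces and have exponents at most \<open>D\<close>,
and these number at most \<open>N (D + 1)\<^sup>r\<close> with \<open>D\<close> linear in \<open>E\<close>. For large \<open>E\<close> there are too many power products, so they are linearly dependent.\<close>

lemma algebraic_relation:
  fixes fs :: "('v, 'k::field) mpol list"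
  assumes \<Delta>: "finite \<Delta>" "\<And>F. F \<in> \<Delta> \<Longrightarrow> finite F \<and> card F \<le> r"
    and fs: "set fs \<subseteq> poly_carrier V" "length fs = Suc r"
  shows "\<exists>E c. (\<exists>\<alpha>\<in>exps E (Suc r). c \<alpha> \<noteq> 0) \<and> relation_value const E fs c \<in> sr_ideal V \<Delta>"
proof -
  obtain d where d: "\<forall>f\<in>set fs. bounded_exps d f" using bounded_exps_list by blast
  define N where "N = card \<Delta>"
  define q where "q = Suc r * d + 1"
  \<comment> \<open>With D + 1 at most q (E + 1) there are at most N q^r (E + 1)^r monomials, and this choice of E keeps them fewer than the power products.\<close>
  define E where "E = N * q ^ r"
  define D where "D = Suc r * (E * d)"
  define X where "X = {m :: 'v \<Rightarrow>\<^sub>0 nat. keys m \<in> \<Delta> \<and> (\<forall>v. lookup m v \<le> D)}"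
  let ?M = "\<lambda>F. {m :: 'v \<Rightarrow>\<^sub>0 nat. keys m \<subseteq> F \<and> (\<forall>v. lookup m v \<le> D)}"
  have XM: "X \<subseteq> (\<Union>F\<in>\<Delta>. ?M F)" unfolding X_def by blast
  have finM: "finite (?M F)" if "F \<in> \<Delta>" for F
    using card_monomials_le[of F D] \<Delta>(2)[OF that] by blast
  have finU: "finite (\<Union>F\<in>\<Delta>. ?M F)" by (intro finite_UN_I \<Delta>(1) finM)
  then have finX: "finite X" using XM finite_subset by blast
  have cardM: "card (?M F) \<le> (D + 1) ^ r" if "F \<in> \<Delta>" for F
  proof -
    have "card (?M F) \<le> (D + 1) ^ card F" using card_monomials_le[of F D] \<Delta>(2)[OF that] by blast
    also have "\<dots> \<le> (D + 1) ^ r" using \<Delta>(2)[OF that] by (intro power_increasing) auto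
    finally show ?thesis .
  qed
  have "card X \<le> card (\<Union>F\<in>\<Delta>. ?M F)" by (rule card_mono[OF finU XM])
  also have "\<dots> \<le> (\<Sum>F\<in>\<Delta>. card (?M F))" by (rule card_UN_le[OF \<Delta>(1)])
  also have "\<dots> \<le> N * (D + 1) ^ r" using sum_bounded_above[OF cardM, of \<Delta>] by (simp add: N_def)
  also have "\<dots> \<le> N * (q * (E + 1)) ^ r"
  proof -
    have "D + 1 \<le> q * (E + 1)" unfolding D_def q_def by (simp add: algebra_simps)
    then show ?thesis by (intro mult_left_mono power_mono) auto
  qed
  also have "\<dots> = E * (E + 1) ^ r" by (simp only: E_def power_mult_distrib mult.assoc)
  also have "\<dots> < (E + 1) ^ Suc r" by simp
  finally have "card X < card (exps E (Suc r))" by (simp add: card_exps)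
  then obtain c where c: "\<exists>\<alpha>\<in>exps E (Suc r). c \<alpha> \<noteq> 0"
    "\<forall>m\<in>X. (\<Sum>\<alpha>\<in>exps E (Suc r). c \<alpha> * lookup (power_product fs \<alpha>) m) = 0"
    using homogeneous_system[OF finX finite_exps, of E "Suc r" "\<lambda>\<alpha> m. lookup (power_product fs \<alpha>) m"] by blast
  have lk: "lookup (relation_value const E fs c) m = (\<Sum>\<alpha>\<in>exps E (Suc r). c \<alpha> * lookup (power_product fs \<alpha>) m)" for m
    unfolding relation_value_eq_sum fs(2) by (simp add: lookup_sum lookup_const_times)
  have "keys m \<notin> \<Delta>" if m: "m \<in> keys (relation_value const E fs c)" for m
  proof
    assume m\<Delta>: "keys m \<in> \<Delta>"
    show False
    proof (cases "m \<in> X")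
      case True
      then show False using c(2) lk[of m] m by (simp add: in_keys_iff)
    next
      case False
      then obtain v where v: "\<not> lookup m v \<le> D" using m\<Delta> unfolding X_def by blast
      have "lookup (power_product fs \<alpha>) m = 0" if \<alpha>: "\<alpha> \<in> exps E (Suc r)" for \<alpha>
      proof (rule ccontr)
        assume "\<not> ?thesis"
        then have "m \<in> keys (power_product fs \<alpha>)" by (simp add: in_keys_iff)
        moreover have "bounded_exps D (power_product fs \<alpha>)"
          using bounded_exps_power_product[OF d, of \<alpha> E] \<alpha> unfolding fs(2) D_def by simp
        ultimately show False using v unfolding bounded_exps_def by blast
      qed
      then have "lookup (relation_value const E fs c) m = 0" unfolding lk by simp
      then show False using m by (simp add: in_keys_iff)
    qed
  qed
  moreover have "relation_value const E fs c \<in> poly_carrier V"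
    by (rule relation_value_in_subring[OF is_subring_poly_carrier fs(1)]) (auto intro: const_in_poly_carrier)
  ultimately have "relation_value const E fs c \<in> sr_ideal V \<Delta>" unfolding sr_ideal_def by blast
  then show ?thesis using c(1) by blast
qed

theorem prime_chain_length_le:
  fixes P :: "nat \<Rightarrow> ('v, 'k::field) mpol set"
  assumes \<Delta>: "finite \<Delta>" "\<And>F. F \<in> \<Delta> \<Longrightarrow> finite F \<and> card F \<le> r"
    and P: "\<And>i. i \<le> n \<Longrightarrow> prime_of (poly_carrier V) (P i)" and strict: "\<And>i. i < n \<Longrightarrow> P i \<subset> P (Suc i)"
    and sub: "sr_ideal V \<Delta> \<subseteq> P 0"
  shows "n \<le> r"
proof (rule ccontr)
  assume "\<not> n \<le> r"
  have "\<forall>i. \<exists>x. i < n \<longrightarrow> x \<in> P (Suc i) - P i" using strict by blast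
  then obtain x where x: "\<And>i. i < n \<Longrightarrow> x i \<in> P (Suc i) - P i" by metis
  define fs where "fs = map x [0..<Suc r]"
  have len: "length fs = Suc r" and nth: "\<And>i. i < Suc r \<Longrightarrow> fs ! i = x i"
    unfolding fs_def by (simp_all del: upt_Suc)
  have "set fs \<subseteq> poly_carrier V"
  proof
    fix y assume "y \<in> set fs"
    then have "y \<in> x ` {0..<Suc r}" unfolding fs_def by (simp del: upt_Suc)
    then obtain i where i: "i < Suc r" "y = x i" by (meson atLeastLessThan_iff imageE)
    then have "y \<in> P (Suc i)" using x[of i] \<open>\<not> n \<le> r\<close> by simp
    then show "y \<in> poly_carrier V"
      using ideal_ofD(1)[OF prime_ofD(1)[OF P[of "Suc i"]] is_subring_poly_carrier] i(1) \<open>\<not> n \<le> r\<close> by simp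
  qed
  then obtain E c \<alpha> where c: "\<alpha> \<in> exps E (Suc r)" "c \<alpha> \<noteq> 0" "relation_value const E fs c \<in> sr_ideal V \<Delta>"
    using algebraic_relation[OF \<Delta>, of fs V] len by blast
  have "c \<alpha> = 0"
  proof (rule prime_chain_independent[OF is_subring_poly_carrier, where P = P and fs = fs and E = E and \<phi> = const])
    show "range const \<subseteq> (poly_carrier V :: ('v, 'k) mpol set)" by (auto intro: const_in_poly_carrier)
    show "const 0 = 0" by simp
    show "a = 0" if Q: "prime_of (poly_carrier V) Q" and a: "const a \<in> (Q :: ('v, 'k) mpol set)" for Q a
    proof (rule ccontr)
      assume "a \<noteq> 0"
      have "const (inverse a) * const a \<in> Q"
        by (rule ideal_ofD(4)[OF prime_ofD(1)[OF Q] is_subring_poly_carrier const_in_poly_carrier a])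
      then show False using prime_ofD(2)[OF Q] by (simp only: const_inverse[OF \<open>a \<noteq> 0\<close>])
    qed
    show "prime_of (poly_carrier V) (P i)" if "i \<le> length fs" for i using P that len \<open>\<not> n \<le> r\<close> by simp
    show "P i \<subseteq> P (Suc i) \<and> fs ! i \<in> P (Suc i) - P i" if "i < length fs" for i
    proof -
      have i: "i < Suc r" "i < n" using that len \<open>\<not> n \<le> r\<close> by auto
      show ?thesis unfolding nth[OF i(1)] using strict[OF i(2)] x[OF i(2)] by blast
    qed
    show "relation_value const E fs c \<in> P 0" using c(3) sub by blast
    show "\<alpha> \<in> exps E (length fs)" using c(1) len by simp
  qed
  with c(2) show False by simp
qed



section \<open>Passing to the quotient ring\<close>

lemma polynomial_ring_simps:
  "carrier (polynomial_ring V) = poly_carrier V" "p \<otimes>\<^bsub>polynomial_ring V\<^esub> q = p * q"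
  "p \<oplus>\<^bsub>polynomial_ring V\<^esub> q = p + q" "\<one>\<^bsub>polynomial_ring V\<^esub> = 1" "\<zero>\<^bsub>polynomial_ring V\<^esub> = 0"
  by (simp_all add: polynomial_ring_def poly_carrier_def)

lemma cring_polynomial_ring: "cring (polynomial_ring V :: ('v, 'k::field) mpol ring)"
proof (rule cringI)
  note C = is_subringD[OF is_subring_poly_carrier[of V, where 'k='k]]
  show "abelian_group (polynomial_ring V :: ('v, 'k) mpol ring)"
  proof (rule abelian_groupI, unfold polynomial_ring_simps)
    show "\<exists>y\<in>poly_carrier V. y + x = 0" if "x \<in> poly_carrier V" for x :: "('v, 'k) mpol"
      using C(5)[OF that] by (intro bexI[of _ "- x"]) simp_all
  qed (simp_all add: C add_ac)
  show "comm_monoid (polynomial_ring V :: ('v, 'k) mpol ring)"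
    by (rule comm_monoidI, unfold polynomial_ring_simps) (simp_all add: C mult_ac)
qed (simp add: polynomial_ring_simps distrib_right)

lemma ideal_polynomial_ring_iff:
  "ideal J (polynomial_ring V) \<longleftrightarrow> ideal_of (poly_carrier V) (J :: ('v, 'k::field) mpol set)"
proof
  assume "ideal J (polynomial_ring V)"
  note J = idealD[OF this, unfolded polynomial_ring_simps]
  show "ideal_of (poly_carrier V) J" unfolding ideal_of_def using J by simp
next
  assume J: "ideal_of (poly_carrier V) J"
  interpret cring "polynomial_ring V :: ('v, 'k) mpol ring" by (rule cring_polynomial_ring)
  show "ideal J (polynomial_ring V)"
    by (rule cideal_I, unfold polynomial_ring_simps) (use J in \<open>simp_all add: ideal_of_def\<close>)
qed

locale quotient_by_ideal =
  fixes V :: "'v set" and I :: "('v, 'k::field) mpol set"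
  assumes V: "finite V" and I: "ideal_of (poly_carrier V) I"
begin

abbreviation "C \<equiv> poly_carrier V :: ('v, 'k) mpol set"
abbreviation "S \<equiv> polynomial_ring V :: ('v, 'k) mpol ring"
abbreviation "R \<equiv> S Quot I"

definition \<pi> :: "('v, 'k) mpol \<Rightarrow> ('v, 'k) mpol set" where
  "\<pi> a = I +>\<^bsub>S\<^esub> a"

lemmas carrier_closed = is_subringD[OF is_subring_poly_carrier[of V, where 'k='k]]
lemmas I_closed = ideal_ofD[OF I is_subring_poly_carrier]

lemma idealI_S: "ideal I S"
  using I by (simp only: ideal_polynomial_ring_iff)

lemma \<pi>_def': "\<pi> a = (\<lambda>i. i + a) ` I"
  unfolding \<pi>_def by (auto simp: a_r_coset_def r_coset_def polynomial_ring_simps)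

lemma \<pi>_eq_iff: "\<pi> a = \<pi> b \<longleftrightarrow> a - b \<in> I"
proof
  assume eq: "\<pi> a = \<pi> b"
  have "0 + a \<in> \<pi> a" unfolding \<pi>_def' by (rule imageI[OF I_closed(2)])
  then obtain i where "i \<in> I" "a = i + b" unfolding eq unfolding \<pi>_def' by auto
  then show "a - b \<in> I" by simp
next
  assume ab: "a - b \<in> I"
  show "\<pi> a = \<pi> b"
  proof
    show "\<pi> a \<subseteq> \<pi> b" unfolding \<pi>_def'
    proof
      fix x assume "x \<in> (\<lambda>i. i + a) ` I"
      then obtain i where i: "i \<in> I" "x = i + a" by blast
      then have "x = (i + (a - b)) + b" by simp
      then show "x \<in> (\<lambda>i. i + b) ` I" using I_closed(3)[OF i(1) ab] by (rule image_eqI)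
    qed
    show "\<pi> b \<subseteq> \<pi> a" unfolding \<pi>_def'
    proof
      fix x assume "x \<in> (\<lambda>i. i + b) ` I"
      then obtain i where i: "i \<in> I" "x = i + b" by blast
      then have "x = (i - (a - b)) + a" by simp
      then show "x \<in> (\<lambda>i. i + a) ` I" using I_closed(7)[OF i(1) ab] by (rule image_eqI)
    qed
  qed
qed

lemma carrier_R: "carrier R = \<pi> ` C"
  unfolding FactRing_def A_RCOSETS_def' \<pi>_def polynomial_ring_simps by auto

lemma cring_R: "cring R"
  by (rule ideal.quotient_is_cring[OF idealI_S cring_polynomial_ring])

lemma \<pi>_hom: "ring_hom_cring S R \<pi>"
  using ideal.rcos_ring_hom_cring[OF idealI_S cring_polynomial_ring] unfolding \<pi>_def[abs_def] .

lemma \<pi>_simps: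
  "a \<in> C \<Longrightarrow> b \<in> C \<Longrightarrow> \<pi> a \<otimes>\<^bsub>R\<^esub> \<pi> b = \<pi> (a * b)"
  "a \<in> C \<Longrightarrow> b \<in> C \<Longrightarrow> \<pi> a \<oplus>\<^bsub>R\<^esub> \<pi> b = \<pi> (a + b)"
  "\<one>\<^bsub>R\<^esub> = \<pi> 1" "\<zero>\<^bsub>R\<^esub> = \<pi> 0"
proof -
  interpret ring_hom_cring S R \<pi> by (rule \<pi>_hom)
  show "a \<in> C \<Longrightarrow> b \<in> C \<Longrightarrow> \<pi> a \<otimes>\<^bsub>R\<^esub> \<pi> b = \<pi> (a * b)"
    using hom_mult[of a b] by (simp add: polynomial_ring_simps)
  show "a \<in> C \<Longrightarrow> b \<in> C \<Longrightarrow> \<pi> a \<oplus>\<^bsub>R\<^esub> \<pi> b = \<pi> (a + b)"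
    using hom_add[of a b] by (simp add: polynomial_ring_simps)
  show "\<one>\<^bsub>R\<^esub> = \<pi> 1" using hom_one by (simp add: polynomial_ring_simps)
  show "\<zero>\<^bsub>R\<^esub> = \<pi> 0" using hom_zero by (simp add: polynomial_ring_simps)
qed

text \<open>The inverse image of an ideal under the projection.\<close>

definition pre :: "('v, 'k) mpol set set \<Rightarrow> ('v, 'k) mpol set" where
  "pre J = {a \<in> C. \<pi> a \<in> J}"

lemma pre_ideal:
  assumes J: "ideal J R" shows "ideal_of C (pre J)" "I \<subseteq> pre J"
proof -
  note J' = idealD[OF J]
  show "ideal_of C (pre J)"
    unfolding ideal_of_def
  proof (intro conjI ballI)
    show "pre J \<subseteq> C" by (auto simp: pre_def)
    show "0 \<in> pre J" using J'(2) carrier_closed(2) by (simp add: pre_def \<pi>_simps)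
    show "x + y \<in> pre J" if "x \<in> pre J" "y \<in> pre J" for x y
      using that J'(3)[of "\<pi> x" "\<pi> y"] carrier_closed(6)[of x y] by (simp add: pre_def \<pi>_simps)
    show "c * x \<in> pre J" if "c \<in> C" "x \<in> pre J" for c x
      using that J'(4)[of "\<pi> c" "\<pi> x"] carrier_closed(4)[of c x] by (simp add: pre_def \<pi>_simps carrier_R)
  qed
  show "I \<subseteq> pre J"
  proof
    fix i assume i: "i \<in> I"
    then have "\<pi> i = \<pi> 0" unfolding \<pi>_eq_iff by simp
    then show "i \<in> pre J" using J'(2) I_closed(1)[OF i] by (simp add: pre_def \<pi>_simps)
  qed
qed

lemma pre_subset_iff:
  assumes J: "ideal J R" and K: "ideal K R" shows "pre J \<subseteq> pre K \<longleftrightarrow> J \<subseteq> K"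
proof
  assume sub: "pre J \<subseteq> pre K"
  show "J \<subseteq> K"
  proof
    fix x assume x: "x \<in> J"
    then obtain a where "a \<in> C" "x = \<pi> a" using idealD(1)[OF J x] unfolding carrier_R by blast
    then show "x \<in> K" using sub x unfolding pre_def by blast
  qed
qed (auto simp: pre_def)

lemma \<pi>_in_image_iff:
  assumes J: "ideal_of C J" "I \<subseteq> J"
  shows "\<pi> a \<in> \<pi> ` J \<longleftrightarrow> a \<in> J"
proof
  assume "\<pi> a \<in> \<pi> ` J"
  then obtain j where j: "j \<in> J" "\<pi> a = \<pi> j" by blast
  then have "a - j \<in> J" using \<pi>_eq_iff J(2) by blast
  from ideal_ofD(3)[OF J(1) is_subring_poly_carrier this j(1)] show "a \<in> J" by simp
qed simp

lemma image_ideal: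
  assumes J: "ideal_of C J" shows "ideal (\<pi> ` J) R"
proof -
  interpret R: cring R by (rule cring_R)
  note J' = ideal_ofD[OF J is_subring_poly_carrier]
  show ?thesis
  proof (rule R.cideal_I)
    show "\<pi> ` J \<subseteq> carrier R" unfolding carrier_R using J'(1) by blast
    show "\<zero>\<^bsub>R\<^esub> \<in> \<pi> ` J" unfolding \<pi>_simps using J'(2) by blast
  next
    fix x y assume "x \<in> \<pi> ` J" "y \<in> \<pi> ` J"
    then obtain a b where ab: "a \<in> J" "x = \<pi> a" "b \<in> J" "y = \<pi> b" by blast
    then have "x \<oplus>\<^bsub>R\<^esub> y = \<pi> (a + b)" using J'(1) by (simp add: \<pi>_simps)
    then show "x \<oplus>\<^bsub>R\<^esub> y \<in> \<pi> ` J" using J'(3)[OF ab(1,3)] by blast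
  next
    fix x y assume "x \<in> carrier R" "y \<in> \<pi> ` J"
    then obtain a b where ab: "a \<in> C" "x = \<pi> a" "b \<in> J" "y = \<pi> b" unfolding carrier_R by blast
    then have "x \<otimes>\<^bsub>R\<^esub> y = \<pi> (a * b)" using J'(1) by (simp add: \<pi>_simps)
    then show "x \<otimes>\<^bsub>R\<^esub> y \<in> \<pi> ` J" using J'(4)[OF ab(1,3)] by blast
  qed
qed

lemma genideal_R:
  assumes xs: "set xs \<subseteq> C"
  shows "Idl\<^bsub>R\<^esub> (set (map \<pi> xs)) = \<pi> ` foldl (add_generator C) I xs"
proof -
  interpret R: cring R by (rule cring_R)
  have X: "set (map \<pi> xs) \<subseteq> carrier R" using xs unfolding carrier_R by auto
  have F: "ideal_of C (foldl (add_generator C) I xs)" "set xs \<subseteq> foldl (add_generator C) I xs"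
    using ideal_of_foldl_add_generator[OF is_subring_poly_carrier I xs] by blast+
  show ?thesis
  proof
    show "Idl\<^bsub>R\<^esub> (set (map \<pi> xs)) \<subseteq> \<pi> ` foldl (add_generator C) I xs"
      using F(2) by (intro R.genideal_minimal image_ideal[OF F(1)]) auto
    note G = R.genideal_ideal[OF X]
    have "set xs \<subseteq> pre (Idl\<^bsub>R\<^esub> (set (map \<pi> xs)))"
      using R.genideal_self[OF X] xs unfolding pre_def by auto
    then have "foldl (add_generator C) I xs \<subseteq> pre (Idl\<^bsub>R\<^esub> (set (map \<pi> xs)))"
      by (rule foldl_add_generator_subset[OF is_subring_poly_carrier pre_ideal[OF G]])
    then show "\<pi> ` foldl (add_generator C) I xs \<subseteq> Idl\<^bsub>R\<^esub> (set (map \<pi> xs))" unfolding pre_def by blast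
  qed
qed

lemma regular_sequence_R:
  assumes xs: "set xs \<subseteq> C" and w: "weakly_regular C I xs"
    and proper: "ideal N R" "N \<noteq> carrier R" "set (map \<pi> xs) \<subseteq> N"
  shows "regular_sequence R (map \<pi> xs)"
  unfolding regular_sequence_def
proof (intro conjI allI impI ballI)
  interpret R: cring R by (rule cring_R)
  show "set (map \<pi> xs) \<subseteq> carrier R" using xs unfolding carrier_R by auto
  have "Idl\<^bsub>R\<^esub> (set (map \<pi> xs)) \<subseteq> N" by (rule R.genideal_minimal[OF proper(1,3)])
  then show "Idl\<^bsub>R\<^esub> (set (map \<pi> xs)) \<noteq> carrier R" using proper(2) idealD(6)[OF proper(1)] by blast
next
  fix i x assume i: "i < length (map \<pi> xs)" and x: "x \<in> carrier R"
    and m: "map \<pi> xs ! i \<otimes>\<^bsub>R\<^esub> x \<in> Idl\<^bsub>R\<^esub> (set (take i (map \<pi> xs)))"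
  obtain a where a: "a \<in> C" "x = \<pi> a" using x unfolding carrier_R by blast
  have xi: "xs ! i \<in> C" using i xs by auto
  have xt: "set (take i xs) \<subseteq> C" using xs set_take_subset[of i xs] by blast
  let ?J = "foldl (add_generator C) I (take i xs)"
  have J: "ideal_of C ?J" "I \<subseteq> ?J" using ideal_of_foldl_add_generator[OF is_subring_poly_carrier I xt] by blast+
  have Idl: "Idl\<^bsub>R\<^esub> (set (take i (map \<pi> xs))) = \<pi> ` ?J" using genideal_R[OF xt] by (simp add: take_map)
  have "\<pi> (xs ! i * a) \<in> \<pi> ` ?J" using m i unfolding Idl a(2) by (simp add: \<pi>_simps xi a(1))
  then have "xs ! i * a \<in> ?J" using \<pi>_in_image_iff[OF J] by blast
  then have "a \<in> ?J" using weakly_regular_nth[OF w _ a(1)] i by simp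
  then show "x \<in> Idl\<^bsub>R\<^esub> (set (take i (map \<pi> xs)))" unfolding Idl a(2) by (rule imageI)
qed

lemma prime_of_pre:
  assumes P: "primeideal P R" shows "prime_of C (pre P)"
proof -
  have Pi: "ideal P R" using P by (simp add: primeideal_def)
  show ?thesis
    unfolding prime_of_def
  proof (intro conjI ballI impI)
    show "ideal_of C (pre P)" by (rule pre_ideal(1)[OF Pi])
    have "\<one>\<^bsub>R\<^esub> \<notin> P" using ideal_whole_iff[OF Pi] primeideal.I_notcarr[OF P] by simp
    then show "1 \<notin> pre P" by (simp add: pre_def \<pi>_simps)
    fix x y assume xy: "x \<in> C" "y \<in> C" "x * y \<in> pre P"
    then have "\<pi> x \<otimes>\<^bsub>R\<^esub> \<pi> y \<in> P" by (simp add: pre_def \<pi>_simps)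
    then have "\<pi> x \<in> P \<or> \<pi> y \<in> P"
      using primeideal.I_prime[OF P, of "\<pi> x" "\<pi> y"] xy(1,2) unfolding carrier_R by blast
    then show "x \<in> pre P \<or> y \<in> pre P" using xy(1,2) by (simp add: pre_def)
  qed
qed

text \<open>If the inverse image of \<open>M\<close> and \<open>b\<close> did not generate the unit ideal, the image of the ideal that they generate
would lie strictly between \<open>M\<close> and the whole ring.\<close>

lemma maximal_pre:
  assumes M: "maximalideal M R" and b: "b \<in> C" "b \<notin> pre M"
  shows "\<exists>c\<in>C. b * c - 1 \<in> pre M"
proof -
  have Mi: "ideal M R" using M by (simp add: maximalideal_def)
  note pM = pre_ideal[OF Mi]
  let ?J = "add_generator C (pre M) b"
  have J: "ideal_of C ?J" by (rule ideal_of_add_generator[OF is_subring_poly_carrier pM(1) b(1)])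
  have sub: "pre M \<subseteq> ?J" by (rule subset_add_generator[OF is_subring_poly_carrier])
  have bJ: "b \<in> ?J" by (rule self_in_add_generator[OF is_subring_poly_carrier pM(1)])
  have IJ: "I \<subseteq> ?J" using pM(2) sub by blast
  note K = image_ideal[OF J]
  have "M \<subseteq> \<pi> ` ?J"
  proof
    fix x assume x: "x \<in> M"
    then obtain a where a: "a \<in> C" "x = \<pi> a" using idealD(1)[OF Mi x] unfolding carrier_R by blast
    then have "a \<in> ?J" using x sub unfolding pre_def by blast
    then show "x \<in> \<pi> ` ?J" unfolding a(2) by (rule imageI)
  qed
  moreover have "\<pi> ` ?J \<noteq> M" using b bJ unfolding pre_def by blast
  ultimately have "\<pi> ` ?J = carrier R" using maximalideal.I_maximal[OF M K] idealD(6)[OF K] by blast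
  then have "\<pi> 1 \<in> \<pi> ` ?J" using ideal_whole_iff[OF K] by (simp add: \<pi>_simps)
  then have "1 \<in> ?J" using \<pi>_in_image_iff[OF J IJ] by blast
  then obtain m c where mc: "m \<in> pre M" "c \<in> C" "1 = m + b * c" unfolding add_generator_def by blast
  then have "b * c - 1 = - m" by (simp add: algebra_simps)
  then show ?thesis using ideal_ofD(6)[OF pM(1) is_subring_poly_carrier mc(1)] mc(2) by metis
qed

lemma noetherian_S: "noetherian_ring S"
proof -
  interpret S: cring S by (rule cring_polynomial_ring)
  show ?thesis
  proof (rule S.trivial_ideal_chain_imp_noetherian)
    fix Ch assume Ch: "Ch \<noteq> {}" "subset.chain {J. ideal J S} Ch"
    have id: "ideal_of C J" if "J \<in> Ch" for J
      using Ch(2) that unfolding subset_chain_def by (auto simp: ideal_polynomial_ring_iff)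
    show "\<Union>Ch \<in> Ch"
    proof (rule ccontr)
      assume no: "\<Union>Ch \<notin> Ch"
      have step: "\<exists>J'. J' \<in> Ch \<and> J \<subset> J'" if J: "J \<in> Ch" for J
      proof -
        have "\<Union>Ch \<noteq> J" using no J by blast
        then obtain x J' where "J' \<in> Ch" "x \<in> J'" "x \<notin> J" using J by blast
        moreover have "J \<subseteq> J' \<or> J' \<subseteq> J" using Ch(2) J \<open>J' \<in> Ch\<close> unfolding subset_chain_def by simp
        ultimately show ?thesis by blast
      qed
      have "\<exists>f. \<forall>n::nat. f n \<in> Ch \<and> f n \<subset> f (Suc n)"
      proof (rule dependent_nat_choice)
        show "\<exists>J. J \<in> Ch" using Ch(1) by (simp add: ex_in_conv)
        show "\<exists>J'. J' \<in> Ch \<and> J \<subset> J'" if "J \<in> Ch" for J and n :: nat by (rule step[OF that])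
      qed
      then obtain f where f: "\<And>n::nat. f n \<in> Ch" "\<And>n. f n \<subset> f (Suc n)" by blast
      have "(\<forall>n. ideal_of C (f n)) \<and> (\<forall>n. f n \<subseteq> f (Suc n)) \<longrightarrow> (\<exists>n. \<forall>m\<ge>n. f m = f n)"
        using acc_poly_carrier[OF V, where 'k='k] unfolding acc_def by (rule spec)
      moreover have "(\<forall>n. ideal_of C (f n)) \<and> (\<forall>n. f n \<subseteq> f (Suc n))"
        by (intro conjI allI id f(1) psubset_imp_subset[OF f(2)])
      ultimately obtain n where n: "\<forall>m\<ge>n. f m = f n" by (elim impE exE)
      have "f (Suc n) = f n" by (rule n[rule_format]) simp
      with f(2)[of n] show False by simp
    qed
  qed
qed

lemma noetherian_R: "noetherian_ring R"
  by (rule noetherian_transfer[OF noetherian_S cring.axioms(1)[OF cring_R], where c = pre])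
    (simp_all add: pre_ideal pre_subset_iff ideal_polynomial_ring_iff)

end



section \<open>Edge ideals are Stanley--Reisner ideals\<close>

lemma independence_complex_eq_faces: "independence_complex G = faces (edges G) (verts G)"
  by (simp add: independence_complex_def faces_def)

text \<open>A monomial whose support is not independent contains both ends of an edge, and these are different vertices, so the monomial is divisible by the generator of
that edge.\<close>

lemma edge_ideal_eq_sr_ideal:
  assumes E: "\<And>e. e \<in> edges G \<Longrightarrow> e \<subseteq> verts G \<and> card e = 2"
  shows "edge_ideal G = (sr_ideal (verts G) (independence_complex G) :: ('v, 'k::field) mpol set)"
proof -
  let ?S = "polynomial_ring (verts G) :: ('v, 'k) mpol ring"
  let ?X = "{var u * var v | u v. {u, v} \<in> edges G} :: ('v, 'k) mpol set"
  let ?I = "sr_ideal (verts G) (independence_complex G) :: ('v, 'k) mpol set"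
  interpret S: cring ?S by (rule cring_polynomial_ring)
  have Xp: "?X \<subseteq> poly_carrier (verts G)"
  proof
    fix p assume "p \<in> ?X"
    then obtain u v where p: "p = var u * var v" "{u, v} \<in> edges G" by blast
    then show "p \<in> poly_carrier (verts G)"
      using E[OF p(2)] unfolding p(1) by (intro is_subringD(4)[OF is_subring_poly_carrier] var_in_poly_carrier) auto
  qed
  then have Xc: "?X \<subseteq> carrier ?S" by (simp only: polynomial_ring_simps)
  have I: "ideal_of (poly_carrier (verts G)) ?I"
    unfolding independence_complex_eq_faces by (rule ideal_of_sr_ideal[OF down_closed_faces])
  show ?thesis
    unfolding edge_ideal_def
  proof
    show "Idl\<^bsub>?S\<^esub> ?X \<subseteq> ?I"
    proof (rule S.genideal_minimal)
      show "ideal ?I ?S" using I by (simp only: ideal_polynomial_ring_iff)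
      show "?X \<subseteq> ?I"
      proof
        fix p assume pX: "p \<in> ?X"
        then obtain u v where p: "p = var u * var v" "{u, v} \<in> edges G" by blast
        have pe: "p = single (single u 1 + single v 1) 1"
          by (simp add: p(1) var_def mult_single)
        have "{u, v} \<notin> independence_complex G" using p(2) by (auto simp: independence_complex_def)
        then have "\<forall>m\<in>keys p. keys m \<notin> independence_complex G"
          unfolding pe by (simp add: keys_add_nat insert_commute)
        then show "p \<in> ?I" using pX Xp unfolding sr_ideal_def by blast
      qed
    qed
    have G: "ideal_of (poly_carrier (verts G)) (Idl\<^bsub>?S\<^esub> ?X)"
      using S.genideal_ideal[OF Xc] by (simp only: ideal_polynomial_ring_iff)
    show "?I \<subseteq> Idl\<^bsub>?S\<^esub> ?X"
    proof
      fix p assume p: "p \<in> ?I"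
      show "p \<in> Idl\<^bsub>?S\<^esub> ?X"
      proof (rule in_ideal_termwise[OF G])
        fix m assume m: "m \<in> keys p"
        let ?c = "lookup p m"
        have mV: "keys m \<subseteq> verts G" using p m unfolding sr_ideal_def poly_carrier_def by blast
        moreover have "keys m \<notin> independence_complex G" using p m unfolding sr_ideal_def by blast
        ultimately obtain e where e: "e \<in> edges G" "e \<subseteq> keys m"
          unfolding independence_complex_def by blast
        then obtain u v where uv: "e = {u, v}" "u \<noteq> v" using E[OF e(1)] by (auto simp: card_2_iff)
        let ?m1 = "m - single u 1"
        let ?m2 = "?m1 - single v 1"
        have u1: "1 \<le> lookup m u" using e(2) uv(1) by (simp add: in_keys_iff)
        have v1: "1 \<le> lookup ?m1 v"
          using e(2) uv by (simp add: in_keys_iff lookup_minus lookup_single)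
        have eq: "single m ?c = (var u * var v) * single ?m2 ?c"
          using single_factor[OF u1, of ?c] single_factor[OF v1, of ?c] by (simp add: mult.assoc)
        have "keys ?m2 \<subseteq> verts G"
          using mV by (auto simp: in_keys_iff lookup_minus)
        then have s: "single ?m2 ?c \<in> (poly_carrier (verts G) :: ('v, 'k) mpol set)" by (rule single_in_poly_carrier)
        have "var u * var v \<in> Idl\<^bsub>?S\<^esub> ?X"
          using S.genideal_self[OF Xc] e(1) unfolding uv(1) by blast
        then show "single m ?c \<in> Idl\<^bsub>?S\<^esub> ?X"
          unfolding eq by (rule ideal_ofD(5)[OF G is_subring_poly_carrier s])
      qed
    qed
  qed
qed

section \<open>Graphs covered by cliques with free vertices\<close>

text \<open>The combinatorial content of a hybrid graph: the blocks \<open>C\<^sub>i = A\<^sub>i \<union> B\<^sub>i\<close> are cliques partitioning the vertices, and each contains a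
vertex \<open>z\<^sub>i\<close>, for instance the first vertex of \<open>B\<^sub>i\<close>, all of whose neighbours lie in the block. Further vertices of \<open>B\<^sub>i\<close> behave like
elements of \<open>A\<^sub>i\<close> in all that follows.\<close>

locale clique_blocks =
  fixes V :: "'v set" and E :: "'v set set" and C :: "nat \<Rightarrow> 'v set" and z :: "nat \<Rightarrow> 'v" and r :: nat
  assumes finite_V: "finite V"
    and E2: "e \<in> E \<Longrightarrow> e \<subseteq> V \<and> card e = 2"
    and cover: "(\<Union>i\<in>{1..r}. C i) = V"
    and disjoint: "i \<in> {1..r} \<Longrightarrow> j \<in> {1..r} \<Longrightarrow> i \<noteq> j \<Longrightarrow> C i \<inter> C j = {}"
    and block_clique: "i \<in> {1..r} \<Longrightarrow> u \<in> C i \<Longrightarrow> v \<in> C i \<Longrightarrow> u \<noteq> v \<Longrightarrow> {u, v} \<in> E"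
    and z_in: "i \<in> {1..r} \<Longrightarrow> z i \<in> C i"
    and z_free: "i \<in> {1..r} \<Longrightarrow> e \<in> E \<Longrightarrow> z i \<in> e \<Longrightarrow> e \<subseteq> C i"
begin

abbreviation "\<Delta> \<equiv> faces E V"

lemma finite_complex: "finite \<Delta>"
  by (rule finite_subset[of _ "Pow V"]) (auto simp: faces_def finite_V)

lemma finite_face: "F \<in> \<Delta> \<Longrightarrow> finite F"
  using finite_subset[OF facesD(1) finite_V] .

lemma one_per_block:
  assumes F: "F \<in> \<Delta>" and i: "i \<in> {1..r}" and uv: "u \<in> F" "v \<in> F" "u \<in> C i" "v \<in> C i"
  shows "u = v"
proof (rule ccontr)
  assume "u \<noteq> v"
  then have "{u, v} \<in> E" by (rule block_clique[OF i uv(3,4)])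
  then have "\<not> {u, v} \<subseteq> F" by (rule facesD(2)[OF F])
  then show False using uv by simp
qed

lemma block_unique: "i \<in> {1..r} \<Longrightarrow> j \<in> {1..r} \<Longrightarrow> v \<in> C i \<Longrightarrow> v \<in> C j \<Longrightarrow> i = j"
  using disjoint[of i j] by blast

lemma card_face_le:
  assumes F: "F \<in> \<Delta>" shows "card F \<le> r"
proof -
  have "\<forall>v\<in>F. \<exists>i. i \<in> {1..r} \<and> v \<in> C i" using facesD(1)[OF F] cover by blast
  then obtain b where b: "\<And>v. v \<in> F \<Longrightarrow> b v \<in> {1..r} \<and> v \<in> C (b v)" by metis
  have "inj_on b F"
  proof (rule inj_onI)
    fix u v assume uv: "u \<in> F" "v \<in> F" "b u = b v"
    show "u = v"
      using one_per_block[OF F conjunct1[OF b[OF uv(1)]] uv(1,2)] b[OF uv(1)] b[OF uv(2)] uv(3) by simp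
  qed
  then have "card F \<le> card {1..r}" using b by (intro card_inj_on_le) auto
  then show ?thesis by simp
qed

lemma edge_with_free_vertex:
  assumes e: "e \<in> E" "z i \<in> e" and i: "i \<in> {1..r}"
  obtains u where "e = {u, z i}" "u \<noteq> z i" "u \<in> C i"
proof -
  obtain u where u: "e = {u, z i}" "u \<noteq> z i" using e(2) conjunct2[OF E2[OF e(1)]] by (rule other_endpoint)
  moreover have "u \<in> C i" using z_free[OF i e] u(1) by simp
  ultimately show ?thesis by (rule that)
qed

text \<open>A face without a vertex of the \<open>i\<close>-th block may be enlarged by \<open>z\<^sub>i\<close>, whose neighbours all lie in
the block. With \<open>F' = F\<close> this makes facets transversals of the blocks; with \<open>F' = F - {v}\<close> it exchanges \<open>v\<close> for \<open>z\<^sub>i\<close>.\<close>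

lemma insert_free_vertex:
  assumes F: "F \<in> \<Delta>" and i: "i \<in> {1..r}" and F': "F' \<subseteq> F" "F' \<inter> C i = {}"
  shows "insert (z i) F' \<in> \<Delta>"
proof (rule facesI)
  show "insert (z i) F' \<subseteq> V" using facesD(1)[OF F] F'(1) z_in[OF i] cover i by blast
  fix e assume e: "e \<in> E"
  show "\<not> e \<subseteq> insert (z i) F'"
  proof
    assume sub: "e \<subseteq> insert (z i) F'"
    show False
    proof (cases "z i \<in> e")
      case True
      obtain u where u: "e = {u, z i}" "u \<noteq> z i" "u \<in> C i" using e True i by (rule edge_with_free_vertex)
      then have "u \<in> F'" using sub by blast
      then show False using u(3) F'(2) by blast
    next
      case False
      then have "e \<subseteq> F" using sub F'(1) by blast
      then show False using facesD(2)[OF F e] by blast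
    qed
  qed
qed

lemma facet_meets_block:
  assumes F: "F \<in> facets \<Delta>" and i: "i \<in> {1..r}"
  shows "\<exists>v. v \<in> F \<and> v \<in> C i"
proof (rule ccontr)
  assume "\<not> ?thesis"
  then have d: "F \<inter> C i = {}" by blast
  have F\<Delta>: "F \<in> \<Delta>" using F by (simp add: facets_def)
  have "insert (z i) F \<in> \<Delta>" by (rule insert_free_vertex[OF F\<Delta> i order_refl d])
  then have "insert (z i) F = F" using F unfolding facets_def by blast
  then have "z i \<in> F" by blast
  then show False using d z_in[OF i] by blast
qed

lemma facet_iff: "F \<in> facets \<Delta> \<longleftrightarrow> F \<in> \<Delta> \<and> card F = r"
proof
  assume F: "F \<in> facets \<Delta>"
  then have F\<Delta>: "F \<in> \<Delta>" by (simp add: facets_def)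
  obtain g where g: "\<And>i. i \<in> {1..r} \<Longrightarrow> g i \<in> F \<and> g i \<in> C i" using facet_meets_block[OF F] by metis
  have "inj_on g {1..r}"
  proof (rule inj_onI)
    fix i j assume ij: "i \<in> {1..r}" "j \<in> {1..r}" "g i = g j"
    show "i = j" using block_unique[OF ij(1,2)] g[OF ij(1)] g[OF ij(2)] ij(3) by simp
  qed
  then have "card {1..r} \<le> card F" using g finite_face[OF F\<Delta>] by (intro card_inj_on_le) auto
  then show "F \<in> \<Delta> \<and> card F = r" using card_face_le[OF F\<Delta>] F\<Delta> by simp
next
  assume F: "F \<in> \<Delta> \<and> card F = r"
  have "H = F" if H: "H \<in> \<Delta>" "F \<subseteq> H" for H
    using card_seteq[OF finite_face[OF H(1)] H(2)] card_face_le[OF H(1)] F by simp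
  then show "F \<in> facets \<Delta>" using F by (simp add: facets_def)
qed

lemma free_vertices_facet: "z ` {1..r} \<in> facets \<Delta>"
  unfolding facet_iff
proof
  have inj: "inj_on z {1..r}"
  proof (rule inj_onI)
    fix i j assume ij: "i \<in> {1..r}" "j \<in> {1..r}" "z i = z j"
    show "i = j" using block_unique[OF ij(1,2)] z_in[OF ij(1)] z_in[OF ij(2)] ij(3) by simp
  qed
  then show "card (z ` {1..r}) = r" by (simp add: card_image)
  show "z ` {1..r} \<in> \<Delta>"
  proof (rule facesI)
    show "z ` {1..r} \<subseteq> V" using z_in cover by blast
    fix e assume e: "e \<in> E"
    show "\<not> e \<subseteq> z ` {1..r}"
    proof
      assume sub: "e \<subseteq> z ` {1..r}"
      have "e \<noteq> {}" using E2[OF e] by auto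
      then obtain i where i: "i \<in> {1..r}" "z i \<in> e" using sub by blast
      obtain u where u: "e = {u, z i}" "u \<noteq> z i" "u \<in> C i" using e i(2,1) by (rule edge_with_free_vertex)
      then obtain j where j: "j \<in> {1..r}" "u = z j" using sub by blast
      have "j = i" using block_unique[OF j(1) i(1) z_in[OF j(1)]] u(3) j(2) by simp
      then show False using u(2) j(2) by simp
    qed
  qed
qed

lemma pure_complex_faces: "pure_complex \<Delta>"
  unfolding pure_complex_def by (intro ballI) (simp add: facet_iff)

lemma complex_dim_faces: "complex_dim \<Delta> = int r - 1"
  unfolding complex_dim_def
proof (rule Max_eqI)
  show "finite ((\<lambda>F. int (card F) - 1) ` \<Delta>)" by (intro finite_imageI finite_complex)
  show "y \<le> int r - 1" if y: "y \<in> (\<lambda>F. int (card F) - 1) ` \<Delta>" for y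
  proof -
    obtain F where "F \<in> \<Delta>" "y = int (card F) - 1" using y by (elim imageE)
    then show ?thesis using card_face_le[of F] by simp
  qed
  have "z ` {1..r} \<in> \<Delta>" "int r - 1 = int (card (z ` {1..r})) - 1"
    using free_vertices_facet unfolding facet_iff by auto
  then show "int r - 1 \<in> (\<lambda>F. int (card F) - 1) ` \<Delta>" by (intro image_eqI)
qed

text \<open>The facets are shelled in the order of increasing weight, beginning with the facet that consists of the \<open>z\<^sub>i\<close>.\<close>

definition weight :: "'v set \<Rightarrow> nat" where
  "weight F = card (F - z ` {1..r})"

text \<open>If all vertices of \<open>F\<close> other than the \<open>z\<^sub>i\<close> belonged to \<open>H\<close>, the weights would force \<open>F\<close> and \<open>H\<close> to agree in
these vertices, and in the remaining blocks both contain \<open>z\<^sub>i\<close>.\<close>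

lemma facet_differs_in_non_free_vertex:
  assumes F: "F \<in> facets \<Delta>" and H: "H \<in> facets \<Delta>" and ne: "H \<noteq> F" and w: "weight H \<le> weight F"
  shows "\<exists>v. v \<in> F - z ` {1..r} \<and> v \<notin> H"
proof (rule ccontr)
  assume "\<not> ?thesis"
  then have sub: "F - z ` {1..r} \<subseteq> H - z ` {1..r}" by blast
  have F\<Delta>: "F \<in> \<Delta>" and H\<Delta>: "H \<in> \<Delta>" using F H by (simp_all add: facets_def)
  have eq: "F - z ` {1..r} = H - z ` {1..r}"
    using finite_face[OF H\<Delta>] w by (intro card_seteq sub) (simp_all add: weight_def)
  have "F \<subseteq> H"
  proof
    fix v assume v: "v \<in> F"
    show "v \<in> H"
    proof (cases "v \<in> z ` {1..r}")
      case False
      then show ?thesis using v eq by blast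
    next
      case True
      then obtain k where k: "k \<in> {1..r}" "v = z k" by blast
      obtain u where u: "u \<in> H" "u \<in> C k" using facet_meets_block[OF H k(1)] by blast
      have "u = v"
      proof (cases "u \<in> z ` {1..r}")
        case True
        then obtain l where l: "l \<in> {1..r}" "u = z l" by blast
        have "l = k" using block_unique[OF l(1) k(1) z_in[OF l(1)]] u(2) l(2) by simp
        then show ?thesis using k(2) l(2) by simp
      next
        case False
        then have "u \<in> F" using u(1) eq by blast
        then show ?thesis using one_per_block[OF F\<Delta> k(1) _ v u(2)] z_in[OF k(1)] k(2) by simp
      qed
      then show ?thesis using u(1) by simp
    qed
  qed
  then have "H = F" using F H\<Delta> by (simp add: facets_def)
  with ne show False by contradiction
qed

text \<open>Replacing \<open>v\<close> by the vertex \<open>z\<^sub>k\<close> of its block gives a facet again.\<close>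

lemma exchange_free_vertex:
  assumes F: "F \<in> facets \<Delta>" and v: "v \<in> F - z ` {1..r}"
  shows "\<exists>H\<in>facets \<Delta>. F - {v} \<subseteq> H \<and> weight H < weight F"
proof -
  have F\<Delta>: "F \<in> \<Delta>" and cF: "card F = r" using F by (simp_all add: facet_iff)
  note fin = finite_face[OF F\<Delta>]
  have "v \<in> V" using facesD(1)[OF F\<Delta>] v by blast
  then obtain k where k: "k \<in> {1..r}" "v \<in> C k" unfolding cover[symmetric] by blast
  have d: "(F - {v}) \<inter> C k = {}"
  proof -
    have "u = v" if "u \<in> F" "u \<in> C k" for u using one_per_block[OF F\<Delta> k(1) that(1) _ that(2) k(2)] v by simp
    then show ?thesis by blast
  qed
  let ?H = "insert (z k) (F - {v})"
  have H\<Delta>: "?H \<in> \<Delta>" by (rule insert_free_vertex[OF F\<Delta> k(1) Diff_subset d])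
  have zk: "z k \<notin> F - {v}" using d z_in[OF k(1)] by blast
  have "card ?H = Suc (card (F - {v}))" using fin zk by (intro card_insert_disjoint) simp_all
  also have "\<dots> = r" unfolding cF[symmetric] using fin v by (intro card_Suc_Diff1) simp_all
  finally have H: "?H \<in> facets \<Delta>" unfolding facet_iff using H\<Delta> by (intro conjI)
  have sub: "?H - z ` {1..r} \<subset> F - z ` {1..r}" using k(1) v by auto
  have "weight ?H < weight F" unfolding weight_def using fin by (intro psubset_card_mono sub) simp
  then have "F - {v} \<subseteq> ?H \<and> weight ?H < weight F" by (intro conjI subset_insertI)
  then show ?thesis using H by (rule bexI)
qed

text \<open>An earlier facet misses some vertex \<open>v\<close> of \<open>F\<close> that is not one of the \<open>z\<^sub>i\<close>, so it meets \<open>F\<close> inside \<open>F - {v}\<close>. Conversely each such \<open>F - {v}\<close> lies in an earlier facet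
by exchange. So the earlier facets meet \<open>F\<close> exactly in the faces generated by these sets.\<close>

lemma shellable_faces: "shellable \<Delta>"
proof -
  have "finite (facets \<Delta>)" using finite_complex by (simp add: facets_def)
  then obtain xs where xs: "set xs = facets \<Delta>" "distinct xs" using finite_distinct_list by blast
  define Fs where "Fs = sort_key weight xs"
  have Fs: "set Fs = facets \<Delta>" "distinct Fs" "sorted (map weight Fs)"
    using xs by (simp_all add: Fs_def)
  have wle: "weight (Fs ! j) \<le> weight (Fs ! i)" if "j \<le> i" "i < length Fs" for i j
    using sorted_nth_mono[OF Fs(3), of j i] that by simp
  show ?thesis
    unfolding shellable_def
  proof (intro exI[of _ Fs] conjI allI impI Fs(1,2))
    fix i assume i: "1 \<le> i \<and> i < length Fs"
    let ?F = "Fs ! i"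
    let ?M = "(\<lambda>v. ?F - {v}) ` (?F - z ` {1..r})"
    have F: "?F \<in> facets \<Delta>" using i Fs(1) nth_mem by blast
    have earlier: "\<exists>v. v \<in> ?F - z ` {1..r} \<and> v \<notin> Fs ! j" if j: "j < i" for j
    proof (rule facet_differs_in_non_free_vertex[OF F])
      show "Fs ! j \<in> facets \<Delta>" using i j Fs(1) nth_mem[of j Fs] by simp
      show "Fs ! j \<noteq> ?F" using i j nth_eq_iff_index_eq[OF Fs(2), of j i] by simp
      show "weight (Fs ! j) \<le> weight ?F" using i j by (intro wle) simp_all
    qed
    show "\<exists>M. M \<noteq> {} \<and> M \<subseteq> facets (Pow ?F - {?F}) \<and>
        generated_complex (set (take i Fs)) \<inter> generated_complex {?F} = generated_complex M"
    proof (intro exI[of _ ?M] conjI)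
      show "?M \<noteq> {}" using earlier[of 0] i by auto
      show "?M \<subseteq> facets (Pow ?F - {?F})" by (auto simp: facets_def)
      show "generated_complex (set (take i Fs)) \<inter> generated_complex {?F} = generated_complex ?M"
      proof (intro equalityI subsetI)
        fix X assume "X \<in> generated_complex (set (take i Fs)) \<inter> generated_complex {?F}"
        then obtain H where H: "H \<in> set (take i Fs)" "X \<subseteq> H" "X \<subseteq> ?F"
          unfolding generated_complex_def by auto
        then obtain j where j: "j < i" "H = Fs ! j" by (auto simp: in_set_conv_nth)
        obtain v where v: "v \<in> ?F - z ` {1..r}" "v \<notin> Fs ! j" using earlier[OF j(1)] by blast
        have "X \<subseteq> ?F - {v}" using H(2,3) v(2) j(2) by blast
        then show "X \<in> generated_complex ?M" using v(1) unfolding generated_complex_def by blast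
      next
        fix X assume "X \<in> generated_complex ?M"
        then obtain v where v: "v \<in> ?F - z ` {1..r}" "X \<subseteq> ?F - {v}"
          unfolding generated_complex_def by auto
        obtain H where H: "H \<in> facets \<Delta>" "?F - {v} \<subseteq> H" "weight H < weight ?F"
          using exchange_free_vertex[OF F v(1)] by blast
        obtain j where j: "j < length Fs" "H = Fs ! j" using H(1) unfolding Fs(1)[symmetric] by (auto simp: in_set_conv_nth)
        have "j < i"
        proof (rule ccontr)
          assume "\<not> j < i"
          then have "weight ?F \<le> weight (Fs ! j)" using j(1) by (intro wle) simp_all
          then show False using H(3) j(2) by simp
        qed
        then have "H \<in> set (take i Fs)" using j i by (auto simp: in_set_conv_nth)
        then show "X \<in> generated_complex (set (take i Fs)) \<inter> generated_complex {?F}"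
          using v(2) H(2) unfolding generated_complex_def by blast
      qed
    qed
  qed
qed

text \<open>Every maximal ideal contains a nonzero polynomial in each of the \<open>r\<close> block sums by Zariski's lemma, and these polynomials form a
regular sequence. Faces have at most \<open>r\<close> vertices, which bounds the chains of primes by \<open>r\<close>.\<close>

theorem cohen_macaulay_quotient:
  "cohen_macaulay (polynomial_ring V Quot (sr_ideal V \<Delta> :: ('v, 'k::field) mpol set)) \<and>
   krull_dim (polynomial_ring V Quot (sr_ideal V \<Delta> :: ('v, 'k) mpol set)) = enat r"
proof -
  let ?I = "sr_ideal V \<Delta> :: ('v, 'k) mpol set"
  have I: "ideal_of (poly_carrier V) ?I" by (rule ideal_of_sr_ideal[OF down_closed_faces])
  interpret Q: quotient_by_ideal V ?I by unfold_locales (rule finite_V, rule I)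
  let ?\<theta> = "\<lambda>i. (\<Sum>v\<in>C i. var v) :: ('v, 'k) mpol"
  let ?is = "[1..<Suc r]"
  have set_is: "set ?is = {1..r}" by auto
  have CV: "C i \<subseteq> V" if "i \<in> {1..r}" for i using cover that by blast
  have \<theta>: "?\<theta> i \<in> poly_carrier V" if "i \<in> {1..r}" for i
    using CV[OF that] by (intro is_subring_sum[OF is_subring_poly_carrier] var_in_poly_carrier) blast
  have "{} \<in> \<Delta>" using E2 by (intro facesI) force+
  show ?thesis
  proof (rule cring.cohen_macaulay_criterion[OF Q.cring_R Q.noetherian_R])
    have "(1 :: ('v, 'k) mpol) \<notin> ?I" using \<open>{} \<in> \<Delta>\<close> by (simp add: sr_ideal_def)
    then show "\<one>\<^bsub>Q.R\<^esub> \<noteq> \<zero>\<^bsub>Q.R\<^esub>" by (simp add: Q.\<pi>_simps Q.\<pi>_eq_iff)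
  next
    fix n P assume P: "prime_chain Q.R n P"
    have Pp: "primeideal (P i) Q.R" if "i \<le> n" for i using P that by (simp add: prime_chain_def)
    have Pi: "ideal (P i) Q.R" if "i \<le> n" for i using Pp[OF that] by (simp add: primeideal_def)
    show "n \<le> r"
    proof (rule prime_chain_length_le[where P = "\<lambda>i. Q.pre (P i)" and V = V])
      show "finite \<Delta>" by (rule finite_complex)
      show "finite F \<and> card F \<le> r" if "F \<in> \<Delta>" for F using finite_face[OF that] card_face_le[OF that] by simp
      show "prime_of (poly_carrier V) (Q.pre (P i))" if "i \<le> n" for i by (rule Q.prime_of_pre[OF Pp[OF that]])
      show "Q.pre (P i) \<subset> Q.pre (P (Suc i))" if i: "i < n" for i
      proof -
        have 1: "ideal (P i) Q.R" "ideal (P (Suc i)) Q.R" using i by (simp_all add: Pi)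
        have "P i \<subset> P (Suc i)" using P i by (simp add: prime_chain_def)
        then show ?thesis
          using Q.pre_subset_iff[OF 1(1,2)] Q.pre_subset_iff[OF 1(2,1)] by (simp add: less_le_not_le)
      qed
      show "?I \<subseteq> Q.pre (P 0)" by (rule Q.pre_ideal(2)[OF Pi]) simp
    qed
  next
    fix M assume M: "maximalideal M Q.R"
    have Mi: "ideal M Q.R" using M by (simp add: maximalideal_def)
    have Mp: "prime_of (poly_carrier V) (Q.pre M)"
      by (rule Q.prime_of_pre[OF cring.maximalideal_prime[OF Q.cring_R M]])
    have "\<forall>i. \<exists>f. i \<in> {1..r} \<longrightarrow> f \<noteq> 0 \<and> eval_poly f (?\<theta> i) \<in> Q.pre M"
      using zariski[OF finite_V Mp Q.maximal_pre[OF M] \<theta>] by blast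
    then obtain f where f: "\<And>i. i \<in> {1..r} \<Longrightarrow> f i \<noteq> 0 \<and> eval_poly (f i) (?\<theta> i) \<in> Q.pre M" by metis
    define xs where "xs = map (\<lambda>i. eval_poly (f i) (?\<theta> i)) ?is"
    have xsC: "set xs \<subseteq> poly_carrier V" unfolding xs_def using \<theta> set_is by (auto simp del: upt_Suc intro!: eval_poly_in_poly_carrier)
    have xsM: "set (map Q.\<pi> xs) \<subseteq> M" unfolding xs_def using f set_is by (auto simp del: upt_Suc simp: Q.pre_def)
    have "weakly_regular (poly_carrier V) ?I xs"
      unfolding xs_def
    proof (rule block_sums_regular[where z = z])
      show "finite V" by (rule finite_V)
      show "distinct ?is" by simp
      show "V \<subseteq> (\<Union>i\<in>set ?is. C i)" unfolding set_is cover by simp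
      show "card e = 2" if "e \<in> E" for e using E2[OF that] by simp
    qed (unfold set_is, use CV disjoint block_clique f z_in z_free in \<open>blast+\<close>)
    then have "regular_sequence Q.R (map Q.\<pi> xs)"
      using maximalideal.I_notcarr[OF M] by (intro Q.regular_sequence_R[OF xsC _ Mi _ xsM]) auto
    moreover have "length (map Q.\<pi> xs) = r" by (simp add: xs_def del: upt_Suc)
    ultimately show "\<exists>xs. regular_sequence Q.R xs \<and> set xs \<subseteq> M \<and> length xs = r" using xsM by blast
  qed
qed

end

section \<open>Hybrid graphs\<close>

theorem theorem0p1:
  fixes n r :: nat
    and G :: "vertex sgraph"
    and A B :: "nat \<Rightarrow> vertex set"
    and s :: "nat \<Rightarrow> nat"
  defines "G' \<equiv> hybrid_graph G r A B"
  defines "S \<equiv> (polynomial_ring (XVar ` {1..n} \<union> (\<Union>i\<in>{1..r}. YVar i ` {1..s i}))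
                 :: ((vertex \<Rightarrow>\<^sub>0 nat) \<Rightarrow>\<^sub>0 'k::field) ring)"
  assumes "simple_graph G" and "verts G = XVar ` {1..n}"
    and "(\<Union>i\<in>{1..r}. A i) = verts G" and "disjoint_family_on A {1..r}"
    and "\<And>i. i \<in> {1..r} \<Longrightarrow> clique G (A i)"
    and "\<And>i. i \<in> {1..r} \<Longrightarrow> s i \<ge> 1"
    and "\<And>i. i \<in> {1..r} \<Longrightarrow> B i = YVar i ` {1..s i}"
  shows "(pure_complex (independence_complex G') \<and> shellable (independence_complex G') \<and>
          complex_dim (independence_complex G') = int r - 1) \<and>
         (cohen_macaulay (S Quot (edge_ideal G')) \<and> krull_dim (S Quot (edge_ideal G')) = enat r)"
proof -
  note G = assms(3) and vG = assms(4) and UA = assms(5) and dA = assms(6) and s = assms(8) and B = assms(9)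
  have V': "verts G' = XVar ` {1..n} \<union> (\<Union>i\<in>{1..r}. YVar i ` {1..s i})"
  proof -
    have "(\<Union>i\<in>{1..r}. B i) = (\<Union>i\<in>{1..r}. YVar i ` {1..s i})" by (intro SUP_cong refl B)
    then show ?thesis unfolding G'_def hybrid_graph_def vG by simp
  qed
  have E': "edges G' = edges G \<union> (\<Union>i\<in>{1..r}. {F. F \<subseteq> A i \<union> B i \<and> card F = 2})"
    by (simp add: G'_def hybrid_graph_def)
  have A: "A i \<subseteq> XVar ` {1..n}" if "i \<in> {1..r}" for i using UA that unfolding vG by blast
  have EG: "e \<subseteq> XVar ` {1..n} \<and> card e = 2" if "e \<in> edges G" for e
    using G that unfolding simple_graph_def vG by blast
  have YA: "YVar i j \<notin> A k" if "k \<in> {1..r}" for i j k using A[OF that] by blast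
  interpret clique_blocks "verts G'" "edges G'" "\<lambda>i. A i \<union> B i" "\<lambda>i. YVar i 1" r
  proof
    show "finite (verts G')" unfolding V' by simp
    have AB: "A i \<union> B i \<subseteq> verts G'" if "i \<in> {1..r}" for i
      using A[OF that] B[OF that] that unfolding V' by blast
    show "e \<subseteq> verts G' \<and> card e = 2" if "e \<in> edges G'" for e
      using that unfolding E'
    proof
      assume "e \<in> edges G"
      then show ?thesis using EG unfolding V' by blast
    next
      assume "e \<in> (\<Union>i\<in>{1..r}. {F. F \<subseteq> A i \<union> B i \<and> card F = 2})"
      then show ?thesis using AB by blast
    qed
    show "(\<Union>i\<in>{1..r}. A i \<union> B i) = verts G'"
    proof -
      have "(\<Union>i\<in>{1..r}. A i \<union> B i) = (\<Union>i\<in>{1..r}. A i) \<union> (\<Union>i\<in>{1..r}. B i)" by blast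
      then show ?thesis unfolding UA G'_def hybrid_graph_def by simp
    qed
    show "(A i \<union> B i) \<inter> (A j \<union> B j) = {}" if ij: "i \<in> {1..r}" "j \<in> {1..r}" "i \<noteq> j" for i j
    proof -
      have "A i \<inter> A j = {}" using dA ij by (rule disjoint_family_onD)
      moreover have "B i \<inter> B j = {}" unfolding B[OF ij(1)] B[OF ij(2)] using ij(3) by blast
      moreover have "A i \<inter> B j = {}" unfolding B[OF ij(2)] using YA[OF ij(1)] by blast
      moreover have "B i \<inter> A j = {}" unfolding B[OF ij(1)] using YA[OF ij(2)] by blast
      ultimately show ?thesis by blast
    qed
    show "{u, v} \<in> edges G'" if i: "i \<in> {1..r}" and uv: "u \<in> A i \<union> B i" "v \<in> A i \<union> B i" "u \<noteq> v" for i u v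
    proof -
      have "{u, v} \<in> {F. F \<subseteq> A i \<union> B i \<and> card F = 2}" using uv by simp
      then show ?thesis unfolding E' using i by blast
    qed
    show "YVar i 1 \<in> A i \<union> B i" if "i \<in> {1..r}" for i
      unfolding B[OF that] using s[OF that] by simp
    show "e \<subseteq> A i \<union> B i" if i: "i \<in> {1..r}" and e: "e \<in> edges G'" "YVar i 1 \<in> e" for i e
    proof -
      have "e \<notin> edges G" using EG[of e] e(2) by blast
      then obtain j where j: "j \<in> {1..r}" "e \<subseteq> A j \<union> B j" using e(1) unfolding E' by blast
      then have "YVar i 1 \<in> B j" using e(2) YA[OF j(1)] by blast
      then have "i = j" unfolding B[OF j(1)] by blast
      then show ?thesis using j(2) by simp
    qed
  qed
  have "edge_ideal G' = (sr_ideal (verts G') (faces (edges G') (verts G')) :: (vertex, 'k) mpol set)"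
    unfolding independence_complex_eq_faces[symmetric] by (rule edge_ideal_eq_sr_ideal[OF E2])
  then show ?thesis
    using pure_complex_faces shellable_faces complex_dim_faces cohen_macaulay_quotient[where 'k='k]
    unfolding independence_complex_eq_faces S_def V'[symmetric] by simp
qed

end
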